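(* Let $n\ge 3$ and let $\mathbf{p}$ be a vector of the Minkowski spacetime $\mathbb{R}^{1,n}$. Then there exist a compact set $K\subset\mathbb{R}^n$ and a Riemannian metric $g$ defined on $\mathbb{R}^n\setminus K$ which is asymptotically hyperbolic (with spherical conformal infinity) and conformally flat, with constant scalar curvature $R_g=-n(n-1)$, such that the energy-momentum vector of $g$ exists and coincides with $\mathbf{p}$.
   Context: $\mathbb{R}^{1,n}$ is $\mathbb{R}^{n+1}$ with the form $\eta$ of signature $(+,-,\dots,-)$. Asymptotically hyperbolic (A.H.). A Riemannian $n$-manifold $(M,g)$ is conformally compact if there is a smooth compact manifold $\bar M$ with interior $\mathring M$ and boundary $\partial\bar M=\partial M\cup\partial_\infty M$, $M=\mathring M\cup\partial M$, and a smooth function $\rho:\bar M\to\mathbb{R}_+$ (defining function) with $\rho^{-1}(0)=\partial_\infty M$, $d\rho\neq 0$ on $\partial_\infty M$, such that $\bar g=\rho^2 g$ extends to a smooth metric on $\bar M$. It is asymptotically hyperbolic if moreover $|d\rho|_{\bar g}=1$ on $\partial_\infty M$. For a metric on $\mathbb{R}^n\setminus K$, these conditions concern the end at infinity of $\mathbb{R}^n$, whose boundary at infinity $\partial_\infty M$ is $\mathbb{S}^{n-1}$ with (a metric conformal to) the round metric; no completeness is required towards $K$. Hyperbolic background. In polar coordinates on $\mathbb{R}^n$, the hyperbolic metric is $b=\frac{dr^2}{1+r^2}+r^2\sigma_{n-1}$, where $\sigma_{n-1}$ is the round metric of the unit sphere $\mathbb{S}^{n-1}$; $x^i$ are the Cartesian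 coordinates ($r^2=\sum_i (x^i)^2$). Put $V_{(0)}=\sqrt{1+r^2}$ and $V_{(i)}=x^i$, $i=1,\dots,n$. Energy-momentum vector. Let $\Phi:[R_0,\infty)\times\mathbb{S}^{n-1}\to M_{ext}$ be a diffeomorphism onto the complement of a compact region of the end (a chart at infinity) for which $e=\Phi^*g-b$ decays suitably: $|e|_b+|\nabla e|_b=O(r^{-\tau})$ for some $\tau>n/2$. For $V\in\{V_{(0)},\dots,V_{(n)}\}$ let $$H_\Phi(V)=\lim_{R\to+\infty}\int_{\{r=R\}}\mathbb{U}(V,e)(\nu_r)\,dS_r,\qquad \mathbb{U}(V,e)=V\big(\mathrm{div}\,e-d(\mathrm{tr}\,e)\big)-\iota_{\nabla V}e+(\mathrm{tr}\,e)\,dV,$$ where divergence, trace, gradient, the outward unit normal $\nu_r$ and the induced measure $dS_r$ are those of $b$. The energy-momentum vector of $g$ (relative to the chart $\Phi$) is $\mathbf{p_g}=(p_{(0)},\dots,p_{(n)})$ with $p_{(\mu)}=H_\Phi(V_{(\mu)})$; it exists when these limits exist and are finite. Changing $\Phi$ changes $\mathbf{p_g}$ by an element of $O(1,n)$. The statement is that $\mathbf{p_g}=\mathbf{p}$ for some chart at infinity $\Phi:[R_0,\infty)\times\mathbb{S}^{n-1}\to M_{ext}$ satisfying $|\Phi^*g-b|_b+|\nabla(\Phi^*g-b)|_b=O(r^{-\tau})$ for some $\tau>n/2$. *)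

theory Defs
  imports "HOL-Analysis.Analysis" "HOL-Library.Landau_Symbols"
begin

text \<open>
  Everything lives on subsets of \<open>real ^ 'n\<close> (dimension \<open>n = CARD('n)\<close>). Tensor fields are given by
  their components in Cartesian coordinates; a symmetric 2-tensor field is matrix valued, with
  \<open>g x $ i $ j\<close> the value of \<open>g\<close> on the \<open>i\<close>-th and \<open>j\<close>-th coordinate vector fields.
\<close>

section \<open>Smoothness and diffeomorphisms\<close>

definition partial :: "'n \<Rightarrow> (real^'n \<Rightarrow> 'b::real_normed_vector) \<Rightarrow> real^'n \<Rightarrow> 'b"
  where "partial i f x = frechet_derivative f (at x) (axis i 1)"

primrec Ck_on :: "nat \<Rightarrow> (real^'n) set \<Rightarrow> (real^'n \<Rightarrow> 'b::real_normed_vector) \<Rightarrow> bool"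
  where
    "Ck_on 0 U f \<longleftrightarrow> continuous_on U f"
  | "Ck_on (Suc k) U f \<longleftrightarrow> f differentiable_on U \<and> (\<forall>i. Ck_on k U (partial i f))"

text \<open>
  For a set that is not open (a domain with boundary), smooth means being the restriction of a smooth
  map on an open neighbourhood. The total function is required to be that extension itself, so that
  its derivatives at boundary points are the ordinary ones.
\<close>

definition smooth_on :: "(real^'n) set \<Rightarrow> (real^'n \<Rightarrow> 'b::real_normed_vector) \<Rightarrow> bool"
  where "smooth_on S f \<longleftrightarrow> (\<exists>U. open U \<and> S \<subseteq> U \<and> (\<forall>k. Ck_on k U f))"

definition diffeomorphism ::
  "(real^'n) set \<Rightarrow> (real^'n) set \<Rightarrow> (real^'n \<Rightarrow> real^'n) \<Rightarrow> (real^'n \<Rightarrow> real^'n) \<Rightarrow> bool"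
  where "diffeomorphism S T f h \<longleftrightarrow> homeomorphism S T f h \<and> smooth_on S f \<and> smooth_on T h"

section \<open>Riemannian geometry in coordinates\<close>

definition riemannian_metric_on :: "(real^'n) set \<Rightarrow> (real^'n \<Rightarrow> real^'n^'n) \<Rightarrow> bool"
  where "riemannian_metric_on S g \<longleftrightarrow> smooth_on S g \<and>
    (\<forall>x\<in>S. transpose (g x) = g x \<and> (\<forall>v. v \<noteq> 0 \<longrightarrow> v \<bullet> (g x *v v) > 0))"

definition pullback :: "(real^'n \<Rightarrow> real^'n) \<Rightarrow> (real^'n \<Rightarrow> real^'n^'n) \<Rightarrow> real^'n \<Rightarrow> real^'n^'n"
  where "pullback \<phi> g x = transpose (jacobian \<phi> (at x)) ** g (\<phi> x) ** jacobian \<phi> (at x)"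

definition christoffel :: "(real^'n \<Rightarrow> real^'n^'n) \<Rightarrow> 'n \<Rightarrow> 'n \<Rightarrow> 'n \<Rightarrow> real^'n \<Rightarrow> real"
  where "christoffel g k i j x = (1/2) * (\<Sum>l\<in>UNIV. matrix_inv (g x) $ k $ l *
      (partial i (\<lambda>y. g y $ j $ l) x + partial j (\<lambda>y. g y $ i $ l) x - partial l (\<lambda>y. g y $ i $ j) x))"

definition ricci :: "(real^'n \<Rightarrow> real^'n^'n) \<Rightarrow> 'n \<Rightarrow> 'n \<Rightarrow> real^'n \<Rightarrow> real"
  where "ricci g i j x =
      (\<Sum>k\<in>UNIV. partial k (christoffel g k i j) x - partial j (christoffel g k i k) x) +
      (\<Sum>k\<in>UNIV. \<Sum>l\<in>UNIV. christoffel g k k l x * christoffel g l i j x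
                      - christoffel g k j l x * christoffel g l i k x)"

definition scalar_curvature :: "(real^'n \<Rightarrow> real^'n^'n) \<Rightarrow> real^'n \<Rightarrow> real"
  where "scalar_curvature g x = (\<Sum>i\<in>UNIV. \<Sum>j\<in>UNIV. matrix_inv (g x) $ i $ j * ricci g i j x)"

definition conformally_flat_on :: "(real^'n) set \<Rightarrow> (real^'n \<Rightarrow> real^'n^'n) \<Rightarrow> bool"
  where "conformally_flat_on M g \<longleftrightarrow> (\<forall>x\<in>M. \<exists>W W' \<phi> \<phi>' f.
      open W \<and> x \<in> W \<and> W \<subseteq> M \<and> open W' \<and> diffeomorphism W W' \<phi> \<phi>' \<and>
      smooth_on W f \<and> (\<forall>y\<in>W. f y > 0) \<and>
      (\<forall>y\<in>W. g y = f y *\<^sub>R pullback \<phi> (\<lambda>_. mat 1) y))"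

text \<open>The pointwise norm with respect to \<open>g\<close> of a 2-tensor field and of its covariant derivative.\<close>

definition tensor_norm :: "(real^'n \<Rightarrow> real^'n^'n) \<Rightarrow> (real^'n \<Rightarrow> real^'n^'n) \<Rightarrow> real^'n \<Rightarrow> real"
  where "tensor_norm g e x = sqrt (\<Sum>i\<in>UNIV. \<Sum>j\<in>UNIV. \<Sum>k\<in>UNIV. \<Sum>l\<in>UNIV.
      matrix_inv (g x) $ i $ k * matrix_inv (g x) $ j $ l * e x $ i $ j * e x $ k $ l)"

definition cov_deriv ::
  "(real^'n \<Rightarrow> real^'n^'n) \<Rightarrow> (real^'n \<Rightarrow> real^'n^'n) \<Rightarrow> 'n \<Rightarrow> 'n \<Rightarrow> 'n \<Rightarrow> real^'n \<Rightarrow> real"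
  where "cov_deriv g e k i j x = partial k (\<lambda>y. e y $ i $ j) x
      - (\<Sum>l\<in>UNIV. christoffel g l k i x * e x $ l $ j + christoffel g l k j x * e x $ i $ l)"

definition cov_deriv_norm :: "(real^'n \<Rightarrow> real^'n^'n) \<Rightarrow> (real^'n \<Rightarrow> real^'n^'n) \<Rightarrow> real^'n \<Rightarrow> real"
  where "cov_deriv_norm g e x = sqrt (\<Sum>i\<in>UNIV. \<Sum>j\<in>UNIV. \<Sum>k\<in>UNIV. \<Sum>i'\<in>UNIV. \<Sum>j'\<in>UNIV. \<Sum>k'\<in>UNIV.
      matrix_inv (g x) $ k $ k' * matrix_inv (g x) $ i $ i' * matrix_inv (g x) $ j $ j' *
      cov_deriv g e k i j x * cov_deriv g e k' i' j' x)"

definition tensor_trace :: "(real^'n \<Rightarrow> real^'n^'n) \<Rightarrow> (real^'n \<Rightarrow> real^'n^'n) \<Rightarrow> real^'n \<Rightarrow> real"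
  where "tensor_trace g e x = (\<Sum>i\<in>UNIV. \<Sum>j\<in>UNIV. matrix_inv (g x) $ i $ j * e x $ i $ j)"

definition divergence :: "(real^'n \<Rightarrow> real^'n^'n) \<Rightarrow> (real^'n \<Rightarrow> real^'n^'n) \<Rightarrow> 'n \<Rightarrow> real^'n \<Rightarrow> real"
  where "divergence g e j x = (\<Sum>i\<in>UNIV. \<Sum>k\<in>UNIV. matrix_inv (g x) $ i $ k * cov_deriv g e i k j x)"

definition gradient :: "(real^'n \<Rightarrow> real^'n^'n) \<Rightarrow> (real^'n \<Rightarrow> real) \<Rightarrow> real^'n \<Rightarrow> real^'n"
  where "gradient g V x = matrix_inv (g x) *v (\<chi> i. partial i V x)"

section \<open>Asymptotically hyperbolic ends\<close>

text \<open>
  The end at infinity of the complement of \<open>K\<close>: a set \<open>M_ext\<close> is a neighbourhood of infinity in that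
  end if only a bounded region is left out.
\<close>

definition exterior_region :: "(real^'n) set \<Rightarrow> (real^'n) set \<Rightarrow> bool"
  where "exterior_region K M_ext \<longleftrightarrow> M_ext \<subseteq> - K \<and> bounded (- M_ext)"

text \<open>
  Conformal compactness of an end of the form \<open>M_ext\<close>, with boundary at infinity a sphere.
  The compact manifold with boundary is the closed annulus \<open>c \<le> norm y \<le> 1\<close>, with inner boundary
  sphere corresponding to the boundary of \<open>M_ext\<close> and with \<open>norm y = 1\<close> the boundary at infinity;
  \<open>\<psi>\<close> identifies the annulus minus the latter with \<open>M_ext\<close>.
  The field \<open>gbar\<close> is the smooth extension of \<open>\<rho>\<^sup>2 g\<close>.
\<close>

definition conformal_compactification ::
  "(real^'n) set \<Rightarrow> (real^'n \<Rightarrow> real^'n^'n) \<Rightarrow> real \<Rightarrow> (real^'n \<Rightarrow> real^'n) \<Rightarrow>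
    (real^'n \<Rightarrow> real) \<Rightarrow> (real^'n \<Rightarrow> real^'n^'n) \<Rightarrow> bool"
  where "conformal_compactification K g c \<psi> \<rho> gbar \<longleftrightarrow>
    0 < c \<and> c < 1 \<and>
    (\<exists>M_ext \<psi>'. exterior_region K M_ext \<and>
      diffeomorphism {y. c \<le> norm y \<and> norm y < 1} M_ext \<psi> \<psi>') \<and>
    smooth_on {y. c \<le> norm y \<and> norm y \<le> 1} \<rho> \<and>
    (\<forall>y. c \<le> norm y \<and> norm y \<le> 1 \<longrightarrow> \<rho> y \<ge> 0 \<and> (\<rho> y = 0 \<longleftrightarrow> norm y = 1)) \<and>
    (\<forall>y. norm y = 1 \<longrightarrow> (\<exists>i. partial i \<rho> y \<noteq> 0)) \<and>
    riemannian_metric_on {y. c \<le> norm y \<and> norm y \<le> 1} gbar \<and>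
    (\<forall>y. c \<le> norm y \<and> norm y < 1 \<longrightarrow> gbar y = (\<rho> y)\<^sup>2 *\<^sub>R pullback \<psi> g y)"

text \<open>
  The last clause: the metric induced by \<open>gbar\<close> on the boundary at infinity is conformal to the
  round metric of the unit sphere.
\<close>

definition asymptotically_hyperbolic_spherical ::
  "(real^'n) set \<Rightarrow> (real^'n \<Rightarrow> real^'n^'n) \<Rightarrow> bool"
  where "asymptotically_hyperbolic_spherical K g \<longleftrightarrow> (\<exists>c \<psi> \<rho> gbar.
    conformal_compactification K g c \<psi> \<rho> gbar \<and>
    (\<forall>y. norm y = 1 \<longrightarrow>
      sqrt (\<Sum>i\<in>UNIV. \<Sum>j\<in>UNIV. matrix_inv (gbar y) $ i $ j * partial i \<rho> y * partial j \<rho> y) = 1) \<and>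
    (\<forall>y. norm y = 1 \<longrightarrow>
      (\<exists>s>0. \<forall>v w. v \<bullet> y = 0 \<and> w \<bullet> y = 0 \<longrightarrow> v \<bullet> (gbar y *v w) = s * (v \<bullet> w))))"

section \<open>The hyperbolic background\<close>

text \<open>
  Since the Euclidean metric is \<open>dr\<^sup>2 + r\<^sup>2 \<sigma>\<close> and \<open>dr = (\<Sum>i. x\<^sup>i dx\<^sup>i) / r\<close>, the hyperbolic metric
  \<open>dr\<^sup>2 / (1 + r\<^sup>2) + r\<^sup>2 \<sigma>\<close> has the following Cartesian components; see \<open>hyp_metric_polar\<close> below.
\<close>

definition hyp_metric :: "real^'n \<Rightarrow> real^'n^'n"
  where "hyp_metric x = (\<chi> i j. (if i = j then 1 else 0) - x $ i * x $ j / (1 + (norm x)\<^sup>2))"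

lemma hyp_metric_mult: "hyp_metric x *v v = v - ((x \<bullet> v) / (1 + (norm x)\<^sup>2)) *\<^sub>R x"
proof -
  have "(hyp_metric x *v v) $ i = (v - ((x \<bullet> v) / (1 + (norm x)\<^sup>2)) *\<^sub>R x) $ i" for i
  proof -
    have "(hyp_metric x *v v) $ i =
        (\<Sum>j\<in>UNIV. (if i = j then v $ j else 0) - x $ i / (1 + (norm x)\<^sup>2) * (x $ j * v $ j))"
      unfolding hyp_metric_def matrix_vector_mult_def vec_lambda_beta
      by (rule sum.cong) (auto simp: left_diff_distrib)
    also have "\<dots> = v $ i - x $ i / (1 + (norm x)\<^sup>2) * (x \<bullet> v)"
      by (simp add: sum_subtractf inner_vec_def sum_distrib_left)
    finally show ?thesis by (simp add: mult.commute)
  qed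
  then show ?thesis by (simp add: vec_eq_iff)
qed

text \<open>
  The radial part of \<open>v\<close> is \<open>dr(v) = (x \<bullet> v) / norm x\<close>, and \<open>r\<^sup>2 \<sigma>\<close> is the squared Euclidean norm of
  the part of \<open>v\<close> tangent to the sphere.
\<close>

lemma hyp_metric_polar:
  assumes "x \<noteq> 0"
  shows "v \<bullet> (hyp_metric x *v v) =
    ((x \<bullet> v) / norm x)\<^sup>2 / (1 + (norm x)\<^sup>2) + (norm (v - ((x \<bullet> v) / (norm x)\<^sup>2) *\<^sub>R x))\<^sup>2"
proof -
  define m d where "m = (norm x)\<^sup>2" and "d = x \<bullet> v"
  have m: "m > 0" "1 + m > 0" "x \<bullet> x = m"
    using assms by (simp_all add: m_def power2_norm_eq_inner add_pos_pos)
  have "(norm (v - (d / m) *\<^sub>R x))\<^sup>2 = v \<bullet> v - 2 * (d / m) * d + (d / m) * (d / m) * m"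
    unfolding power2_norm_eq_inner
    by (simp add: inner_diff_left inner_diff_right inner_commute[of v x] m(3) flip: d_def)
  also have "\<dots> = v \<bullet> v - d\<^sup>2 / m"
    using m by (simp add: power2_eq_square)
  finally have 1: "(norm (v - (d / m) *\<^sub>R x))\<^sup>2 = v \<bullet> v - d\<^sup>2 / m" .
  have "v \<bullet> (hyp_metric x *v v) = v \<bullet> v - d / (1 + m) * d"
    by (simp add: hyp_metric_mult inner_diff_right inner_commute[of v x] flip: d_def m_def)
  also have "\<dots> = d\<^sup>2 / m / (1 + m) + (v \<bullet> v - d\<^sup>2 / m)"
    using m by (simp add: power2_eq_square divide_simps) (simp add: algebra_simps)
  finally show ?thesis
    using 1 by (simp add: power_divide flip: d_def m_def)
qed

text \<open>
  The function \<open>V\<^sub>(\<^sub>0\<^sub>)\<close> has index \<open>None\<close> and \<open>V\<^sub>(\<^sub>i\<^sub>)\<close> has index \<open>Some i\<close>. Accordingly, vectors of the Minkowski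
  spacetime of dimension \<open>n + 1\<close> are elements of \<open>real ^ 'n option\<close>, with time component \<open>None\<close>.
\<close>

fun static_potential :: "'n option \<Rightarrow> real^'n \<Rightarrow> real"
  where
    "static_potential None x = sqrt (1 + (norm x)\<^sup>2)"
  | "static_potential (Some i) x = x $ i"

text \<open>The outward unit normal, with respect to the hyperbolic metric, of the sphere centred at 0 through \<open>x\<close>.\<close>

definition sphere_normal :: "real^'n \<Rightarrow> real^'n"
  where "sphere_normal x = (sqrt (1 + (norm x)\<^sup>2) / norm x) *\<^sub>R x"

lemma sphere_normal_unit_outward:
  assumes "x \<noteq> 0"
  shows "sphere_normal x \<bullet> (hyp_metric x *v sphere_normal x) = 1"
    and "v \<bullet> x = 0 \<Longrightarrow> v \<bullet> (hyp_metric x *v sphere_normal x) = 0"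
    and "sphere_normal x \<bullet> x > 0"
proof -
  let ?s = "sqrt (1 + (norm x)\<^sup>2)"
  have n: "norm x > 0" "1 + (norm x)\<^sup>2 > 0" "?s > 0" "?s * ?s = 1 + (norm x)\<^sup>2"
    using assms by (simp_all add: add_pos_nonneg)
  have xx: "x \<bullet> x = (norm x)\<^sup>2" by (simp add: power2_norm_eq_inner)
  have xs: "x \<bullet> sphere_normal x = ?s * norm x"
    using n by (simp add: sphere_normal_def xx power2_eq_square)
  show "sphere_normal x \<bullet> x > 0"
    using n xs by (simp add: inner_commute)
  have ss: "sphere_normal x \<bullet> sphere_normal x = 1 + (norm x)\<^sup>2"
  proof -
    have "sphere_normal x \<bullet> sphere_normal x = (?s * ?s) * ((norm x)\<^sup>2 / (norm x * norm x))"
      by (simp add: sphere_normal_def xx)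
    then show ?thesis using n by (simp add: power2_eq_square)
  qed
  have "sphere_normal x \<bullet> (hyp_metric x *v sphere_normal x) =
      1 + (norm x)\<^sup>2 - (?s * norm x) * (?s * norm x) / (1 + (norm x)\<^sup>2)"
    by (simp add: hyp_metric_mult inner_diff_right ss xs inner_commute[of "sphere_normal x" x])
  also have "(?s * norm x) * (?s * norm x) = (1 + (norm x)\<^sup>2) * (norm x)\<^sup>2"
    using n(4) by (metis mult.assoc mult.left_commute power2_eq_square)
  finally show "sphere_normal x \<bullet> (hyp_metric x *v sphere_normal x) = 1"
    using n by simp
  show "v \<bullet> (hyp_metric x *v sphere_normal x) = 0" if "v \<bullet> x = 0"
    using that by (simp add: hyp_metric_mult inner_diff_right sphere_normal_def)
qed

text \<open>
  The measure induced on the sphere of radius \<open>R\<close>. The hyperbolic metric restricts to \<open>R\<^sup>2 \<sigma>\<close> there, so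
  this is \<open>R ^ (n - 1)\<close> times the measure of the unit sphere, transported by the dilation by \<open>R\<close>. The
  measure of the unit sphere is, by integration in polar coordinates, \<open>n\<close> times the image of Lebesgue
  measure on the unit ball under the radial projection.
\<close>

definition sphere_measure :: "real \<Rightarrow> (real^'n) measure"
  where "sphere_measure R =
    distr (density lborel (\<lambda>x. ennreal (R ^ (CARD('n) - 1) * real CARD('n) * indicator (ball 0 1) x)))
      borel (\<lambda>x. (R / norm x) *\<^sub>R x)"

section \<open>The energy-momentum vector\<close>

text \<open>The 1-form \<open>\<bbbU>(V, e)\<close> with respect to the hyperbolic metric, evaluated on a vector \<open>X\<close> at \<open>x\<close>.\<close>

definition charge_form ::
  "(real^'n \<Rightarrow> real) \<Rightarrow> (real^'n \<Rightarrow> real^'n^'n) \<Rightarrow> real^'n \<Rightarrow> real^'n \<Rightarrow> real"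
  where "charge_form V e x X = (\<Sum>j\<in>UNIV. X $ j *
    (V x * (divergence hyp_metric e j x - partial j (tensor_trace hyp_metric e) x)
     - (\<Sum>i\<in>UNIV. gradient hyp_metric V x $ i * e x $ i $ j)
     + tensor_trace hyp_metric e x * partial j V x))"

text \<open>
  A chart at infinity is defined on \<open>[R0, \<infinity>) \<times> S\<close>, with \<open>S\<close> the unit sphere, which polar coordinates
  identify with \<open>{x. R0 \<le> norm x}\<close>.
\<close>

definition chart_at_infinity :: "(real^'n) set \<Rightarrow> real \<Rightarrow> (real^'n \<Rightarrow> real^'n) \<Rightarrow> bool"
  where "chart_at_infinity K R0 \<Phi> \<longleftrightarrow> R0 > 0 \<and>
    (\<exists>M_ext \<Phi>'. exterior_region K M_ext \<and> diffeomorphism {x. R0 \<le> norm x} M_ext \<Phi> \<Phi>')"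

definition metric_deviation ::
  "(real^'n \<Rightarrow> real^'n) \<Rightarrow> (real^'n \<Rightarrow> real^'n^'n) \<Rightarrow> real^'n \<Rightarrow> real^'n^'n"
  where "metric_deviation \<Phi> g x = pullback \<Phi> g x - hyp_metric x"

definition asymptotic_decay :: "(real^'n \<Rightarrow> real^'n) \<Rightarrow> (real^'n \<Rightarrow> real^'n^'n) \<Rightarrow> real \<Rightarrow> bool"
  where "asymptotic_decay \<Phi> g \<tau> \<longleftrightarrow>
    (\<lambda>x. tensor_norm hyp_metric (metric_deviation \<Phi> g) x
       + cov_deriv_norm hyp_metric (metric_deviation \<Phi> g) x) \<in> O[at_infinity](\<lambda>x. norm x powr (- \<tau>))"

text \<open>
  The measure is carried by the sphere; integrating over the set \<open>sphere 0 R\<close> makes the integrand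
  irrelevant (also for measurability) outside the domain of the chart.
\<close>

definition has_energy_momentum_in_chart ::
  "(real^'n \<Rightarrow> real^'n) \<Rightarrow> (real^'n \<Rightarrow> real^'n^'n) \<Rightarrow> real^('n option) \<Rightarrow> bool"
  where "has_energy_momentum_in_chart \<Phi> g p \<longleftrightarrow> (\<forall>\<mu>.
    ((\<lambda>R. LINT x : sphere 0 R | sphere_measure R.
            charge_form (static_potential \<mu>) (metric_deviation \<Phi> g) x (sphere_normal x))
      \<longlongrightarrow> p $ \<mu>) at_top)"

definition has_energy_momentum ::
  "(real^'n) set \<Rightarrow> (real^'n \<Rightarrow> real^'n^'n) \<Rightarrow> real^('n option) \<Rightarrow> bool"
  where "has_energy_momentum K g p \<longleftrightarrow> (\<exists>R0 \<Phi> \<tau>. chart_at_infinity K R0 \<Phi> \<and>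
    \<tau> > real CARD('n) / 2 \<and> asymptotic_decay \<Phi> g \<tau> \<and> has_energy_momentum_in_chart \<Phi> g p)"

end

theory Submission
  imports Defs "HOL-Real_Asymp.Real_Asymp"
begin

text \<open>
  The metric is \<open>g = F\<^sup>-\<^sup>2 b\<close> with \<open>b\<close> hyperbolic and \<open>F = 1 + v\<close>. Its scalar curvature is \<open>-n(n-1)\<close> iff
  \<open>(2/n) F \<Delta>F = F\<^sup>2 + |dF|\<^sup>2 - 1\<close>, a quadratic equation whose linearisation \<open>\<Delta>v = n v\<close> has the decaying
  solutions \<open>v \<sim> r\<^sup>-\<^sup>n f(\<theta>)\<close>, with \<open>f\<close> arbitrary on the sphere at infinity. Functions of
  \<open>s = 1 / sqrt (1 + r\<^sup>2)\<close> and \<open>t = s (w \<cdot> x)\<close> are preserved by \<open>\<Delta>\<close> and \<open>|d\<cdot>|\<^sup>2\<close>, so one can look for a power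
  series \<open>v = \<Sum>k\<ge>n. s\<^sup>k p\<^sub>k(t)\<close>. The polynomial \<open>p\<^sub>n\<close> is free and \<open>p\<^sub>k\<close> has degree at most \<open>k\<close>; since the
  indicial factor \<open>(k-n)(k+1)\<close> is of order \<open>k\<^sup>2\<close>, it absorbs the two derivatives in \<open>t\<close>, and the series
  converges near \<open>s = 0\<close>, that is, outside a large ball.

  With \<open>p\<^sub>n(t) = \<alpha> + t\<close> the energy-momentum vector is \<open>-2(n\<^sup>2-1) \<integral> (\<alpha> + w \<cdot> \<theta>) (1, \<theta>) d\<theta>\<close>. The functions \<open>1\<close>
  and \<open>\<theta>\<^sub>i\<close> are linearly independent, so their Gram matrix is invertible and \<open>(\<alpha>, w)\<close> can be chosen to
  produce any vector. In the ball model \<open>x = 2z / (1 - |z|\<^sup>2)\<close> with \<open>\<rho> = (1 - |z|\<^sup>2) / 2\<close>, the metric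
  \<open>\<rho>\<^sup>2 g\<close> is \<open>F\<^sup>-\<^sup>2\<close> times the Euclidean one and \<open>F = 1\<close> on the unit sphere.
\<close>

text \<open>Nothing restricts the prescribed vector because g is never extended over K: no positive
  mass theorem applies, and the problem lives entirely at infinity, where a convergent expansion
  replaces elliptic theory. Writing the conformal factor as an inverse square, instead of the usual
  power 4/(n-2) of a function, makes the equation polynomial in F and its derivatives, so the
  coefficients obey a recursion made of finite convolutions. The indicial roots are n and -1: no
  order above n is resonant and no logarithms appear.

  The obstacle is the loss of derivatives in t. For the absorption to work, a derivative of a
  polynomial of degree k must cost only a factor k. The supremum norm on an interval may cost k^2 by
  Markov's inequality, so coefficients are measured by a weighted sum of their absolute values.

  The series also converges for negative s. In the ball model s changes sign across the unit sphere,
  so the solution continues smoothly beyond the boundary at infinity and the compactification needs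
  no separate boundary regularity argument.\<close>

section \<open>A weighted coefficient norm on polynomials\<close>

definition pnorm :: "real \<Rightarrow> real poly \<Rightarrow> real"
  where "pnorm B p = poly (map_poly abs p) B"

lemma pnorm_0 [simp]: "pnorm B 0 = 0"
  by (simp add: pnorm_def)

lemma pnorm_pCons [simp]: "pnorm B (pCons a p) = \<bar>a\<bar> + B * pnorm B p"
  by (simp add: pnorm_def map_poly_pCons)

lemma pnorm_nonneg [simp]: "0 \<le> B \<Longrightarrow> 0 \<le> pnorm B p"
  by (induction p) auto

lemma abs_poly_le_pnorm: "\<bar>t\<bar> \<le> B \<Longrightarrow> \<bar>poly p t\<bar> \<le> pnorm B p"
proof (induction p)
  case (pCons a p)
  have "\<bar>a + t * poly p t\<bar> \<le> \<bar>a\<bar> + \<bar>t\<bar> * \<bar>poly p t\<bar>"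
    by (metis abs_mult abs_triangle_ineq)
  also have "\<bar>t\<bar> * \<bar>poly p t\<bar> \<le> B * pnorm B p"
    using pCons by (intro mult_mono) auto
  finally show ?case by simp
qed simp

lemma pnorm_add: "0 \<le> B \<Longrightarrow> pnorm B (p + q) \<le> pnorm B p + pnorm B q"
proof (induction p q rule: poly_induct2)
  case (pCons a p b q)
  have "B * pnorm B (p + q) \<le> B * pnorm B p + B * pnorm B q"
    using pCons mult_left_mono[of _ _ B] by (metis distrib_left)
  then show ?case using abs_triangle_ineq[of a b] by simp
qed simp

lemma pnorm_smult: "pnorm B (smult c p) = \<bar>c\<bar> * pnorm B p"
  by (induction p) (auto simp: abs_mult algebra_simps)

lemma pnorm_minus: "pnorm B (- p) = pnorm B p"
  by (induction p) auto

lemma pnorm_diff: "0 \<le> B \<Longrightarrow> pnorm B (p - q) \<le> pnorm B p + pnorm B q"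
  using pnorm_add[of B p "- q"] by (simp add: pnorm_minus)

lemma pnorm_sum: "0 \<le> B \<Longrightarrow> pnorm B (\<Sum>i\<in>I. f i) \<le> (\<Sum>i\<in>I. pnorm B (f i))"
proof (induction I rule: infinite_finite_induct)
  case (insert x F)
  then show ?case using pnorm_add[of B "f x" "sum f F"] by simp
qed auto

lemma pnorm_mult: "0 \<le> B \<Longrightarrow> pnorm B (p * q) \<le> pnorm B p * pnorm B q"
proof (induction p)
  case (pCons a p)
  have "pnorm B (pCons a p * q) \<le> \<bar>a\<bar> * pnorm B q + B * pnorm B (p * q)"
    using pnorm_add[of B "smult a q" "pCons 0 (p * q)"] pCons by (simp add: pnorm_smult)
  also have "B * pnorm B (p * q) \<le> B * (pnorm B p * pnorm B q)"
    using pCons by (intro mult_left_mono) auto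
  finally show ?case by (simp add: algebra_simps)
qed simp

text \<open>Multiplied by B, the derivative has weighted coefficients i |a_i| B^i, and i is at most
  the degree. The loss is thus linear in the degree.\<close>

lemma pnorm_pderiv: "1 \<le> B \<Longrightarrow> B * pnorm B (pderiv p) \<le> real (degree p) * pnorm B p"
proof (induction p)
  case (pCons a p)
  show ?case
  proof (cases "p = 0")
    case False
    have "pnorm B (pderiv (pCons a p)) \<le> pnorm B p + B * pnorm B (pderiv p)"
      using pnorm_add[of B p "pCons 0 (pderiv p)"] pCons.prems by (simp add: pderiv_pCons)
    also have "\<dots> \<le> (real (degree p) + 1) * pnorm B p"
      using pCons by (simp add: algebra_simps)
    finally have "B * pnorm B (pderiv (pCons a p)) \<le> B * ((real (degree p) + 1) * pnorm B p)"
      using pCons.prems by (intro mult_left_mono) auto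
    also have "\<dots> \<le> (real (degree p) + 1) * pnorm B (pCons a p)"
      by (simp add: algebra_simps)
    finally show ?thesis using False by (simp add: add.commute)
  qed (simp add: pderiv_pCons)
qed simp

lemma pnorm_pderiv_le:
  assumes "1 \<le> B" "degree p \<le> m" shows "pnorm B (pderiv p) \<le> real m * pnorm B p"
proof -
  have "pnorm B (pderiv p) \<le> B * pnorm B (pderiv p)"
    using mult_right_mono[of 1 B "pnorm B (pderiv p)"] assms by simp
  also have "\<dots> \<le> real (degree p) * pnorm B p" by (rule pnorm_pderiv[OF assms(1)])
  also have "\<dots> \<le> real m * pnorm B p" using assms by (intro mult_right_mono) auto
  finally show ?thesis .
qed

section \<open>Power series with polynomial coefficients\<close>

definition pser :: "(nat \<Rightarrow> real poly) \<Rightarrow> real \<Rightarrow> real \<Rightarrow> real"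
  where "pser p s t = (\<Sum>k. poly (p k) t * s ^ k)"

text \<open>The degree bound makes a derivative in \<open>t\<close> cost no more than a factor \<open>k + m\<close>.\<close>

definition pser_conv :: "real \<Rightarrow> real \<Rightarrow> (nat \<Rightarrow> real poly) \<Rightarrow> bool"
  where "pser_conv A B p \<longleftrightarrow> 1 \<le> B \<and> (\<exists>m. \<forall>k. degree (p k) \<le> k + m) \<and>
    (\<forall>x. \<bar>x\<bar> < A \<longrightarrow> summable (\<lambda>k. pnorm B (p k) * x ^ k))"

definition pser_ds :: "(nat \<Rightarrow> real poly) \<Rightarrow> nat \<Rightarrow> real poly"
  where "pser_ds p k = smult (real (Suc k)) (p (Suc k))"

definition pser_dt :: "(nat \<Rightarrow> real poly) \<Rightarrow> nat \<Rightarrow> real poly"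
  where "pser_dt p k = pderiv (p k)"

lemma pser_conv_ds: "pser_conv A B p \<Longrightarrow> pser_conv A B (pser_ds p)"
proof -
  assume p: "pser_conv A B p"
  then obtain m where m: "\<And>k. degree (p k) \<le> k + m" by (auto simp: pser_conv_def)
  have "degree (pser_ds p k) \<le> k + (m + 1)" for k
    using m[of "Suc k"] by (simp add: pser_ds_def)
  moreover have "summable (\<lambda>k. pnorm B (pser_ds p k) * x ^ k)" if "\<bar>x\<bar> < A" for x
  proof -
    have "summable (\<lambda>n. diffs (\<lambda>k. pnorm B (p k)) n * x ^ n)"
      using p that by (intro termdiff_converges[of _ A]) (auto simp: pser_conv_def)
    then show ?thesis by (simp add: diffs_def pser_ds_def pnorm_smult)
  qed
  ultimately show ?thesis using p unfolding pser_conv_def by blast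
qed

lemma summable_index_mult:
  fixes c :: "nat \<Rightarrow> real"
  assumes "\<And>x. \<bar>x\<bar> < A \<Longrightarrow> summable (\<lambda>k. c k * x ^ k)" "\<bar>x\<bar> < A"
  shows "summable (\<lambda>k. real k * c k * x ^ k)"
proof -
  have "summable (\<lambda>n. diffs c n * x ^ n)"
    using assms by (intro termdiff_converges[of _ A]) auto
  then have "summable (\<lambda>n. x * (diffs c n * x ^ n))" by (rule summable_mult)
  then have "summable (\<lambda>n. real (Suc n) * c (Suc n) * x ^ Suc n)"
    by (simp add: diffs_def algebra_simps)
  then show ?thesis by (subst (asm) summable_Suc_iff)
qed

lemma pser_conv_abs:
  assumes "pser_conv A B p" "\<bar>x\<bar> < A"
  shows "summable (\<lambda>k. pnorm B (p k) * \<bar>x\<bar> ^ k)"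
  using assms unfolding pser_conv_def by auto

lemma pser_conv_dt: "pser_conv A B p \<Longrightarrow> pser_conv A B (pser_dt p)"
proof -
  assume p: "pser_conv A B p"
  then obtain m where m: "\<And>k. degree (p k) \<le> k + m" by (auto simp: pser_conv_def)
  have B: "1 \<le> B" using p by (simp add: pser_conv_def)
  have "degree (pser_dt p k) \<le> k + m" for k
    using m[of k] by (simp add: pser_dt_def degree_pderiv)
  moreover have "summable (\<lambda>k. pnorm B (pser_dt p k) * x ^ k)" if "\<bar>x\<bar> < A" for x
  proof (rule summable_comparison_test')
    have "summable (\<lambda>k. real k * pnorm B (p k) * \<bar>x\<bar> ^ k)"
      using p that by (intro summable_index_mult[of A]) (auto simp: pser_conv_def)
    then show "summable (\<lambda>k. real k * pnorm B (p k) * \<bar>x\<bar> ^ k + real m * (pnorm B (p k) * \<bar>x\<bar> ^ k))"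
      by (intro summable_add summable_mult pser_conv_abs[OF p that])
    show "norm (pnorm B (pser_dt p k) * x ^ k) \<le>
        real k * pnorm B (p k) * \<bar>x\<bar> ^ k + real m * (pnorm B (p k) * \<bar>x\<bar> ^ k)" if "k \<ge> 0" for k
    proof -
      have "pnorm B (pser_dt p k) * \<bar>x\<bar> ^ k \<le> (real (k + m) * pnorm B (p k)) * \<bar>x\<bar> ^ k"
        unfolding pser_dt_def by (intro mult_right_mono pnorm_pderiv_le B m) auto
      then show ?thesis using B by (simp add: abs_mult power_abs algebra_simps)
    qed
  qed
  ultimately show ?thesis using p unfolding pser_conv_def by blast
qed

lemma pser_abs_summable:
  assumes "pser_conv A B p" "\<bar>s\<bar> < A" "\<bar>t\<bar> \<le> B"
  shows "summable (\<lambda>k. \<bar>poly (p k) t * s ^ k\<bar>)"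
proof (rule summable_comparison_test'[OF pser_conv_abs[OF assms(1,2)]])
  show "norm \<bar>poly (p k) t * s ^ k\<bar> \<le> pnorm B (p k) * \<bar>s\<bar> ^ k" for k
    using abs_poly_le_pnorm[OF assms(3), of "p k"] by (auto simp: abs_mult power_abs intro: mult_right_mono)
qed

lemma pser_sums:
  assumes "pser_conv A B p" "\<bar>s\<bar> < A" "\<bar>t\<bar> \<le> B"
  shows "(\<lambda>k. poly (p k) t * s ^ k) sums pser p s t"
  unfolding pser_def using pser_abs_summable[OF assms] by (intro summable_sums) (rule summable_rabs_cancel)

text \<open>The Euler operator s d/ds multiplies the k-th term by k without shifting exponents,
  which keeps coefficient comparison simple. Absolute summability is recorded for the Cauchy
  products to come.\<close>

lemma pser_theta_sums:
  assumes "pser_conv A B p" "\<bar>s\<bar> < A" "\<bar>t\<bar> \<le> B"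
  shows "(\<lambda>k. real k * poly (p k) t * s ^ k) sums (s * pser (pser_ds p) s t)"
    and "summable (\<lambda>k. \<bar>real k * poly (p k) t * s ^ k\<bar>)"
proof -
  have "(\<lambda>k. s * (poly (pser_ds p k) t * s ^ k)) sums (s * pser (pser_ds p) s t)"
    by (intro sums_mult pser_sums[OF pser_conv_ds[OF assms(1)] assms(2,3)])
  then have "(\<lambda>k. real (Suc k) * poly (p (Suc k)) t * s ^ Suc k) sums (s * pser (pser_ds p) s t)"
    by (simp add: pser_ds_def algebra_simps)
  then show "(\<lambda>k. real k * poly (p k) t * s ^ k) sums (s * pser (pser_ds p) s t)"
    by (subst (asm) sums_Suc_iff) simp
  have "summable (\<lambda>k. \<bar>s\<bar> * \<bar>poly (pser_ds p k) t * s ^ k\<bar>)"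
    by (intro summable_mult pser_abs_summable[OF pser_conv_ds[OF assms(1)] assms(2,3)])
  then have "summable (\<lambda>k. \<bar>real (Suc k) * poly (p (Suc k)) t * s ^ Suc k\<bar>)"
    by (simp add: pser_ds_def abs_mult mult_ac)
  then show "summable (\<lambda>k. \<bar>real k * poly (p k) t * s ^ k\<bar>)"
    by (subst (asm) summable_Suc_iff)
qed

text \<open>Termwise differentiation, jointly in both variables: the series will be composed with
  functions on space, for which separate partial derivatives would not suffice.\<close>

lemma pser_has_derivative:
  assumes p: "pser_conv A B p" and st: "\<bar>s\<bar> < A" "\<bar>t\<bar> < B"
  shows "((\<lambda>z. pser p (fst z) (snd z)) has_derivative
    (\<lambda>h. fst h * pser (pser_ds p) s t + snd h * pser (pser_dt p) s t)) (at (s, t))"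
proof -
  \<comment> \<open>A radius strictly between |s| and A: on the rectangle with |s| < q the
    derivative series has a numerical majorant.\<close>
  obtain q where q: "\<bar>s\<bar> < q" "q < A" using st dense by blast
  define S where "S = {-q<..<q} \<times> {-B<..<B}"
  have S: "open S" "convex S" "(s, t) \<in> S"
    using q st by (auto simp: S_def intro!: open_Times convex_Times)
  have SD: "\<bar>fst z\<bar> < A" "\<bar>fst z\<bar> \<le> q" "\<bar>snd z\<bar> \<le> B" if "z \<in> S" for z
    using that q by (auto simp: S_def)
  have B: "1 \<le> B" using p by (simp add: pser_conv_def)
  define f where "f k z = poly (p k) (snd z) * fst z ^ k" for k and z :: "real \<times> real"
  define f' where "f' k z h = poly (p k) (snd z) * (real k * fst z ^ (k - 1) * fst h)
      + poly (pderiv (p k)) (snd z) * snd h * fst z ^ k" for k and z h :: "real \<times> real"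
  define g' where "g' z h = fst h * pser (pser_ds p) (fst z) (snd z) + snd h * pser (pser_dt p) (fst z) (snd z)"
    for z h :: "real \<times> real"
  \<comment> \<open>The two summands bound the contributions of the s-derivative and of the
    t-derivative; both sums converge at q because \<open>pser_ds\<close> and \<open>pser_dt\<close>
    keep the radius A.\<close>
  define M where "M k = pnorm B (p k) * (real k * q ^ (k - 1)) + pnorm B (pser_dt p k) * q ^ k" for k
  have q0: "\<bar>q\<bar> < A" "0 \<le> q" using q by auto
  have "summable (\<lambda>k. pnorm B (p (Suc k)) * (real (Suc k) * q ^ k))"
    using pser_conv_abs[OF pser_conv_ds[OF p] q0(1)] q0 by (simp add: pser_ds_def pnorm_smult mult_ac)
  then have "summable (\<lambda>k. pnorm B (p k) * (real k * q ^ (k - 1)))"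
    using summable_Suc_iff[of "\<lambda>k. pnorm B (p k) * (real k * q ^ (k - 1))"] by simp
  moreover have "summable (\<lambda>k. pnorm B (pser_dt p k) * q ^ k)"
    using pser_conv_abs[OF pser_conv_dt[OF p] q0(1)] q0 by simp
  ultimately have M: "summable M" unfolding M_def by (rule summable_add)
  have f'_sums: "(\<lambda>k. f' k z h) sums g' z h" if "z \<in> S" for z h
  proof -
    have "(\<lambda>k. fst h * (poly (pser_ds p k) (snd z) * fst z ^ k)) sums (fst h * pser (pser_ds p) (fst z) (snd z))"
      by (intro sums_mult pser_sums[OF pser_conv_ds[OF p]] SD[OF that])
    then have "(\<lambda>k. poly (p (Suc k)) (snd z) * (real (Suc k) * fst z ^ (Suc k - 1) * fst h))
        sums (fst h * pser (pser_ds p) (fst z) (snd z))"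
      by (simp add: pser_ds_def mult_ac)
    then have 1: "(\<lambda>k. poly (p k) (snd z) * (real k * fst z ^ (k - 1) * fst h))
        sums (fst h * pser (pser_ds p) (fst z) (snd z))"
      using sums_Suc_iff[of "\<lambda>k. poly (p k) (snd z) * (real k * fst z ^ (k - 1) * fst h)"] by simp
    have "(\<lambda>k. snd h * (poly (pser_dt p k) (snd z) * fst z ^ k)) sums (snd h * pser (pser_dt p) (fst z) (snd z))"
      by (intro sums_mult pser_sums[OF pser_conv_dt[OF p]] SD[OF that])
    from sums_add[OF 1 this] show ?thesis
      unfolding f'_def g'_def by (simp add: pser_dt_def mult_ac)
  qed
  have f'_bound: "\<bar>f' k z h\<bar> \<le> M k * norm h" if "z \<in> S" for k z h
  proof -
    have h: "\<bar>fst h\<bar> \<le> norm h" "\<bar>snd h\<bar> \<le> norm h"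
      using norm_fst_le[of "fst h" "snd h"] norm_snd_le[of "snd h" "fst h"] by simp_all
    have "\<bar>f' k z h\<bar> \<le> \<bar>poly (p k) (snd z)\<bar> * (real k * \<bar>fst z\<bar> ^ (k - 1) * \<bar>fst h\<bar>)
        + \<bar>poly (pderiv (p k)) (snd z)\<bar> * \<bar>snd h\<bar> * \<bar>fst z\<bar> ^ k"
      unfolding f'_def by (rule order.trans[OF abs_triangle_ineq]) (simp add: abs_mult power_abs)
    also have "\<dots> \<le> pnorm B (p k) * (real k * q ^ (k - 1) * norm h) + pnorm B (pser_dt p k) * norm h * q ^ k"
      unfolding pser_dt_def using B SD[OF that] h q0
      by (intro add_mono mult_mono abs_poly_le_pnorm power_mono) auto
    finally show ?thesis by (simp add: M_def algebra_simps)
  qed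
  have "\<exists>g. \<forall>x\<in>S. (\<lambda>n. f n x) sums g x \<and> (g has_derivative g' x) (at x within S)"
  proof (rule has_derivative_series[OF S(2)])
    show "(f k has_derivative f' k z) (at z within S)" if "z \<in> S" for k z
    proof -
      have "((\<lambda>z. poly (p k) (snd z)) has_derivative (\<lambda>h. snd h * poly (pderiv (p k)) (snd z))) (at z within S)"
        by (rule DERIV_compose_FDERIV[OF poly_DERIV]) (auto intro!: derivative_eq_intros)
      then show ?thesis
        unfolding f_def[abs_def] f'_def[abs_def]
        by (auto intro!: derivative_eq_intros simp: algebra_simps)
    qed
    show "\<forall>\<^sub>F n in sequentially. \<forall>x\<in>S. \<forall>h. norm ((\<Sum>i<n. f' i x h) - g' x h) \<le> e * norm h"
      if e: "0 < e" for e
    proof -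
      \<comment> \<open>Weierstrass test: the tail of the derivative series is at most the tail of
        \<open>M\<close> times \<open>norm h\<close>, uniformly in \<open>z\<close>.\<close>
      obtain N where N: "\<And>n. n \<ge> N \<Longrightarrow> norm (\<Sum>i. M (i + n)) < e"
        using suminf_exist_split[OF e M] by blast
      show ?thesis
      proof (rule eventually_sequentiallyI[of N], intro ballI allI)
        fix n z and h :: "real \<times> real" assume n: "N \<le> n" and z: "z \<in> S"
        have s: "summable (\<lambda>i. \<bar>f' (i + n) z h\<bar>)"
          by (rule summable_comparison_test'[OF summable_mult2[OF summable_ignore_initial_segment[OF M, of n], of "norm h"]])
            (use f'_bound[OF z] in auto)
        have "g' z h - (\<Sum>i<n. f' i z h) = (\<Sum>i. f' (i + n) z h)"
          using suminf_minus_initial_segment[OF sums_summable[OF f'_sums[OF z, of h]], of n]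
            sums_unique[OF f'_sums[OF z, of h]] by simp
        then have "norm ((\<Sum>i<n. f' i z h) - g' z h) = \<bar>\<Sum>i. f' (i + n) z h\<bar>"
          by (simp add: abs_minus_commute)
        also have "\<dots> \<le> (\<Sum>i. \<bar>f' (i + n) z h\<bar>)" by (rule summable_rabs[OF s])
        also have "\<dots> \<le> (\<Sum>i. M (i + n) * norm h)"
          using f'_bound[OF z] by (intro suminf_le s summable_mult2 summable_ignore_initial_segment[OF M]) auto
        also have "\<dots> = (\<Sum>i. M (i + n)) * norm h"
          by (intro suminf_mult2[symmetric] summable_ignore_initial_segment[OF M])
        also have "\<dots> \<le> e * norm h" using N[OF n] by (intro mult_right_mono) auto
        finally show "norm ((\<Sum>i<n. f' i z h) - g' z h) \<le> e * norm h" .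
      qed
    qed
    show "(s, t) \<in> S" by (rule S)
    show "(\<lambda>n. f n (s, t)) sums pser p s t"
      unfolding f_def using pser_sums[OF p] st by simp
  qed
  then obtain g where g: "\<And>x. x \<in> S \<Longrightarrow> (\<lambda>n. f n x) sums g x"
    "\<And>x. x \<in> S \<Longrightarrow> (g has_derivative g' x) (at x within S)" by blast
  have g_eq: "g z = pser p (fst z) (snd z)" if "z \<in> S" for z
    using sums_unique2[OF g(1)[OF that]] pser_sums[OF p] SD[OF that] unfolding f_def by blast
  have "(g has_derivative g' (s, t)) (at (s, t))"
    using g(2)[OF S(3)] unfolding at_within_open[OF S(3,1)] .
  then have "((\<lambda>z. pser p (fst z) (snd z)) has_derivative g' (s, t)) (at (s, t))"
    by (rule has_derivative_transform_within_open[OF _ S(1,3)]) (rule g_eq)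
  then show ?thesis unfolding g'_def fst_conv snd_conv .
qed


text \<open>
  With \<open>S\<close> the partial sum up to \<open>K\<close>, the next one is at most
  \<open>A\<^sup>n N\<^sub>n + C (A\<^sup>2 S + S\<^sup>2 + A\<^sup>2 S\<^sup>2)\<close>: a small enough bound reproduces itself.
\<close>

lemma quadratic_recursion_bounded:
  fixes N :: "nat \<Rightarrow> real" and n :: nat
  assumes N0: "\<And>k. 0 \<le> N k" and Nz: "\<And>k. k < n \<Longrightarrow> N k = 0" and n: "2 \<le> n" and C: "1 \<le> C"
    and rec: "\<And>k. n < k \<Longrightarrow> N k \<le> C * (N (k - 2) + (\<Sum>i\<in>{1..<k}. N i * N (k - i))
      + (\<Sum>i\<le>k-2. N i * N (k - 2 - i)))"
  obtains A where "0 < A" "\<And>K. (\<Sum>k\<le>K. A ^ k * N k) \<le> 1/2"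
proof -
  \<comment> \<open>The constants close the induction. The start \<open>a n\<close> takes at most
    \<eta>/2. Since A \<le> 1/(4C), the linear term takes C A \<eta> \<le> \<eta>/4, and the two
    quadratic terms take 2 C \<eta>^2 = \<eta>/4.\<close>
  define \<eta> where "\<eta> = 1 / (8 * C)"
  have \<eta>: "0 < \<eta>" "\<eta> \<le> 1/8" using C by (simp_all add: \<eta>_def field_simps)
  define A where "A = min (1 / (4 * C)) (\<eta> / (2 * (N n + 1)))"
  have A0: "0 < A" using C \<eta> N0[of n] by (simp add: A_def)
  have A1: "A \<le> 1 / (4 * C)" "A \<le> \<eta> / (2 * (N n + 1))" by (simp_all add: A_def)
  have A14: "A \<le> 1/4" 
  proof -
    have "1 / (4 * C) \<le> 1 / 4" using C by (intro divide_left_mono) auto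
    then show ?thesis using A1(1) by linarith
  qed
  have A2: "A\<^sup>2 \<le> A" using A0 A14 by (simp add: power2_eq_square mult_left_le)
  define a where "a k = A ^ k * N k" for k
  have a0: "0 \<le> a k" for k using A0 N0 by (simp add: a_def)
  have az: "a k = 0" if "k < n" for k using Nz[OF that] by (simp add: a_def)
  have an: "a n \<le> \<eta> / 2"
  proof -
    have "A ^ n \<le> A ^ 1" using n A0 A14 by (intro power_decreasing) auto
    then have "a n \<le> A * (N n + 1)" unfolding a_def using N0[of n] A0 by (intro mult_mono) auto
    also have "\<dots> \<le> \<eta> / (2 * (N n + 1)) * (N n + 1)" using A1 N0[of n] by (intro mult_right_mono) auto
    also have "\<dots> = \<eta> / 2" using N0[of n] by (simp add: field_simps)
    finally show ?thesis .
  qed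
  \<comment> \<open>The weight A^k splits over two indices with sum k. Where the indices add up to k
    - 2 only, a factor A^2 is left over, and in the linear term this is the only source of
    smallness.\<close>
  have arec: "a k \<le> C * (A\<^sup>2 * a (k - 2) + (\<Sum>i\<in>{1..<k}. a i * a (k - i))
      + A\<^sup>2 * (\<Sum>i\<le>k-2. a i * a (k - 2 - i)))" if k: "n < k" for k
  proof -
    have 1: "A ^ k = A\<^sup>2 * A ^ (k - 2)" using k n by (metis le_add_diff_inverse less_imp_le_nat order.trans power_add)
    have 2: "A ^ k * (N i * N (k - i)) = a i * a (k - i)" if "i \<in> {1..<k}" for i
    proof -
      have "A ^ k = A ^ i * A ^ (k - i)" using that by (simp flip: power_add)
      then show ?thesis by (simp add: a_def)
    qed
    have 3: "A ^ k * (N i * N (k - 2 - i)) = A\<^sup>2 * (a i * a (k - 2 - i))" if "i \<le> k - 2" for i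
    proof -
      have "A ^ (k - 2) = A ^ i * A ^ (k - 2 - i)" using that by (simp flip: power_add diff_diff_left)
      then show ?thesis using 1 by (simp add: a_def)
    qed
    have "a k \<le> A ^ k * (C * (N (k - 2) + (\<Sum>i\<in>{1..<k}. N i * N (k - i)) + (\<Sum>i\<le>k-2. N i * N (k - 2 - i))))"
      unfolding a_def using rec[OF k] A0 by (intro mult_left_mono) auto
    also have "\<dots> = C * (A ^ k * N (k - 2) + (\<Sum>i\<in>{1..<k}. A ^ k * (N i * N (k - i)))
        + (\<Sum>i\<le>k-2. A ^ k * (N i * N (k - 2 - i))))"
      by (simp add: distrib_left sum_distrib_left mult_ac)
    also have "A ^ k * N (k - 2) = A\<^sup>2 * a (k - 2)" using 1 by (simp add: a_def)
    also have "(\<Sum>i\<in>{1..<k}. A ^ k * (N i * N (k - i))) = (\<Sum>i\<in>{1..<k}. a i * a (k - i))"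
      by (rule sum.cong[OF refl 2])
    also have "(\<Sum>i\<le>k-2. A ^ k * (N i * N (k - 2 - i))) = A\<^sup>2 * (\<Sum>i\<le>k-2. a i * a (k - 2 - i))"
      using 3 by (simp add: sum_distrib_left)
    finally show ?thesis .
  qed
  have bound: "(\<Sum>k\<le>K. a k) \<le> \<eta>" for K
  proof (induction K)
    case 0
    then show ?case using az[of 0] n \<eta> by simp
  next
    case (Suc K)
    define S where "S = (\<Sum>k\<le>K. a k)"
    have S: "0 \<le> S" "S \<le> \<eta>" using a0 Suc by (auto simp: S_def intro: sum_nonneg)
    define I where "I = {n<..Suc K}"
    have I: "n < k" "k \<le> Suc K" "2 \<le> k" if "k \<in> I" for k using that n by (auto simp: I_def)
    have fI: "finite I" by (simp add: I_def)
    have T1: "(\<Sum>k\<in>I. a (k - 2)) \<le> S"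
      unfolding S_def
    proof (rule sum_le_included[where i = "\<lambda>j. j + 2"])
      show "\<forall>x\<in>I. \<exists>y\<in>{..K}. y + 2 = x \<and> a (x - 2) \<le> a y"
        using I by (intro ballI bexI[where x = "_ - 2"]) force+
    qed (use a0 fI in auto)
    have SS: "S * S = (\<Sum>(i, j)\<in>{..K}\<times>{..K}. a i * a j)"
      by (simp add: S_def sum_product sum.cartesian_product)
    \<comment> \<open>For 1 \<le> i < k \<le> Suc K both i and k - i are at most K, and the pair
      determines k. The triangular sum therefore injects into the square of the previous partial
      sum.\<close>
    have T2: "(\<Sum>k\<in>I. \<Sum>i\<in>{1..<k}. a i * a (k - i)) \<le> S * S"
      unfolding SS sum.Sigma[OF fI ballI[OF finite_atLeastLessThan]]
    proof (rule sum_le_included[where i = "\<lambda>(i, j). (i + j, i)"])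
      show "\<forall>x\<in>Sigma I (\<lambda>k. {1..<k}). \<exists>y\<in>{..K}\<times>{..K}. (case y of (i, j) \<Rightarrow> (i + j, i)) = x \<and>
          (case x of (k, i) \<Rightarrow> a i * a (k - i)) \<le> (case y of (i, j) \<Rightarrow> a i * a j)"
      proof
        fix x assume x: "x \<in> Sigma I (\<lambda>k. {1..<k})"
        then obtain k i where ki: "x = (k, i)" "k \<in> I" "1 \<le> i" "i < k" by auto
        then show "\<exists>y\<in>{..K}\<times>{..K}. (case y of (i, j) \<Rightarrow> (i + j, i)) = x \<and>
          (case x of (k, i) \<Rightarrow> a i * a (k - i)) \<le> (case y of (i, j) \<Rightarrow> a i * a j)"
          using I[OF ki(2)] by (intro bexI[where x = "(i, k - i)"]) auto
      qed
    qed (use a0 fI in auto)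
    have T3: "(\<Sum>k\<in>I. \<Sum>i\<le>k-2. a i * a (k - 2 - i)) \<le> S * S"
      unfolding SS sum.Sigma[OF fI ballI[OF finite_atMost]]
    proof (rule sum_le_included[where i = "\<lambda>(i, j). (i + j + 2, i)"])
      show "\<forall>x\<in>Sigma I (\<lambda>k. {..k-2}). \<exists>y\<in>{..K}\<times>{..K}. (case y of (i, j) \<Rightarrow> (i + j + 2, i)) = x \<and>
          (case x of (k, i) \<Rightarrow> a i * a (k - 2 - i)) \<le> (case y of (i, j) \<Rightarrow> a i * a j)"
      proof
        fix x assume x: "x \<in> Sigma I (\<lambda>k. {..k-2})"
        then obtain k i where ki: "x = (k, i)" "k \<in> I" "i \<le> k - 2" by auto
        then show "\<exists>y\<in>{..K}\<times>{..K}. (case y of (i, j) \<Rightarrow> (i + j + 2, i)) = x \<and>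
          (case x of (k, i) \<Rightarrow> a i * a (k - 2 - i)) \<le> (case y of (i, j) \<Rightarrow> a i * a j)"
          using I[OF ki(2)] by (intro bexI[where x = "(i, k - 2 - i)"]) auto
      qed
    qed (use a0 fI in auto)
    have "(\<Sum>k\<le>Suc K. a k) = (\<Sum>k\<in>{..Suc K} \<inter> {n..}. a k)"
      by (rule sum.mono_neutral_right) (auto intro: az simp: not_le)
    also have "\<dots> \<le> (\<Sum>k\<in>insert n I. a k)"
      by (rule sum_mono2) (auto simp: a0 I_def)
    also have "\<dots> = a n + (\<Sum>k\<in>I. a k)" by (simp add: I_def)
    also have "(\<Sum>k\<in>I. a k) \<le> (\<Sum>k\<in>I. C * (A\<^sup>2 * a (k - 2) + (\<Sum>i\<in>{1..<k}. a i * a (k - i))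
      + A\<^sup>2 * (\<Sum>i\<le>k-2. a i * a (k - 2 - i))))"
      by (intro sum_mono arec I)
    also have "\<dots> = C * (A\<^sup>2 * (\<Sum>k\<in>I. a (k - 2)) + (\<Sum>k\<in>I. \<Sum>i\<in>{1..<k}. a i * a (k - i))
        + A\<^sup>2 * (\<Sum>k\<in>I. \<Sum>i\<le>k-2. a i * a (k - 2 - i)))"
      by (simp add: sum.distrib flip: sum_distrib_left)
    also have "\<dots> \<le> C * (A\<^sup>2 * S + S * S + A\<^sup>2 * (S * S))"
      using C T1 T2 T3 by (intro mult_left_mono add_mono) auto
    also have "\<dots> \<le> C * (A * \<eta> + \<eta> * \<eta> + 1 * (\<eta> * \<eta>))"
      using S C A2 A14 A0 \<eta> by (intro mult_left_mono add_mono mult_mono) auto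
    also have "\<dots> \<le> C * (1 / (4 * C) * \<eta> + \<eta> * \<eta> + 1 * (\<eta> * \<eta>))"
      using C A1 \<eta> by (intro mult_left_mono add_mono mult_right_mono) auto
    also have "\<dots> = \<eta> / 2" using C by (simp add: \<eta>_def field_simps)
    finally show ?case using an by simp
  qed
  have "(\<Sum>k\<le>K. A ^ k * N k) \<le> 1/2" for K
    using bound[of K] \<eta>(2) unfolding a_def by linarith
  then show ?thesis by (rule that[OF A0])
qed

section \<open>The formal solution and its convergence\<close>

text \<open>
  With \<open>\<theta> = s \<partial>\<^sub>s\<close> and \<open>L = \<theta> + t \<partial>\<^sub>t\<close>, the operators \<open>L\<close>, \<open>L(L+1) - Q \<partial>\<^sub>t\<^sup>2\<close> and \<open>\<theta>(\<theta>+1-n)\<close> act on \<open>s\<^sup>k p(t)\<close> as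
  \<open>euler_op k\<close>, \<open>radial_op Q k\<close> and multiplication by \<open>lap_coef n k\<close>. For \<open>Q = |w|\<^sup>2\<close> one has
  \<open>\<Delta> = \<theta>(\<theta>+1-n) - s\<^sup>2 (L(L+1) - Q \<partial>\<^sub>t\<^sup>2)\<close> and \<open>|dv|\<^sup>2 = (\<theta>v)\<^sup>2 + s\<^sup>2 (Q (\<partial>\<^sub>t v)\<^sup>2 - (Lv)\<^sup>2)\<close>; the coefficients
  \<open>quad_coef\<close> and \<open>quad_op\<close> are those of \<open>n/2 (v\<^sup>2 + |dv|\<^sup>2) - v \<Delta>v\<close>.
\<close>

definition euler_op :: "nat \<Rightarrow> real poly \<Rightarrow> real poly"
  where "euler_op k p = smult (real k) p + pCons 0 (pderiv p)"

definition radial_op :: "real \<Rightarrow> nat \<Rightarrow> real poly \<Rightarrow> real poly"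
  where "radial_op Q k p = euler_op k (euler_op k p) + euler_op k p - smult Q (pderiv (pderiv p))"

definition lap_coef :: "nat \<Rightarrow> nat \<Rightarrow> real"
  where "lap_coef n k = real k * (real k + 1 - real n)"

definition quad_op :: "nat \<Rightarrow> real \<Rightarrow> nat \<Rightarrow> nat \<Rightarrow> real poly \<Rightarrow> real poly \<Rightarrow> real poly"
  where "quad_op n Q i l p q =
    smult (real n / 2) (smult Q (pderiv p * pderiv q) - euler_op i p * euler_op l q) + p * radial_op Q l q"

definition quad_coef :: "nat \<Rightarrow> nat \<Rightarrow> nat \<Rightarrow> real"
  where "quad_coef n i l = real n / 2 * (1 + real i * real l) - lap_coef n l"

text \<open>Comparison of the coefficients of s^k. The operator \<Delta> - n multiplies the leading
  part by \<open>lap_coef n k - n\<close>, which is (k - n)(k + 1) and does not vanish for k > n;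
  everything else goes to the right-hand side. Terms carrying s^2 have indices adding up to k - 2.
  The end terms i = 0 and i = k of the first convolution are left out, which makes the recursion
  well-founded; they would vanish anyway because the series starts at order n.\<close>

fun vcoef :: "nat \<Rightarrow> real \<Rightarrow> real poly \<Rightarrow> nat \<Rightarrow> real poly" where
  "vcoef n Q P k = (if k < n then 0 else if k = n then P else
    smult (1 / ((real k - real n) * (real k + 1)))
      (radial_op Q (k - 2) (vcoef n Q P (k - 2))
       + (\<Sum>i\<in>{1..<k}. smult (quad_coef n i (k - i)) (vcoef n Q P i * vcoef n Q P (k - i)))
       + (\<Sum>i\<in>{..k-2}. quad_op n Q i (k - 2 - i) (vcoef n Q P i) (vcoef n Q P (k - 2 - i)))))"

declare vcoef.simps [simp del]

lemma vcoef_less: "k < n \<Longrightarrow> vcoef n Q P k = 0"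
  and vcoef_start: "vcoef n Q P n = P"
  by (simp_all add: vcoef.simps)

lemma vcoef_rec: "n < k \<Longrightarrow> vcoef n Q P k =
    smult (1 / ((real k - real n) * (real k + 1)))
      (radial_op Q (k - 2) (vcoef n Q P (k - 2))
       + (\<Sum>i\<in>{1..<k}. smult (quad_coef n i (k - i)) (vcoef n Q P i * vcoef n Q P (k - i)))
       + (\<Sum>i\<in>{..k-2}. quad_op n Q i (k - 2 - i) (vcoef n Q P i) (vcoef n Q P (k - 2 - i))))"
  by (subst vcoef.simps) simp

lemma degree_euler_op: "degree (euler_op k p) \<le> degree p"
proof -
  have "degree (pCons 0 (pderiv p)) \<le> degree p"
    by (cases "pderiv p = 0") (auto simp: degree_pderiv pderiv_eq_0_iff)
  then show ?thesis unfolding euler_op_def by (intro degree_add_le) auto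
qed

lemma degree_radial_op: "degree (radial_op Q k p) \<le> degree p"
  unfolding radial_op_def
  using degree_euler_op[of k p] degree_euler_op[of k "euler_op k p"]
  by (intro degree_diff_le degree_add_le order.trans[OF degree_smult_le]) (auto simp: degree_pderiv)

lemma degree_quad_op: "degree (quad_op n Q i l p q) \<le> degree p + degree q"
proof -
  have "degree (euler_op i p * euler_op l q) \<le> degree p + degree q"
    using degree_mult_le[of "euler_op i p" "euler_op l q"] degree_euler_op[of i p] degree_euler_op[of l q] by linarith
  moreover have "degree (pderiv p * pderiv q) \<le> degree p + degree q"
    using degree_mult_le[of "pderiv p" "pderiv q"] by (simp add: degree_pderiv)
  moreover have "degree (p * radial_op Q l q) \<le> degree p + degree q"
    using degree_mult_le[of p "radial_op Q l q"] degree_radial_op[of Q l q] by linarith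
  ultimately show ?thesis
    unfolding quad_op_def
    by (intro degree_add_le degree_diff_le order.trans[OF degree_smult_le]) auto
qed

text \<open>None of the operators raises degrees, and in each product the indices add up to k or k -
  2. This bound is what converts t-derivatives into factors k in the estimates.\<close>

lemma degree_vcoef: "degree P \<le> n \<Longrightarrow> 1 \<le> n \<Longrightarrow> degree (vcoef n Q P k) \<le> k"
proof (induction k rule: less_induct)
  case (less k)
  consider "k < n" | "k = n" | "n < k" by linarith
  then show ?case
  proof cases
    case 3
    have IH: "degree (vcoef n Q P i) \<le> i" if "i < k" for i using less that by blast
    have 1: "degree (radial_op Q (k - 2) (vcoef n Q P (k - 2))) \<le> k"
      using degree_radial_op[of Q "k - 2" "vcoef n Q P (k - 2)"] IH[of "k - 2"] 3 less.prems by simp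
    have 2: "degree (smult (quad_coef n i (k - i)) (vcoef n Q P i * vcoef n Q P (k - i))) \<le> k"
      if "i \<in> {1..<k}" for i
      using order.trans[OF degree_smult_le degree_mult_le, of "quad_coef n i (k - i)" "vcoef n Q P i" "vcoef n Q P (k - i)"]
        IH[of i] IH[of "k - i"] that by auto
    have 3: "degree (quad_op n Q i (k - 2 - i) (vcoef n Q P i) (vcoef n Q P (k - 2 - i))) \<le> k"
      if "i \<in> {..k-2}" for i
    proof -
      have "i < k" "k - 2 - i < k" using that 3 by auto
      then show ?thesis
        using degree_quad_op[of n Q i "k - 2 - i" "vcoef n Q P i" "vcoef n Q P (k - 2 - i)"]
          IH[of i] IH[of "k - 2 - i"] that by (auto intro: order.trans)
    qed
    show ?thesis
      unfolding vcoef_rec[OF \<open>n < k\<close>]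
      by (intro order.trans[OF degree_smult_le] degree_add_le degree_sum_le 1 2 3) auto
  qed (use less in \<open>auto simp: vcoef_less vcoef_start\<close>)
qed

lemma pnorm_euler_op:
  assumes "1 \<le> B" "degree p \<le> k" shows "pnorm B (euler_op k p) \<le> 2 * real k * pnorm B p"
proof -
  have "pnorm B (euler_op k p) \<le> real k * pnorm B p + B * pnorm B (pderiv p)"
    using pnorm_add[of B "smult (real k) p" "pCons 0 (pderiv p)"] assms by (simp add: euler_op_def pnorm_smult)
  also have "B * pnorm B (pderiv p) \<le> real (degree p) * pnorm B p" by (rule pnorm_pderiv[OF assms(1)])
  also have "\<dots> \<le> real k * pnorm B p" using assms by (intro mult_right_mono) auto
  finally show ?thesis by simp
qed

lemma pnorm_radial_op:
  assumes "1 \<le> B" "degree p \<le> k" "0 \<le> Q"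
  shows "pnorm B (radial_op Q k p) \<le> (6 + Q) * (real k)\<^sup>2 * pnorm B p"
proof -
  have d: "degree (euler_op k p) \<le> k" "degree (pderiv p) \<le> k"
    using degree_euler_op[of k p] assms(2) by (auto simp: degree_pderiv)
  have kk: "real k \<le> (real k)\<^sup>2" by (cases k) (auto simp: power2_eq_square)
  have "pnorm B (radial_op Q k p) \<le> pnorm B (euler_op k (euler_op k p)) + pnorm B (euler_op k p) + Q * pnorm B (pderiv (pderiv p))"
    unfolding radial_op_def using assms
    by (intro order.trans[OF pnorm_diff] add_mono order.trans[OF pnorm_add]) (auto simp: pnorm_smult)
  also have "\<dots> \<le> 2 * real k * (2 * real k * pnorm B p) + 2 * real k * pnorm B p + Q * (real k * (real k * pnorm B p))"
  proof -
    have "pnorm B (euler_op k (euler_op k p)) \<le> 2 * real k * pnorm B (euler_op k p)"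
      by (rule pnorm_euler_op[OF assms(1) d(1)])
    also have "\<dots> \<le> 2 * real k * (2 * real k * pnorm B p)"
      by (intro mult_left_mono pnorm_euler_op assms) auto
    finally have 1: "pnorm B (euler_op k (euler_op k p)) \<le> 2 * real k * (2 * real k * pnorm B p)" .
    have "pnorm B (pderiv (pderiv p)) \<le> real k * pnorm B (pderiv p)"
      by (rule pnorm_pderiv_le[OF assms(1) d(2)])
    also have "\<dots> \<le> real k * (real k * pnorm B p)"
      by (intro mult_left_mono pnorm_pderiv_le assms) auto
    finally have 2: "pnorm B (pderiv (pderiv p)) \<le> real k * (real k * pnorm B p)" .
    show ?thesis by (intro add_mono mult_left_mono 1 2 pnorm_euler_op assms)
  qed
  also have "\<dots> = (4 * (real k)\<^sup>2 + 2 * real k + Q * (real k)\<^sup>2) * pnorm B p"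
    by (simp add: power2_eq_square algebra_simps)
  also have "\<dots> \<le> (6 + Q) * (real k)\<^sup>2 * pnorm B p"
    using kk assms by (intro mult_right_mono) (auto simp: algebra_simps)
  finally show ?thesis .
qed

lemma pnorm_quad_op:
  assumes "1 \<le> B" "degree p \<le> i" "degree q \<le> l" "0 \<le> Q" "i \<le> k" "l \<le> k"
  shows "pnorm B (quad_op n Q i l p q) \<le> (real n / 2 * (Q + 4) + 6 + Q) * (real k)\<^sup>2 * (pnorm B p * pnorm B q)"
proof -
  have B: "0 \<le> B" using assms by simp
  let ?N = "pnorm B p * pnorm B q"
  have N: "0 \<le> ?N" using B by simp
  have il: "real i * real l \<le> (real k)\<^sup>2" "(real l)\<^sup>2 \<le> (real k)\<^sup>2"
    using assms by (auto simp: power2_eq_square intro!: mult_mono)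
  have "pnorm B (pderiv p * pderiv q) \<le> (real i * pnorm B p) * (real l * pnorm B q)"
    using assms B by (intro order.trans[OF pnorm_mult] mult_mono pnorm_pderiv_le) auto
  also have "\<dots> = real i * real l * ?N" by simp
  also have "\<dots> \<le> (real k)\<^sup>2 * ?N" using il N by (intro mult_right_mono) auto
  finally have 1: "pnorm B (pderiv p * pderiv q) \<le> (real k)\<^sup>2 * ?N" .
  have "pnorm B (euler_op i p * euler_op l q) \<le> (2 * real i * pnorm B p) * (2 * real l * pnorm B q)"
    using assms B by (intro order.trans[OF pnorm_mult] mult_mono pnorm_euler_op) auto
  also have "\<dots> = real i * real l * (4 * ?N)" by simp
  also have "\<dots> \<le> (real k)\<^sup>2 * (4 * ?N)" using il N by (intro mult_right_mono) auto
  finally have 2: "pnorm B (euler_op i p * euler_op l q) \<le> (real k)\<^sup>2 * (4 * ?N)" .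
  have "pnorm B (p * radial_op Q l q) \<le> pnorm B p * ((6 + Q) * (real l)\<^sup>2 * pnorm B q)"
    using assms B by (intro order.trans[OF pnorm_mult] mult_left_mono pnorm_radial_op) auto
  also have "\<dots> = (real l)\<^sup>2 * ((6 + Q) * ?N)" by simp
  also have "\<dots> \<le> (real k)\<^sup>2 * ((6 + Q) * ?N)" using il N assms by (intro mult_right_mono) auto
  finally have 3: "pnorm B (p * radial_op Q l q) \<le> (real k)\<^sup>2 * ((6 + Q) * ?N)" .
  have "pnorm B (quad_op n Q i l p q) \<le> real n / 2 * (Q * pnorm B (pderiv p * pderiv q) + pnorm B (euler_op i p * euler_op l q))
      + pnorm B (p * radial_op Q l q)"
    unfolding quad_op_def using assms B pnorm_diff[of B "smult Q (pderiv p * pderiv q)" "euler_op i p * euler_op l q"]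
    by (intro order.trans[OF pnorm_add] add_mono)  (auto simp: pnorm_smult intro!: mult_left_mono)
  also have "\<dots> \<le> real n / 2 * (Q * ((real k)\<^sup>2 * ?N) + (real k)\<^sup>2 * (4 * ?N)) + (real k)\<^sup>2 * ((6 + Q) * ?N)"
    using 1 2 3 assms by (intro add_mono mult_left_mono) auto
  also have "\<dots> = (real n / 2 * (Q + 4) + 6 + Q) * (real k)\<^sup>2 * ?N" by (simp add: algebra_simps)
  finally show ?thesis .
qed

text \<open>Growth of order k^2 is just what division by (k - n)(k + 1) can absorb.\<close>

lemma abs_quad_coef:
  assumes "n < k" "1 \<le> i" "i < k"
  shows "\<bar>quad_coef n i (k - i)\<bar> \<le> (real n + 1) * (real k)\<^sup>2"
proof -
  define l where "l = k - i"
  have l: "real i * real l \<le> (real k)\<^sup>2" "1 \<le> (real k)\<^sup>2" "l + 1 \<le> k"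
    using assms one_le_power[of "real k" 2] by (auto simp: power2_eq_square l_def intro!: mult_mono)
  have "\<bar>real l + 1 - real n\<bar> \<le> real k" using assms l by linarith
  then have "\<bar>lap_coef n l\<bar> \<le> real k * real k"
    unfolding lap_coef_def abs_mult using l by (intro mult_mono) auto
  moreover have "real n / 2 * (1 + real i * real l) \<le> real n / 2 * ((real k)\<^sup>2 + (real k)\<^sup>2)"
    using l by (intro mult_left_mono add_mono) auto
  moreover have "0 \<le> real n / 2 * (1 + real i * real l)" by simp
  ultimately show ?thesis
  proof -
    assume 1: "\<bar>lap_coef n l\<bar> \<le> real k * real k" and 3: "0 \<le> real n / 2 * (1 + real i * real l)"
      and 2: "real n / 2 * (1 + real i * real l) \<le> real n / 2 * ((real k)\<^sup>2 + (real k)\<^sup>2)"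
    have "(real n + 1) * (real k)\<^sup>2 = real n / 2 * ((real k)\<^sup>2 + (real k)\<^sup>2) + real k * real k"
      by (simp add: power2_eq_square algebra_simps)
    then show ?thesis
      unfolding quad_coef_def l_def[symmetric] using 1 2 3 by linarith
  qed
qed

text \<open>Every term of the recursion costs at most c k^2 in \<open>pnorm\<close>, and the
  indicial factor divides this out. The norms thus satisfy the hypothesis of
  \<open>quadratic_recursion_bounded\<close> with a constant that does not depend on k.\<close>

lemma vcoef_bounded:
  assumes n: "2 \<le> n" and P: "degree P \<le> n" and B: "1 \<le> B" and Q: "0 \<le> Q"
  obtains A where "0 < A" "\<And>K. (\<Sum>k\<le>K. A ^ k * pnorm B (vcoef n Q P k)) \<le> 1/2"
proof -
  define c where "c = real n / 2 * (Q + 4) + 6 + Q + (real n + 1)"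
  have c: "6 + Q \<le> c" "real n + 1 \<le> c" "real n / 2 * (Q + 4) + 6 + Q \<le> c" "1 \<le> c"
    using Q by (auto simp: c_def)
  define N where "N k = pnorm B (vcoef n Q P k)" for k
  note deg = degree_vcoef[OF P, of Q]
  have n1: "1 \<le> n" using n by simp
  have B0: "0 \<le> B" using B by simp
  have N0: "0 \<le> N k" for k using B by (simp add: N_def)
  have rec: "N k \<le> ((real n + 1) * c) * (N (k - 2) + (\<Sum>i\<in>{1..<k}. N i * N (k - i))
      + (\<Sum>i\<le>k-2. N i * N (k - 2 - i)))" if k: "n < k" for k
  proof -
    let ?T = "N (k - 2) + (\<Sum>i\<in>{1..<k}. N i * N (k - i)) + (\<Sum>i\<le>k-2. N i * N (k - 2 - i))"
    have "pnorm B (radial_op Q (k - 2) (vcoef n Q P (k - 2))) \<le> (6 + Q) * (real (k - 2))\<^sup>2 * N (k - 2)"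
      unfolding N_def by (intro pnorm_radial_op B Q deg n1)
    also have "\<dots> \<le> c * (real k)\<^sup>2 * N (k - 2)"
      using c Q N0 by (intro mult_right_mono mult_mono power_mono) auto
    finally have 1: "pnorm B (radial_op Q (k - 2) (vcoef n Q P (k - 2))) \<le> c * (real k)\<^sup>2 * N (k - 2)" .
    have 2: "pnorm B (smult (quad_coef n i (k - i)) (vcoef n Q P i * vcoef n Q P (k - i)))
        \<le> c * (real k)\<^sup>2 * (N i * N (k - i))" if "i \<in> {1..<k}" for i
    proof -
      have "\<bar>quad_coef n i (k - i)\<bar> \<le> c * (real k)\<^sup>2"
        using abs_quad_coef[OF k, of i] that mult_right_mono[OF c(2), of "(real k)\<^sup>2"]
        by (auto intro: order.trans)
      then show ?thesis
        unfolding pnorm_smult N_def using B0 c by (intro mult_mono pnorm_mult) auto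
    qed
    have 3: "pnorm B (quad_op n Q i (k - 2 - i) (vcoef n Q P i) (vcoef n Q P (k - 2 - i)))
        \<le> c * (real k)\<^sup>2 * (N i * N (k - 2 - i))" if "i \<in> {..k-2}" for i
    proof -
      have "pnorm B (quad_op n Q i (k - 2 - i) (vcoef n Q P i) (vcoef n Q P (k - 2 - i)))
        \<le> (real n / 2 * (Q + 4) + 6 + Q) * (real k)\<^sup>2 * (N i * N (k - 2 - i))"
        unfolding N_def using that by (intro pnorm_quad_op B Q deg n1) auto
      also have "\<dots> \<le> c * (real k)\<^sup>2 * (N i * N (k - 2 - i))"
        using c N0 by (intro mult_right_mono) auto
      finally show ?thesis .
    qed
    \<comment> \<open>The quotient k^2 / ((k - n)(k + 1)) is at most n + 1, since k \<le> (n + 1)(k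
      - n) for every integer k > n, with equality at k = n + 1.\<close>
    have "real n + real n * real n \<le> real n * real k"
      using k mult_left_mono[of "real (n + 1)" "real k" "real n"] by (simp add: algebra_simps)
    then have "real k \<le> (real n + 1) * (real k - real n)" by (simp add: algebra_simps)
    then have "real k * real k \<le> ((real n + 1) * (real k - real n)) * (real k + 1)"
      using k by (intro mult_mono) auto
    then have f: "1 / ((real k - real n) * (real k + 1)) * (real k)\<^sup>2 \<le> real n + 1"
      using k by (simp add: pos_divide_le_eq power2_eq_square mult_ac)
    have "N k \<le> 1 / ((real k - real n) * (real k + 1)) * (c * (real k)\<^sup>2 * N (k - 2)
        + (\<Sum>i\<in>{1..<k}. c * (real k)\<^sup>2 * (N i * N (k - i)))
        + (\<Sum>i\<in>{..k-2}. c * (real k)\<^sup>2 * (N i * N (k - 2 - i))))"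
      unfolding N_def[of k] vcoef_rec[OF k] pnorm_smult using k
      by (intro mult_mono order.trans[OF pnorm_add[OF B0]] add_mono order.trans[OF pnorm_sum[OF B0]] sum_mono 1 2 3)
        (auto simp: B0)
    also have "\<dots> = (1 / ((real k - real n) * (real k + 1)) * (real k)\<^sup>2) * (c * ?T)"
      by (simp add: distrib_left sum_distrib_left sum_divide_distrib mult_ac)
    also have "\<dots> \<le> (real n + 1) * (c * ?T)"
      using f c N0 by (intro mult_right_mono mult_nonneg_nonneg add_nonneg_nonneg sum_nonneg) auto
    finally show ?thesis by (simp add: mult_ac)
  qed
  have C: "1 \<le> (real n + 1) * c" using c mult_mono[of 1 "real n + 1" 1 c] by simp
  have Nz: "N k = 0" if "k < n" for k using that by (simp add: N_def vcoef_less)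
  from quadratic_recursion_bounded[of N, OF N0 Nz n C rec] that show thesis
    unfolding N_def by blast
qed

section \<open>Summing the recursion to the differential equation\<close>

lemma sums_shift2:
  fixes a :: "nat \<Rightarrow> real"
  assumes "a sums x" shows "(\<lambda>k. if k < 2 then 0 else a (k - 2)) sums x"
proof -
  have "(\<lambda>k. (if k + 2 < 2 then 0 else a (k + 2 - 2))) sums (x - (\<Sum>i<2. if i < 2 then 0 else a (i - 2)))"
    using assms by simp
  then show ?thesis by (subst (asm) sums_iff_shift') simp
qed

lemma Cauchy_product_sums_real:
  fixes a b :: "nat \<Rightarrow> real"
  assumes "summable (\<lambda>k. \<bar>a k\<bar>)" "summable (\<lambda>k. \<bar>b k\<bar>)" "a sums x" "b sums y"
  shows "(\<lambda>k. \<Sum>i\<le>k. a i * b (k - i)) sums (x * y)"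
  using Cauchy_product_sums[of a b] assms by (simp add: sums_iff)

lemma pser_theta2_sums:
  assumes "pser_conv A B p" "\<bar>s\<bar> < A" "\<bar>t\<bar> \<le> B"
  shows "(\<lambda>k. (real k)\<^sup>2 * poly (p k) t * s ^ k) sums (s\<^sup>2 * pser (pser_ds (pser_ds p)) s t + s * pser (pser_ds p) s t)"
    and "summable (\<lambda>k. \<bar>(real k)\<^sup>2 * poly (p k) t * s ^ k\<bar>)"
proof -
  note d = pser_theta_sums[OF pser_conv_ds[OF assms(1)] assms(2,3)]
  have "(\<lambda>k. s * (real k * poly (pser_ds p k) t * s ^ k)) sums (s * (s * pser (pser_ds (pser_ds p)) s t))"
    by (intro sums_mult d)
  then have "(\<lambda>k. real (Suc k - 1) * real (Suc k) * poly (p (Suc k)) t * s ^ Suc k) sums (s\<^sup>2 * pser (pser_ds (pser_ds p)) s t)"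
    by (simp add: pser_ds_def algebra_simps power2_eq_square)
  then have "(\<lambda>k. real (k - 1) * real k * poly (p k) t * s ^ k) sums (s\<^sup>2 * pser (pser_ds (pser_ds p)) s t)"
    by (subst (asm) sums_Suc_iff[where f = "\<lambda>k. real (k - 1) * real k * poly (p k) t * s ^ k"]) simp
  from sums_add[OF this pser_theta_sums(1)[OF assms]]
  have s: "(\<lambda>k. real (k - 1) * real k * poly (p k) t * s ^ k + real k * poly (p k) t * s ^ k) sums
    (s\<^sup>2 * pser (pser_ds (pser_ds p)) s t + s * pser (pser_ds p) s t)" .
  have e: "real (k - 1) * real k * poly (p k) t * s ^ k + real k * poly (p k) t * s ^ k
     = (real k)\<^sup>2 * poly (p k) t * s ^ k" for k
    by (cases k) (auto simp: power2_eq_square algebra_simps)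
  show "(\<lambda>k. (real k)\<^sup>2 * poly (p k) t * s ^ k) sums (s\<^sup>2 * pser (pser_ds (pser_ds p)) s t + s * pser (pser_ds p) s t)"
    using s unfolding e .
  have "summable (\<lambda>k. \<bar>s\<bar> * (\<bar>real k * poly (pser_ds p k) t * s ^ k\<bar> + \<bar>poly (pser_ds p k) t * s ^ k\<bar>))"
    by (intro summable_mult summable_add d pser_abs_summable[OF pser_conv_ds[OF assms(1)] assms(2,3)])
  moreover have "\<bar>s\<bar> * (\<bar>real k * poly (pser_ds p k) t * s ^ k\<bar> + \<bar>poly (pser_ds p k) t * s ^ k\<bar>)
      = \<bar>(real (Suc k))\<^sup>2 * poly (p (Suc k)) t * s ^ Suc k\<bar>" for k
  proof -
    have "\<bar>real k * y\<bar> + \<bar>y\<bar> = real (Suc k) * \<bar>y\<bar>" for y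
      by (simp add: abs_mult algebra_simps)
    from this[of "poly (pser_ds p k) t * s ^ k"] show ?thesis
      by (simp add: pser_ds_def abs_mult power2_eq_square mult_ac del: of_nat_Suc)
  qed
  ultimately show "summable (\<lambda>k. \<bar>(real k)\<^sup>2 * poly (p k) t * s ^ k\<bar>)"
    by (subst summable_Suc_iff[symmetric]) simp
qed


lemma poly_euler_op: "poly (euler_op k p) t = real k * poly p t + t * poly (pderiv p) t"
  by (simp add: euler_op_def)

lemma poly_radial_op: "poly (radial_op Q k p) t = (real k)\<^sup>2 * poly p t + 2 * t * (real k * poly (pderiv p) t)
    + t * poly (pderiv p) t + t\<^sup>2 * poly (pderiv (pderiv p)) t
    + (real k * poly p t + t * poly (pderiv p) t) - Q * poly (pderiv (pderiv p)) t"
proof -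
  have "pderiv (euler_op k p) = smult (real k) (pderiv p) + pderiv p + pCons 0 (pderiv (pderiv p))"
    by (simp add: euler_op_def pderiv_add pderiv_smult pderiv_pCons)
  then show ?thesis
    by (simp add: radial_op_def poly_euler_op power2_eq_square algebra_simps)
qed

text \<open>This is \<open>\<Delta>v - n v = n/2 (v\<^sup>2 + |dv|\<^sup>2) - v \<Delta>v\<close>.\<close>

lemma vcoef_equation:
  fixes n :: nat and Q :: real and P :: "real poly"
  defines "p \<equiv> vcoef n Q P"
  assumes n: "2 \<le> n" and p: "pser_conv A B p" and st: "\<bar>s\<bar> < A" "\<bar>t\<bar> \<le> B"
  defines "v \<equiv> pser p s t" and "vs \<equiv> s * pser (pser_ds p) s t"
    and "vss \<equiv> s\<^sup>2 * pser (pser_ds (pser_ds p)) s t + s * pser (pser_ds p) s t"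
    and "vt \<equiv> pser (pser_dt p) s t" and "vst \<equiv> s * pser (pser_ds (pser_dt p)) s t" and "vtt \<equiv> pser (pser_dt (pser_dt p)) s t"
  defines "m \<equiv> vss + 2 * t * vst + t * vt + t\<^sup>2 * vtt + (vs + t * vt) - Q * vtt"
  shows "vss + (1 - real n) * vs - real n * v - s\<^sup>2 * m =
    real n / 2 * (v\<^sup>2 + vs\<^sup>2) - v * (vss + (1 - real n) * vs)
    + s\<^sup>2 * (real n / 2 * (Q * vt\<^sup>2 - (vs + t * vt)\<^sup>2) + v * m)"
proof -
  define X where "X k = poly (p k) t * s ^ k" for k
  define Y where "Y k = real k * poly (p k) t * s ^ k" for k
  define Z where "Z k = (real k)\<^sup>2 * poly (p k) t * s ^ k" for k
  define T where "T k = poly (pser_dt p k) t * s ^ k" for k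
  define U where "U k = real k * poly (pser_dt p k) t * s ^ k" for k
  define W where "W k = poly (pser_dt (pser_dt p) k) t * s ^ k" for k
  define E where "E k = Y k + t * T k" for k
  define M where "M k = Z k + 2 * t * U k + t * T k + t\<^sup>2 * W k + E k - Q * W k" for k
  define L where "L k = Z k + (1 - real n) * Y k" for k
  note p' = pser_conv_dt[OF p] and p'' = pser_conv_dt[OF pser_conv_dt[OF p]]
  have sums: "X sums v" "Y sums vs" "Z sums vss" "T sums vt" "U sums vst" "W sums vtt"
    unfolding X_def Y_def Z_def T_def U_def W_def v_def vs_def vss_def vt_def vst_def vtt_def
    by (intro pser_sums[OF p st] pser_theta_sums(1)[OF p st] pser_theta2_sums(1)[OF p st]
      pser_sums[OF p' st] pser_theta_sums(1)[OF p' st] pser_sums[OF p'' st])+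
  have abs: "summable (\<lambda>k. \<bar>X k\<bar>)" "summable (\<lambda>k. \<bar>Y k\<bar>)" "summable (\<lambda>k. \<bar>Z k\<bar>)"
    "summable (\<lambda>k. \<bar>T k\<bar>)" "summable (\<lambda>k. \<bar>U k\<bar>)" "summable (\<lambda>k. \<bar>W k\<bar>)"
    unfolding X_def Y_def Z_def T_def U_def W_def
    by (intro pser_abs_summable[OF p st] pser_theta_sums(2)[OF p st] pser_theta2_sums(2)[OF p st]
      pser_abs_summable[OF p' st] pser_theta_sums(2)[OF p' st] pser_abs_summable[OF p'' st])+
  have abs_lin: "summable (\<lambda>k. \<bar>a k + c * b k\<bar>)"
    if "summable (\<lambda>k. \<bar>a k\<bar>)" "summable (\<lambda>k. \<bar>b k\<bar>)" for a b :: "nat \<Rightarrow> real" and c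
  proof (rule summable_comparison_test')
    show "summable (\<lambda>k. \<bar>a k\<bar> + \<bar>c\<bar> * \<bar>b k\<bar>)" by (intro summable_add summable_mult that)
    show "norm \<bar>a k + c * b k\<bar> \<le> \<bar>a k\<bar> + \<bar>c\<bar> * \<bar>b k\<bar>" for k
      using abs_triangle_ineq[of "a k" "c * b k"] by (simp add: abs_mult)
  qed
  have abs': "summable (\<lambda>k. \<bar>E k\<bar>)" "summable (\<lambda>k. \<bar>L k\<bar>)"
    unfolding E_def L_def by (intro abs_lin abs)+
  have "summable (\<lambda>k. \<bar>Z k + (2 * t) * U k + t * T k + t\<^sup>2 * W k + 1 * E k + (- Q) * W k\<bar>)"
    by (intro abs_lin abs abs')
  then have absM: "summable (\<lambda>k. \<bar>M k\<bar>)" unfolding M_def by simp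
  have sE: "E sums (vs + t * vt)" and sL: "L sums (vss + (1 - real n) * vs)"
    unfolding E_def[abs_def] L_def[abs_def] by (intro sums_add sums_mult sums)+
  have sM: "M sums m"
    unfolding M_def[abs_def] m_def by (intro sums_add sums_diff sums_mult sums sE)
  note CP = Cauchy_product_sums_real
  define R1 where "R1 k = real n / 2 * ((\<Sum>i\<le>k. X i * X (k - i)) + (\<Sum>i\<le>k. Y i * Y (k - i)))
    - (\<Sum>i\<le>k. X i * L (k - i))" for k
  define R2 where "R2 k = real n / 2 * (Q * (\<Sum>i\<le>k. T i * T (k - i)) - (\<Sum>i\<le>k. E i * E (k - i)))
    + (\<Sum>i\<le>k. X i * M (k - i))" for k
  have sR1: "R1 sums (real n / 2 * (v * v + vs * vs) - v * (vss + (1 - real n) * vs))"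
    unfolding R1_def[abs_def] by (intro sums_add sums_diff sums_mult CP abs abs' sums sL)
  have sR2: "R2 sums (real n / 2 * (Q * (vt * vt) - (vs + t * vt) * (vs + t * vt)) + v * m)"
    unfolding R2_def[abs_def] by (intro sums_add sums_diff sums_mult CP abs abs' absM sums sE sM)
  have sl: "(\<lambda>k. L k - real n * X k - s\<^sup>2 * (if k < 2 then 0 else M (k - 2))) sums
      (vss + (1 - real n) * vs - real n * v - s\<^sup>2 * m)"
    by (intro sums_diff sums_mult sums sL sums_shift2 sM)
  have sr: "(\<lambda>k. R1 k + s\<^sup>2 * (if k < 2 then 0 else R2 (k - 2))) sums
      (real n / 2 * (v * v + vs * vs) - v * (vss + (1 - real n) * vs)
      + s\<^sup>2 * (real n / 2 * (Q * (vt * vt) - (vs + t * vt) * (vs + t * vt)) + v * m))"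
    by (intro sums_add sums_mult sR1 sums_shift2 sR2)
  have pz: "p k = 0" if "k < n" for k using that by (simp add: p_def vcoef_less)
  have zero: "X k = 0" "Y k = 0" "Z k = 0" "T k = 0" "U k = 0" "W k = 0" "E k = 0" "M k = 0" "L k = 0"
    if "k < n" for k
    using pz[OF that] by (simp_all add: X_def Y_def Z_def T_def U_def W_def E_def M_def L_def pser_dt_def)
  \<comment> \<open>A product of two series that start at order n starts at order 2n, so the
    nonlinear terms are invisible at orders k \<le> n.\<close>
  have zero2: "(\<Sum>i\<le>k. a i * b (k - i)) = 0"
    if "\<And>k. k < n \<Longrightarrow> a k = 0" "\<And>k. k < n \<Longrightarrow> b k = 0" "k < n + n" for a b :: "nat \<Rightarrow> real" and k
  proof (rule sum.neutral, rule ballI)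
    fix i assume "i \<in> {..k}"
    then have "i < n \<or> k - i < n" using that(3) by auto
    then show "a i * b (k - i) = 0" using that by auto
  qed
  have L_lam: "L k = lap_coef n k * X k" for k
    by (simp add: L_def Z_def Y_def X_def lap_coef_def power2_eq_square algebra_simps)
  have M_radial_op: "M k = poly (radial_op Q k (p k)) t * s ^ k" for k
    by (simp add: M_def E_def Z_def Y_def X_def U_def T_def W_def pser_dt_def poly_radial_op algebra_simps)
  have E_euler_op: "E k = poly (euler_op k (p k)) t * s ^ k" for k
    by (simp add: E_def Y_def T_def pser_dt_def poly_euler_op algebra_simps)
  have eq: "L k - real n * X k - s\<^sup>2 * (if k < 2 then 0 else M (k - 2)) =
      R1 k + s\<^sup>2 * (if k < 2 then 0 else R2 (k - 2))" for k
  proof (cases "n < k")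
    case False
    have "R1 k = 0"
      unfolding R1_def using False n by (simp add: zero2 zero)
    moreover have "R2 (k - 2) = 0"
      unfolding R2_def using False n by (simp add: zero2 zero)
    moreover have "M (k - 2) = 0 \<or> k < 2" using False n zero(8)[of "k - 2"] by force
    moreover have "L k - real n * X k = 0"
    \<comment> \<open>At k = n the factor \<open>lap_coef n n - n\<close> is zero and the equation
      puts no condition on the coefficient: this is why \<open>P\<close> is free.\<close>
    proof (cases "k = n")
      case False
      then show ?thesis using \<open>\<not> n < k\<close> zero(1,9)[of k] by simp
    qed (simp add: L_lam lap_coef_def)
    ultimately show ?thesis by auto
  next
    case True
    have k2: "\<not> k < 2" "2 \<le> k" using True n by auto
    have kn: "(real k - real n) * (real k + 1) \<noteq> 0" using True by simp
    have sk: "s ^ k = s\<^sup>2 * s ^ (k - 2)" using le_add_diff_inverse[OF k2(2)] by (metis power_add)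
    have R1': "R1 k = (\<Sum>i\<in>{1..<k}. quad_coef n i (k - i) * poly (p i) t * poly (p (k - i)) t) * s ^ k"
    proof -
      have "R1 k = (\<Sum>i\<le>k. real n / 2 * (X i * X (k - i) + Y i * Y (k - i)) - X i * L (k - i))"
        by (simp add: R1_def sum_subtractf sum.distrib sum_distrib_left distrib_left)
      \<comment> \<open>The terms i = 0 and i = k contain the vanishing coefficient of order 0;
        dropping them gives the range used in \<open>vcoef\<close>.\<close>
      also have "\<dots> = (\<Sum>i\<in>{1..<k}. real n / 2 * (X i * X (k - i) + Y i * Y (k - i)) - X i * L (k - i))"
      proof (rule sum.mono_neutral_right)
        show "\<forall>i\<in>{..k} - {1..<k}. real n / 2 * (X i * X (k - i) + Y i * Y (k - i)) - X i * L (k - i) = 0"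
        proof
          fix i assume "i \<in> {..k} - {1..<k}"
          then have "i = 0 \<or> i = k" by auto
          then show "real n / 2 * (X i * X (k - i) + Y i * Y (k - i)) - X i * L (k - i) = 0"
            using zero[of 0] n by auto
        qed
      qed auto
      also have "\<dots> = (\<Sum>i\<in>{1..<k}. quad_coef n i (k - i) * poly (p i) t * poly (p (k - i)) t * s ^ k)"
      proof (rule sum.cong[OF refl])
        fix i assume "i \<in> {1..<k}"
        then have "s ^ k = s ^ i * s ^ (k - i)" by (simp flip: power_add)
        then show "real n / 2 * (X i * X (k - i) + Y i * Y (k - i)) - X i * L (k - i) =
            quad_coef n i (k - i) * poly (p i) t * poly (p (k - i)) t * s ^ k"
          by (simp add: L_lam X_def Y_def quad_coef_def algebra_simps)
      qed
      finally show ?thesis by (simp add: sum_distrib_right)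
    qed
    have R2': "R2 (k - 2) = (\<Sum>i\<le>k-2. poly (quad_op n Q i (k - 2 - i) (p i) (p (k - 2 - i))) t) * s ^ (k - 2)"
    proof -
      have "R2 (k - 2) = (\<Sum>i\<le>k-2. real n / 2 * (Q * (T i * T (k - 2 - i)) - E i * E (k - 2 - i)) + X i * M (k - 2 - i))"
        by (simp add: R2_def sum_subtractf sum.distrib sum_distrib_left distrib_left right_diff_distrib del: diff_diff_left)
      also have "\<dots> = (\<Sum>i\<le>k-2. poly (quad_op n Q i (k - 2 - i) (p i) (p (k - 2 - i))) t * s ^ (k - 2))"
      proof (rule sum.cong[OF refl])
        fix i assume "i \<in> {..k-2}"
        then have "s ^ (k - 2) = s ^ i * s ^ (k - 2 - i)" by (simp flip: power_add diff_diff_left)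
        then show "real n / 2 * (Q * (T i * T (k - 2 - i)) - E i * E (k - 2 - i)) + X i * M (k - 2 - i) =
            poly (quad_op n Q i (k - 2 - i) (p i) (p (k - 2 - i))) t * s ^ (k - 2)"
          by (simp add: M_radial_op E_euler_op X_def T_def pser_dt_def quad_op_def algebra_simps del: diff_diff_left)
      qed
      finally show ?thesis by (simp add: sum_distrib_right)
    qed
    have "L k - real n * X k = (real k - real n) * (real k + 1) * X k"
      by (simp add: L_lam lap_coef_def algebra_simps)
    also have "\<dots> = (poly (radial_op Q (k - 2) (p (k - 2))) t
       + (\<Sum>i\<in>{1..<k}. quad_coef n i (k - i) * poly (p i) t * poly (p (k - i)) t)
       + (\<Sum>i\<le>k-2. poly (quad_op n Q i (k - 2 - i) (p i) (p (k - 2 - i))) t)) * s ^ k"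
      unfolding X_def p_def vcoef_rec[OF True]
      using kn by (simp add: poly_sum mult.assoc del: diff_diff_left)
    also have "\<dots> = s\<^sup>2 * M (k - 2) + R1 k + s\<^sup>2 * R2 (k - 2)"
      unfolding M_radial_op R1' R2' sk by (simp add: algebra_simps del: diff_diff_left)
    finally show ?thesis using k2 by simp
  qed
  have "vss + (1 - real n) * vs - real n * v - s\<^sup>2 * m =
      real n / 2 * (v * v + vs * vs) - v * (vss + (1 - real n) * vs)
      + s\<^sup>2 * (real n / 2 * (Q * (vt * vt) - (vs + t * vt) * (vs + t * vt)) + v * m)"
    using sums_unique2[OF sl sr[folded eq]] .
  then show ?thesis by (simp only: power2_eq_square)
qed


lemma pser_at_0: "pser p 0 t = poly (p 0) t"
  unfolding pser_def by (rule powser_zero)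

lemma pser_conv_I:
  assumes A: "0 < A" and B: "1 \<le> B" and d: "\<And>k. degree (p k) \<le> k + m"
    and b: "\<And>K. (\<Sum>k\<le>K. A ^ k * pnorm B (p k)) \<le> M"
  shows "pser_conv A B p" and "\<And>s t. \<bar>s\<bar> < A \<Longrightarrow> \<bar>t\<bar> \<le> B \<Longrightarrow> \<bar>pser p s t\<bar> \<le> M"
proof -
  have B0: "0 \<le> B" using B by simp
  have sA: "summable (\<lambda>k. A ^ k * pnorm B (p k))"
    using A B0 b by (intro bounded_imp_summable) (auto simp: mult_nonneg_nonneg)
  have le: "norm (pnorm B (p k) * x ^ k) \<le> A ^ k * pnorm B (p k)" if "\<bar>x\<bar> < A" for x k
    using that B0 mult_right_mono[OF power_mono[of "\<bar>x\<bar>" A k], of "pnorm B (p k)"]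
    by (simp add: abs_mult power_abs mult.commute)
  have "summable (\<lambda>k. pnorm B (p k) * x ^ k)" if "\<bar>x\<bar> < A" for x
    by (rule summable_comparison_test'[OF sA le[OF that]])
  then show c: "pser_conv A B p" unfolding pser_conv_def using B d by blast
  fix s t assume st: "\<bar>s\<bar> < A" "\<bar>t\<bar> \<le> B"
  have "\<bar>pser p s t\<bar> \<le> (\<Sum>k. \<bar>poly (p k) t * s ^ k\<bar>)"
    unfolding pser_def by (rule summable_rabs[OF pser_abs_summable[OF c st]])
  also have "\<dots> \<le> M"
  proof (rule suminf_le_const[OF pser_abs_summable[OF c st]])
    fix K
    have "(\<Sum>k<K. \<bar>poly (p k) t * s ^ k\<bar>) \<le> (\<Sum>k<K. A ^ k * pnorm B (p k))"
    proof (rule sum_mono)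
      fix k
      have "\<bar>poly (p k) t * s ^ k\<bar> \<le> norm (pnorm B (p k) * s ^ k)"
        using abs_poly_le_pnorm[OF st(2), of "p k"] B0 by (simp add: abs_mult mult_right_mono)
      then show "\<bar>poly (p k) t * s ^ k\<bar> \<le> A ^ k * pnorm B (p k)" using le[OF st(1), of k] by linarith
    qed
    also have "\<dots> \<le> (\<Sum>k\<le>K. A ^ k * pnorm B (p k))"
      using A B0 by (intro sum_mono2) auto
    also have "\<dots> \<le> M" by (rule b)
    finally show "(\<Sum>k<K. \<bar>poly (p k) t * s ^ k\<bar>) \<le> M" .
  qed
  finally show "\<bar>pser p s t\<bar> \<le> M" .
qed

text \<open>The bound 1/2 will keep 1 + v away from zero. The shifted series exhibits v as s^n times
  a series that converges on the same domain, from which both the decay and the charges are read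
  off.\<close>

lemma vcoef_converges:
  assumes n: "2 \<le> n" and P: "degree P \<le> n" and B: "1 \<le> B" and Q: "0 \<le> Q"
  obtains A where "0 < A" "pser_conv A B (vcoef n Q P)" "pser_conv A B (\<lambda>k. vcoef n Q P (k + n))"
    "\<And>s t. \<bar>s\<bar> < A \<Longrightarrow> \<bar>t\<bar> \<le> B \<Longrightarrow> \<bar>pser (vcoef n Q P) s t\<bar> \<le> 1/2"
    "\<And>s t. \<bar>s\<bar> < A \<Longrightarrow> \<bar>t\<bar> \<le> B \<Longrightarrow> pser (vcoef n Q P) s t = s ^ n * pser (\<lambda>k. vcoef n Q P (k + n)) s t"
proof -
  define p where "p = vcoef n Q P"
  obtain A where A: "0 < A" "\<And>K. (\<Sum>k\<le>K. A ^ k * pnorm B (p k)) \<le> 1/2"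
    using vcoef_bounded[OF assms] unfolding p_def by blast
  have d: "degree (p k) \<le> k + 0" for k unfolding p_def using degree_vcoef[OF P, of Q k] n by simp
  note c = pser_conv_I[OF A(1) B d A(2)]
  have B0: "0 \<le> B" using B by simp
  have c2: "pser_conv A B (\<lambda>k. p (k + n))"
  proof (rule pser_conv_I(1)[OF A(1) B])
    show "degree (p (k + n)) \<le> k + n" for k using d[of "k + n"] by simp
    show "(\<Sum>k\<le>K. A ^ k * pnorm B (p (k + n))) \<le> (1/2) / A ^ n" for K
    proof -
      have "(\<Sum>k\<le>K. A ^ k * pnorm B (p (k + n))) * A ^ n = (\<Sum>k\<le>K. A ^ (k + n) * pnorm B (p (k + n)))"
        unfolding sum_distrib_right by (intro sum.cong) (simp_all add: power_add mult_ac)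
      also have "\<dots> = (\<Sum>k\<in>(\<lambda>k. k + n) ` {..K}. A ^ k * pnorm B (p k))"
        by (subst sum.reindex) auto
      also have "\<dots> \<le> (\<Sum>k\<le>K+n. A ^ k * pnorm B (p k))"
        using A B0 by (intro sum_mono2) auto
      also have "\<dots> \<le> 1/2" by (rule A)
      finally show ?thesis using A by (simp add: pos_le_divide_eq)
    qed
  qed
  have e: "pser p s t = s ^ n * pser (\<lambda>k. p (k + n)) s t" if st: "\<bar>s\<bar> < A" "\<bar>t\<bar> \<le> B" for s t
  proof -
    have "(\<lambda>k. s ^ n * (poly (p (k + n)) t * s ^ k)) sums (s ^ n * pser (\<lambda>k. p (k + n)) s t)"
      by (intro sums_mult pser_sums[OF c2 st])
    then have "(\<lambda>k. poly (p (k + n)) t * s ^ (k + n)) sums (s ^ n * pser (\<lambda>k. p (k + n)) s t)"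
      by (simp add: power_add mult_ac)
    moreover have "(\<Sum>k<n. poly (p k) t * s ^ k) = 0"
      by (rule sum.neutral) (auto simp: p_def vcoef_less)
    ultimately have "(\<lambda>k. poly (p k) t * s ^ k) sums (s ^ n * pser (\<lambda>k. p (k + n)) s t)"
      using sums_iff_shift[of "\<lambda>k. poly (p k) t * s ^ k" n] by simp
    then show ?thesis using pser_sums[OF c(1) st] sums_unique2 by blast
  qed
  show ?thesis
    by (rule that[OF A(1)]) (use c c2 e in \<open>auto simp: p_def\<close>)
qed

section \<open>Calculus of smooth maps\<close>

lemma partial_eqI: "(f has_derivative f') (at x) \<Longrightarrow> partial i f x = f' (axis i 1)"
  unfolding partial_def by (metis frechet_derivative_at)

lemma partial_eq_fun: "partial i f = (\<lambda>x. frechet_derivative f (at x) (axis i 1))"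
  by (rule ext) (simp add: partial_def)

lemma partial_cong_open:
  assumes "open U" "x \<in> U" "\<And>y. y \<in> U \<Longrightarrow> f y = g y"
  shows "partial i f x = partial i g x"
proof -
  have "(f has_derivative D) (at x) \<longleftrightarrow> (g has_derivative D) (at x)" for D
    using assms by (metis has_derivative_transform_within_open)
  then show ?thesis by (simp add: partial_def frechet_derivative_def)
qed

lemma differentiable_on_cong:
  assumes "\<And>y. y \<in> U \<Longrightarrow> f y = g y" "f differentiable_on U"
  shows "g differentiable_on U"
  using assms has_derivative_transform[of _ U g f]
  unfolding differentiable_on_def differentiable_def by force

lemma Ck_on_cong:
  assumes "open U" "\<And>y. y \<in> U \<Longrightarrow> f y = g y" "Ck_on k U f"
  shows "Ck_on k U g"
  using assms(2,3)
proof (induction k arbitrary: f g)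
  case 0
  then show ?case unfolding Ck_on.simps by (metis continuous_on_cong)
next
  case (Suc k)
  have "g differentiable_on U"
    by (rule differentiable_on_cong[of U f]) (use Suc.prems in auto)
  moreover have "Ck_on k U (partial i g)" for i
  proof (rule Suc.IH)
    show "partial i f y = partial i g y" if "y \<in> U" for y
      using that Suc.prems(1) by (rule partial_cong_open[OF assms(1)])
    show "Ck_on k U (partial i f)" using Suc.prems by simp
  qed
  ultimately show ?case by simp
qed

lemma Ck_on_subset: "Ck_on k U f \<Longrightarrow> V \<subseteq> U \<Longrightarrow> Ck_on k V f"
proof (induction k arbitrary: f)
  case 0
  then show ?case unfolding Ck_on.simps by (rule continuous_on_subset)
next
  case (Suc k)
  then show ?case unfolding Ck_on.simps using differentiable_on_subset by blast
qed

lemma Ck_on_SucD: "Ck_on (Suc k) U f \<Longrightarrow> Ck_on k U f"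
proof (induction k arbitrary: f)
  case 0
  then show ?case unfolding Ck_on.simps using differentiable_imp_continuous_on by blast
next
  case (Suc k)
  then show ?case unfolding Ck_on.simps(2)[of "Suc k"] Ck_on.simps(2)[of k U f] by blast
qed

lemma Ck_on_Suc_partial:
  "Ck_on (Suc k) U f \<Longrightarrow> Ck_on k U (\<lambda>x. frechet_derivative f (at x) (axis i 1))"
  by (simp add: partial_eq_fun)

text \<open>A derivative formula valid on the open set alone is enough: \<open>partial\<close> may
  differ from it elsewhere, but \<open>Ck_on\<close> on an open set does not see values
  outside.\<close>

lemma Ck_on_SucI:
  assumes "open U" and "\<And>x. x \<in> U \<Longrightarrow> (f has_derivative f' x) (at x)"
    and "\<And>i. Ck_on k U (\<lambda>x. f' x (axis i 1))"
  shows "Ck_on (Suc k) U f"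
proof -
  have "f differentiable_on U"
    using assms(2) by (auto simp: differentiable_on_def differentiable_def intro: has_derivative_at_withinI)
  moreover have "Ck_on k U (partial i f)" for i
    by (rule Ck_on_cong[OF assms(1) _ assms(3)[of i]]) (simp add: partial_eqI[OF assms(2)])
  ultimately show ?thesis by simp
qed

lemma Ck_on_Suc_has_derivative:
  assumes "open U" "Ck_on (Suc k) U f" "x \<in> U"
  shows "(f has_derivative frechet_derivative f (at x)) (at x)"
    using assms by (auto simp: differentiable_on_eq_differentiable_at frechet_derivative_works)

lemma Ck_on_const: "Ck_on k U (\<lambda>_ :: real^'n. c)"
proof (induction k arbitrary: c)
  case (Suc k)
  have "partial i (\<lambda>_ :: real^'n. c) = (\<lambda>_. 0)" for i
    by (rule ext) (rule partial_eqI[OF has_derivative_const])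
  then show ?case using Suc[of 0] Suc[of c] by simp
qed simp

lemma Ck_on_bounded_linear:
  assumes "open U" "bounded_linear T"
  shows "Ck_on k U f \<Longrightarrow> Ck_on k U (\<lambda>x. T (f x))"
proof (induction k arbitrary: f)
  case 0
  then show ?case unfolding Ck_on.simps by (rule bounded_linear.continuous_on[OF assms(2)])
next
  case (Suc k)
  show ?case
  proof (rule Ck_on_SucI[OF assms(1)])
    show "((\<lambda>x. T (f x)) has_derivative (\<lambda>h. T (frechet_derivative f (at x) h))) (at x)" if "x \<in> U" for x
      using bounded_linear.has_derivative[OF assms(2)] Ck_on_Suc_has_derivative[OF assms(1) Suc.prems that] .
    show "Ck_on k U (\<lambda>x. T (frechet_derivative f (at x) (axis i 1)))" for i
      by (intro Suc.IH Ck_on_Suc_partial Suc.prems)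
  qed
qed

lemma Ck_on_id: "open U \<Longrightarrow> Ck_on k U (\<lambda>x. x)"
proof (cases k)
  case 0
  then show ?thesis unfolding Ck_on.simps by simp
next
  case (Suc m)
  assume "open U"
  then show ?thesis unfolding Suc
    by (rule Ck_on_SucI[OF _ has_derivative_ident]) (rule Ck_on_const)
qed

lemma Ck_on_add:
  assumes "open U"
  shows "Ck_on k U f \<Longrightarrow> Ck_on k U g \<Longrightarrow> Ck_on k U (\<lambda>x. f x + g x)"
proof (induction k arbitrary: f g)
  case 0
  then show ?case unfolding Ck_on.simps by (rule continuous_on_add)
next
  case (Suc k)
  show ?case
  proof (rule Ck_on_SucI[OF assms(1)])
    show "((\<lambda>x. f x + g x) has_derivative (\<lambda>h. frechet_derivative f (at x) h + frechet_derivative g (at x) h)) (at x)" if "x \<in> U" for x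
      by (intro has_derivative_add Ck_on_Suc_has_derivative[OF assms(1) _ that, where k = k] Suc.prems)
    show "Ck_on k U (\<lambda>x. frechet_derivative f (at x) (axis i 1) + frechet_derivative g (at x) (axis i 1))" for i
      by (intro Suc.IH Ck_on_Suc_partial Suc.prems)
  qed
qed

lemma Ck_on_bilinear:
  assumes "open U" "bounded_bilinear T"
  shows "Ck_on k U f \<Longrightarrow> Ck_on k U g \<Longrightarrow> Ck_on k U (\<lambda>x. T (f x) (g x))"
proof (induction k arbitrary: f g)
  case 0
  then show ?case unfolding Ck_on.simps by (rule bounded_bilinear.continuous_on[OF assms(2)])
next
  case (Suc k)
  show ?case
  proof (rule Ck_on_SucI[OF assms(1)])
    show "((\<lambda>x. T (f x) (g x)) has_derivative
       (\<lambda>h. T (f x) (frechet_derivative g (at x) h) + T (frechet_derivative f (at x) h) (g x))) (at x)" if "x \<in> U" for x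
      by (intro bounded_bilinear.FDERIV[OF assms(2)] Ck_on_Suc_has_derivative[OF assms(1) _ that, where k = k] Suc.prems)
    show "Ck_on k U (\<lambda>x. T (f x) (frechet_derivative g (at x) (axis i 1))
        + T (frechet_derivative f (at x) (axis i 1)) (g x))" for i
      by (intro Ck_on_add[OF assms(1)] Suc.IH Ck_on_Suc_partial Suc.prems Ck_on_SucD)
  qed
qed

lemmas Ck_on_mult = Ck_on_bilinear[OF _ bounded_bilinear_mult]
lemmas Ck_on_scaleR = Ck_on_bilinear[OF _ bounded_bilinear_scaleR]
lemmas Ck_on_inner = Ck_on_bilinear[OF _ bounded_bilinear_inner]

lemma Ck_on_minus: "open U \<Longrightarrow> Ck_on k U f \<Longrightarrow> Ck_on k U (\<lambda>x. - f x)"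
  by (rule Ck_on_bounded_linear[OF _ bounded_linear_minus[OF bounded_linear_ident]])

lemma Ck_on_diff: "open U \<Longrightarrow> Ck_on k U f \<Longrightarrow> Ck_on k U g \<Longrightarrow> Ck_on k U (\<lambda>x. f x - g x)"
  unfolding diff_conv_add_uminus by (intro Ck_on_add Ck_on_minus)

lemma Ck_on_inverse:
  fixes f :: "real^'n \<Rightarrow> real"
  assumes "open U" and nz: "\<And>x. x \<in> U \<Longrightarrow> f x \<noteq> 0"
  shows "Ck_on k U f \<Longrightarrow> Ck_on k U (\<lambda>x. inverse (f x))"
proof (induction k)
  case 0
  then show ?case unfolding Ck_on.simps using nz by (intro continuous_on_inverse) auto
next
  case (Suc k)
  note f = Ck_on_SucD[OF Suc.prems] and p = Ck_on_Suc_partial[OF Suc.prems]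
  show ?case
  proof (rule Ck_on_SucI[OF assms(1)])
    show "((\<lambda>x. inverse (f x)) has_derivative
       (\<lambda>h. - (inverse (f x) * frechet_derivative f (at x) h * inverse (f x)))) (at x)" if "x \<in> U" for x
      by (rule Deriv.has_derivative_inverse[OF nz[OF that] Ck_on_Suc_has_derivative[OF assms(1) Suc.prems that]])
    show "Ck_on k U (\<lambda>x. - (inverse (f x) * frechet_derivative f (at x) (axis i 1) * inverse (f x)))" for i
      by (intro Ck_on_minus Ck_on_mult Suc.IH f p assms(1))
  qed
qed

lemma Ck_on_divide:
  fixes f :: "real^'n \<Rightarrow> real"
  assumes "open U" and "\<And>x. x \<in> U \<Longrightarrow> g x \<noteq> 0"
    and "Ck_on k U f" "Ck_on k U g"
  shows "Ck_on k U (\<lambda>x. f x / g x)"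
  unfolding divide_inverse
  by (rule Ck_on_mult[OF assms(1,3) Ck_on_inverse[OF assms(1,2,4)]])

lemma Ck_on_sqrt:
  assumes "open U" and pos: "\<And>x. x \<in> U \<Longrightarrow> f x > 0"
  shows "Ck_on k U f \<Longrightarrow> Ck_on k U (\<lambda>x. sqrt (f x))"
proof (induction k)
  case 0
  then show ?case unfolding Ck_on.simps by (rule continuous_on_real_sqrt)
next
  case (Suc k)
  note f = Ck_on_SucD[OF Suc.prems] and p = Ck_on_Suc_partial[OF Suc.prems]
  have nz: "sqrt (f x) \<noteq> 0" if "x \<in> U" for x using pos[OF that] by simp
  show ?case
  proof (rule Ck_on_SucI[OF assms(1)])
    show "((\<lambda>x. sqrt (f x)) has_derivative
       (\<lambda>h. inverse (sqrt (f x)) * frechet_derivative f (at x) h * (1/2))) (at x)" if "x \<in> U" for x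
      using has_derivative_real_sqrt[OF pos[OF that] Ck_on_Suc_has_derivative[OF assms(1) Suc.prems that]]
      by (simp add: mult.commute)
    show "Ck_on k U (\<lambda>x. inverse (sqrt (f x)) * frechet_derivative f (at x) (axis i 1) * (1/2))" for i
      by (intro Ck_on_mult Ck_on_inverse Ck_on_const Suc.IH f p nz assms(1))
  qed
qed

lemma Ck_on_vec:
  fixes f :: "real^'n \<Rightarrow> ('b::euclidean_space)^'m"
  assumes "open U"
  shows "(\<And>j. Ck_on k U (\<lambda>x. f x $ j)) \<Longrightarrow> Ck_on k U f"
proof (induction k arbitrary: f)
  case 0
  then show ?case
    by (simp add: continuous_on_eq_continuous_within continuous_within vec_tendstoI)
next
  case (Suc k)
  show ?case
  proof (rule Ck_on_SucI[OF assms(1)])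
    show "(f has_derivative (\<lambda>h. \<chi> j. frechet_derivative (\<lambda>x. f x $ j) (at x) h)) (at x)" if "x \<in> U" for x
      using Ck_on_Suc_has_derivative[OF assms(1) Suc.prems that]
      unfolding has_derivative_componentwise_within[of f] by (auto simp: Basis_vec_def inner_axis intro!: has_derivative_inner_left)
    show "Ck_on k U (\<lambda>x. \<chi> j. frechet_derivative (\<lambda>x. f x $ j) (at x) (axis i 1))" for i
    proof (rule Suc.IH)
      show "Ck_on k U (\<lambda>x. (\<chi> j. frechet_derivative (\<lambda>x. f x $ j) (at x) (axis i 1)) $ j)" for j
        unfolding vec_lambda_beta by (rule Ck_on_Suc_partial[OF Suc.prems])
    qed
  qed
qed

section \<open>The hyperbolic metric and its conformal changes\<close>

text \<open>A constant in place of an \<open>if\<close> term, so that algebraic normalisation causes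
  no case splits and index sums contract only through \<open>sum_kron\<close>.\<close>

definition kron :: "'n \<Rightarrow> 'n \<Rightarrow> real"
  where "kron i j = (if i = j then 1 else 0)"

definition hyp_rho :: "real^'n \<Rightarrow> real"
  where "hyp_rho x = 1 / (1 + x \<bullet> x)"

lemma one_plus_inner_pos: "0 < 1 + x \<bullet> (x :: real^'n)"
  by (simp add: add_pos_nonneg)

lemma hyp_metric_nth: "hyp_metric x $ i $ j = kron i j - hyp_rho x * x $ i * x $ j"
  by (simp add: hyp_metric_def kron_def hyp_rho_def power2_norm_eq_inner)

lemma kron_sym: "kron i j = kron j i"
  by (simp add: kron_def)

lemma sum_kron:
  fixes f :: "'n::finite \<Rightarrow> real"
  shows "(\<Sum>k\<in>UNIV. kron k i * f k) = f i" "(\<Sum>k\<in>UNIV. kron i k * f k) = f i"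
    "(\<Sum>k\<in>UNIV. f k * kron k i) = f i" "(\<Sum>k\<in>UNIV. f k * kron i k) = f i"
  by (simp_all add: kron_def if_distrib[where f = "\<lambda>a. a * _"] if_distrib[where f = "\<lambda>a. _ * a"] cong: if_cong)

lemma kron_self: "kron k k = 1" by (simp add: kron_def)

text \<open>The inverse of the hyperbolic metric: a rank one perturbation of the identity, inverted
  by the Sherman-Morrison formula.\<close>

definition hyp_inv :: "real^'n \<Rightarrow> real^'n^'n"
  where "hyp_inv x = (\<chi> i j. kron i j + x $ i * x $ j)"

lemma sum_nth_sq: "(\<Sum>k\<in>UNIV. x $ k * x $ k) = x \<bullet> (x :: real^'n)"
  by (simp add: inner_vec_def)

lemma hyp_inv_mult: "(\<Sum>l\<in>UNIV. hyp_inv x $ k $ l * hyp_metric x $ l $ j) = kron k j"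
proof -
  have "(\<Sum>l\<in>UNIV. hyp_inv x $ k $ l * hyp_metric x $ l $ j) =
     (\<Sum>l\<in>UNIV. kron k l * kron l j - kron k l * (hyp_rho x * x $ l * x $ j)
       + x $ k * (x $ l * kron l j) - x $ k * x $ j * hyp_rho x * (x $ l * x $ l))"
    by (rule sum.cong) (simp_all add: hyp_inv_def hyp_metric_nth algebra_simps)
  also have "\<dots> = kron k j - hyp_rho x * x $ k * x $ j + x $ k * x $ j - x $ k * x $ j * hyp_rho x * (x \<bullet> x)"
    by (simp add: sum.distrib sum_subtractf sum_kron sum_nth_sq flip: sum_distrib_left)
  also have "\<dots> = kron k j + x $ k * x $ j * (1 - hyp_rho x * (1 + x \<bullet> x))"
    by (simp add: algebra_simps)
  also have "hyp_rho x * (1 + x \<bullet> x) = 1"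
    using one_plus_inner_pos[of x] by (simp add: hyp_rho_def)
  finally show ?thesis by simp
qed

lemma hyp_metric_sym: "hyp_metric x $ i $ j = hyp_metric x $ j $ i"
  by (simp add: hyp_metric_nth kron_sym)

lemma hyp_inv_sym: "hyp_inv x $ i $ j = hyp_inv x $ j $ i"
  by (simp add: hyp_inv_def kron_sym)

lemma mat_1_nth: "mat 1 $ i $ j = kron i j"
  by (simp add: mat_def kron_def)

lemma matrix_inv_eqI:
  fixes A B :: "real^'n^'n"
  assumes "A ** B = mat 1" shows "matrix_inv B = A"
  unfolding matrix_inv_def
proof (rule some_equality)
  show "B ** A = mat 1 \<and> A ** B = mat 1"
    using assms matrix_left_right_inverse by blast
  show "C = A" if "B ** C = mat 1 \<and> C ** B = mat 1" for C
    using that assms by (metis matrix_mul_assoc matrix_mul_lid matrix_mul_rid)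
qed

lemma matrix_inv_conformal:
  assumes "c \<noteq> 0" shows "matrix_inv (c *\<^sub>R hyp_metric x) = (1 / c) *\<^sub>R hyp_inv x"
proof (rule matrix_inv_eqI)
  have "((1 / c) *\<^sub>R hyp_inv x ** (c *\<^sub>R hyp_metric x)) $ i $ j = kron i j" for i j
    using hyp_inv_mult[of x i j] assms by (simp add: matrix_matrix_mult_def mult_ac)
  then show "(1 / c) *\<^sub>R hyp_inv x ** (c *\<^sub>R hyp_metric x) = mat 1"
    by (simp add: vec_eq_iff mat_1_nth)
qed

lemma matrix_inv_hyp: "matrix_inv (hyp_metric x) = hyp_inv x"
  using matrix_inv_conformal[of 1 x] by simp

lemma hyp_rho_has_derivative:
  "(hyp_rho has_derivative (\<lambda>h. - 2 * (hyp_rho x)\<^sup>2 * (x \<bullet> h))) (at x)"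
proof -
  have "1 + x \<bullet> x \<noteq> 0" using one_plus_inner_pos[of x] by linarith
  then show ?thesis
    unfolding hyp_rho_def[abs_def]
    by (auto intro!: derivative_eq_intros simp: power2_eq_square inner_commute field_simps fun_eq_iff)
qed

lemma vec_nth_has_derivative: "((\<lambda>x. x $ i) has_derivative (\<lambda>h. h $ i)) F"
  by (intro bounded_linear_imp_has_derivative bounded_linear_vec_nth)

lemma hyp_metric_has_derivative:
  "((\<lambda>x. hyp_metric x $ i $ j) has_derivative
    (\<lambda>h. 2 * (hyp_rho x)\<^sup>2 * (x \<bullet> h) * x $ i * x $ j - hyp_rho x * (h $ i * x $ j + x $ i * h $ j))) (at x)"
  unfolding hyp_metric_nth
  by (auto intro!: derivative_eq_intros hyp_rho_has_derivative vec_nth_has_derivative simp: algebra_simps)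

lemma axis_nth: "axis i (1::real) $ j = kron i j"
  by (simp add: axis_def kron_def)

lemma inner_axis_1: "x \<bullet> axis i 1 = x $ i"
  by (simp add: inner_axis)

text \<open>Here \<open>g = E b\<close> with \<open>dE = 2 E \<omega>\<close>, that is \<open>g = exp (2 \<phi>) b\<close> with \<open>\<omega> = d\<phi>\<close>.\<close>

definition conf_christoffel :: "(real^'n \<Rightarrow> real^'n) \<Rightarrow> 'n \<Rightarrow> 'n \<Rightarrow> 'n \<Rightarrow> real^'n \<Rightarrow> real"
  where "conf_christoffel om k i j x = kron k i * om x $ j + kron k j * om x $ i
    - hyp_metric x $ i $ j * (om x $ k + (1 + x \<bullet> om x) * x $ k)"

lemma hyp_inv_x: "(\<Sum>l\<in>UNIV. hyp_inv x $ k $ l * x $ l) = (1 + x \<bullet> x) * x $ k"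
proof -
  have "(\<Sum>l\<in>UNIV. hyp_inv x $ k $ l * x $ l) = (\<Sum>l\<in>UNIV. kron k l * x $ l + x $ k * (x $ l * x $ l))"
    by (rule sum.cong) (simp_all add: hyp_inv_def algebra_simps)
  also have "\<dots> = (1 + x \<bullet> x) * x $ k"
    unfolding sum.distrib sum_distrib_left[symmetric] sum_kron sum_nth_sq by (simp add: algebra_simps)
  finally show ?thesis .
qed

lemma hyp_inv_vec: "(\<Sum>l\<in>UNIV. hyp_inv x $ k $ l * w $ l) = w $ k + (x \<bullet> w) * x $ k"
proof -
  have "(\<Sum>l\<in>UNIV. hyp_inv x $ k $ l * w $ l) = (\<Sum>l\<in>UNIV. kron k l * w $ l + x $ k * (x $ l * w $ l))"
    by (rule sum.cong) (simp_all add: hyp_inv_def algebra_simps)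
  also have "\<dots> = w $ k + (x \<bullet> w) * x $ k"
    unfolding sum.distrib sum_distrib_left[symmetric] sum_kron by (simp add: inner_vec_def algebra_simps)
  finally show ?thesis .
qed

lemma partial_hyp_metric: "partial k (\<lambda>y. hyp_metric y $ i $ j) x =
    2 * (hyp_rho x)\<^sup>2 * x $ k * x $ i * x $ j - hyp_rho x * (kron k i * x $ j + x $ i * kron k j)"
  by (simp add: partial_eqI[OF hyp_metric_has_derivative] axis_nth inner_axis_1)

text \<open>With \<open>om\<close> zero the formula reads \<Gamma>^k_ij = - b_ij x^k, that is, the
  Hessian of each coordinate x^k is x^k b, as for the linear functions on the hyperboloid in
  Minkowski space. The other terms are the usual change under g = exp(2\<phi>) b, the index of
  d\<phi> being raised with \<open>hyp_inv\<close>.\<close>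

lemma christoffel_conformal:
  assumes U: "open U" "x \<in> U"
    and g: "\<And>y. y \<in> U \<Longrightarrow> g y = E y *\<^sub>R hyp_metric y"
    and E: "E x \<noteq> 0" "(E has_derivative (\<lambda>h. 2 * E x * (om x \<bullet> h))) (at x)"
  shows "christoffel g k i j x = conf_christoffel om k i j x"
proof -
  have pg: "partial m (\<lambda>y. g y $ a $ b) x = E x * (2 * om x $ m * hyp_metric x $ a $ b
      + partial m (\<lambda>y. hyp_metric y $ a $ b) x)" for m a b
  proof -
    have "partial m (\<lambda>y. g y $ a $ b) x = partial m (\<lambda>y. E y * hyp_metric y $ a $ b) x"
      by (rule partial_cong_open[OF U]) (simp add: g)
    also have "\<dots> = E x * (2 * om x $ m * hyp_metric x $ a $ b + partial m (\<lambda>y. hyp_metric y $ a $ b) x)"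
      by (subst partial_eqI[OF has_derivative_mult[OF E(2) hyp_metric_has_derivative]])
        (simp add: axis_nth inner_axis_1 partial_hyp_metric algebra_simps)
    finally show ?thesis .
  qed
  have gi: "matrix_inv (g x) = (1 / E x) *\<^sub>R hyp_inv x"
    by (simp add: g[OF U(2)] matrix_inv_conformal[OF E(1)])
  let ?b = "\<lambda>i j. hyp_metric x $ i $ j"
  have "christoffel g k i j x = (\<Sum>l\<in>UNIV. hyp_inv x $ k $ l *
      (om x $ i * ?b l j + om x $ j * ?b l i - om x $ l * ?b i j - hyp_rho x * ?b i j * x $ l))"
    unfolding christoffel_def gi sum_distrib_left
  proof (rule sum.cong[OF refl])
    fix l
    have "partial i (\<lambda>y. g y $ j $ l) x + partial j (\<lambda>y. g y $ i $ l) x - partial l (\<lambda>y. g y $ i $ j) x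
       = E x * (2 * (om x $ i * ?b l j + om x $ j * ?b l i - om x $ l * ?b i j - hyp_rho x * ?b i j * x $ l))"
      unfolding pg partial_hyp_metric
      by (simp add: hyp_metric_nth kron_sym[of j i] kron_sym[of l i] kron_sym[of l j] power2_eq_square algebra_simps)
    then show "1 / 2 * (((1 / E x) *\<^sub>R hyp_inv x) $ k $ l *
         (partial i (\<lambda>y. g y $ j $ l) x + partial j (\<lambda>y. g y $ i $ l) x - partial l (\<lambda>y. g y $ i $ j) x)) =
      hyp_inv x $ k $ l *
      (om x $ i * ?b l j + om x $ j * ?b l i - om x $ l * ?b i j - hyp_rho x * ?b i j * x $ l)"
      using E(1) by simp
  qed
  also have "\<dots> = (\<Sum>l\<in>UNIV. om x $ i * (hyp_inv x $ k $ l * ?b l j) + om x $ j * (hyp_inv x $ k $ l * ?b l i)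
      - ?b i j * (hyp_inv x $ k $ l * om x $ l) - hyp_rho x * ?b i j * (hyp_inv x $ k $ l * x $ l))"
    by (rule sum.cong) (simp_all add: algebra_simps)
  also have "\<dots> = om x $ i * kron k j + om x $ j * kron k i - ?b i j * (om x $ k + (x \<bullet> om x) * x $ k)
      - hyp_rho x * ?b i j * ((1 + x \<bullet> x) * x $ k)"
    by (simp add: sum.distrib sum_subtractf hyp_inv_mult hyp_inv_x hyp_inv_vec flip: sum_distrib_left)
  also have "hyp_rho x * ?b i j * ((1 + x \<bullet> x) * x $ k) = ?b i j * x $ k"
    using one_plus_inner_pos[of x] by (simp add: hyp_rho_def)
  finally show ?thesis by (simp add: conf_christoffel_def algebra_simps)
qed


section \<open>Contractions of the Christoffel symbols; Ricci and scalar curvature of a conformal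
  metric\<close>

lemma hyp_rho_mult: "hyp_rho x * (1 + x \<bullet> x) = 1"
  using one_plus_inner_pos[of x] by (simp add: hyp_rho_def)

text \<open>The vector that multiplies - b_ij in the Christoffel symbols: the gradient of \<phi>
  with respect to b, plus the position vector, which comes from b itself.\<close>

definition conf_vec :: "(real^'n \<Rightarrow> real^'n) \<Rightarrow> real^'n \<Rightarrow> real^'n"
  where "conf_vec om x = om x + (1 + x \<bullet> om x) *\<^sub>R x"

lemma conf_christoffel_eq: "conf_christoffel om k i j x =
    kron k i * om x $ j + kron k j * om x $ i - hyp_metric x $ i $ j * conf_vec om x $ k"
  by (simp add: conf_christoffel_def conf_vec_def)

lemma hyp_rho_inner_conf_vec: "hyp_rho x * (x \<bullet> conf_vec om x) = 1 + x \<bullet> om x - hyp_rho x"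
proof -
  have "hyp_rho x * (x \<bullet> conf_vec om x) = (1 + x \<bullet> om x) * (hyp_rho x * (1 + x \<bullet> x)) - hyp_rho x"
    by (simp add: conf_vec_def inner_add_right algebra_simps)
  then show ?thesis by (simp add: hyp_rho_mult)
qed

lemma sum_hyp_metric_vec: "(\<Sum>k\<in>UNIV. hyp_metric x $ i $ k * v $ k) = v $ i - hyp_rho x * (x \<bullet> v) * x $ i"
proof -
  have "(\<Sum>k\<in>UNIV. hyp_metric x $ i $ k * v $ k) =
      (\<Sum>k\<in>UNIV. kron i k * v $ k - hyp_rho x * x $ i * (x $ k * v $ k))"
    by (rule sum.cong) (simp_all add: hyp_metric_nth algebra_simps)
  also have "\<dots> = v $ i - hyp_rho x * x $ i * (x \<bullet> v)"
    unfolding sum_subtractf sum_distrib_left[symmetric] sum_kron by (simp add: inner_vec_def)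
  finally show ?thesis by simp
qed

lemma sum_hyp_metric_conf_vec:
  "(\<Sum>k\<in>UNIV. hyp_metric x $ i $ k * conf_vec om x $ k) = om x $ i + hyp_rho x * x $ i"
  unfolding sum_hyp_metric_vec hyp_rho_inner_conf_vec by (simp add: conf_vec_def algebra_simps)

text \<open>This trace is the derivative of log sqrt det g: the factor exp(2\<phi>) contributes n
  d\<phi>, and det b = 1 / (1 + |x|^2) gives the other term.\<close>

lemma conf_christoffel_trace:
  "(\<Sum>k\<in>UNIV. conf_christoffel om k k (l::'n::finite) x) = real CARD('n) * om x $ l - hyp_rho x * x $ l"
proof -
  have "(\<Sum>k\<in>UNIV. conf_christoffel om k k l x) =
      (\<Sum>k\<in>UNIV. om x $ l + kron k l * om x $ k - hyp_metric x $ l $ k * conf_vec om x $ k)"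
    by (rule sum.cong) (simp_all add: conf_christoffel_eq kron_self hyp_metric_sym[of x l])
  then show ?thesis
    by (simp add: sum.distrib sum_subtractf sum_kron sum_hyp_metric_conf_vec)
qed

lemma conf_christoffel_prod1:
  fixes x :: "real^'n"
  shows "(\<Sum>k\<in>UNIV. \<Sum>l\<in>UNIV. conf_christoffel om k k l x * conf_christoffel om l i j x) =
    (real CARD('n) * om x $ i - hyp_rho x * x $ i) * om x $ j + (real CARD('n) * om x $ j - hyp_rho x * x $ j) * om x $ i
    - hyp_metric x $ i $ j * (real CARD('n) * (om x \<bullet> conf_vec om x) - hyp_rho x * (x \<bullet> conf_vec om x))"
proof -
  let ?T = "\<lambda>l. real CARD('n) * om x $ l - hyp_rho x * x $ l"
  have "(\<Sum>k\<in>UNIV. \<Sum>l\<in>UNIV. conf_christoffel om k k l x * conf_christoffel om l i j x) =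
      (\<Sum>l\<in>UNIV. ?T l * conf_christoffel om l i j x)"
    by (subst sum.swap) (simp add: conf_christoffel_trace flip: sum_distrib_right)
  also have "\<dots> = (\<Sum>l\<in>UNIV. kron l i * (?T l * om x $ j) + kron l j * (?T l * om x $ i)
      - hyp_metric x $ i $ j * (real CARD('n) * (om x $ l * conf_vec om x $ l) - hyp_rho x * (x $ l * conf_vec om x $ l)))"
    by (rule sum.cong) (simp_all add: conf_christoffel_eq algebra_simps)
  also have "\<dots> = ?T i * om x $ j + ?T j * om x $ i
      - hyp_metric x $ i $ j * (real CARD('n) * (om x \<bullet> conf_vec om x) - hyp_rho x * (x \<bullet> conf_vec om x))"
    unfolding sum_subtractf sum.distrib sum_distrib_left[symmetric] sum_kron by (simp add: inner_vec_def)
  finally show ?thesis .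
qed

lemma conf_christoffel_prod2:
  fixes x :: "real^'n"
  shows "(\<Sum>k\<in>UNIV. \<Sum>l\<in>UNIV. conf_christoffel om k j l x * conf_christoffel om l i k x) =
    (real CARD('n) + 2) * (om x $ i * om x $ j) - 2 * hyp_metric x $ i $ j * (om x \<bullet> conf_vec om x)
    + (hyp_rho x)\<^sup>2 * (x $ i * x $ j)"
proof -
  let ?w = "\<lambda>i. om x $ i" and ?V = "\<lambda>k. conf_vec om x $ k" and ?b = "\<lambda>i j. hyp_metric x $ i $ j"
  let ?wV = "om x \<bullet> conf_vec om x"
  have wV: "(\<Sum>l\<in>UNIV. ?w l * ?V l) = ?wV" by (simp add: inner_vec_def)
  have bV: "(\<Sum>l\<in>UNIV. ?b i l * ?V l) = ?w i + hyp_rho x * x $ i" for i by (rule sum_hyp_metric_conf_vec)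
  have 1: "(\<Sum>l\<in>UNIV. conf_christoffel om k j l x * conf_christoffel om l i k x) =
      2 * (kron k j * (?w i * ?w k)) - kron k j * ?b i k * ?wV + kron k i * (?w j * ?w k) + ?w i * ?w j
      - ?w j * (?b i k * ?V k) - ?b i j * (?w k * ?V k) - ?w i * (?b j k * ?V k)
      + (?w j + hyp_rho x * x $ j) * (?b i k * ?V k)" for k
  proof -
    have "(\<Sum>l\<in>UNIV. conf_christoffel om k j l x * conf_christoffel om l i k x) =
      (\<Sum>l\<in>UNIV. kron l i * (kron k j * ?w l * ?w k) + kron l k * (kron k j * ?w l * ?w i)
        - kron k j * ?b i k * (?w l * ?V l)
        + kron k l * (kron l i * ?w j * ?w k) + kron k l * (kron l k * ?w j * ?w i) - kron k l * (?w j * ?b i k * ?V l)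
        - kron l i * (?b j l * ?V k * ?w k) - kron l k * (?b j l * ?V k * ?w i) + ?V k * ?b i k * (?b j l * ?V l))"
      by (rule sum.cong) (simp_all add: conf_christoffel_eq algebra_simps)
    also have "\<dots> = kron k j * ?w i * ?w k + kron k j * ?w k * ?w i - kron k j * ?b i k * ?wV
        + kron k i * ?w j * ?w k + kron k k * ?w j * ?w i - ?w j * ?b i k * ?V k
        - ?b j i * ?V k * ?w k - ?b j k * ?V k * ?w i + ?V k * ?b i k * (?w j + hyp_rho x * x $ j)"
      unfolding sum_subtractf sum.distrib sum_distrib_left[symmetric] sum_kron wV bV ..
    finally show ?thesis by (simp add: kron_self hyp_metric_sym[of x j i] algebra_simps)
  qed
  have "(\<Sum>k\<in>UNIV. kron k j * ?b i k * ?wV) = ?b i j * ?wV"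
    by (simp add: mult.assoc sum_kron)
  then show ?thesis
    unfolding 1 sum_subtractf sum.distrib sum_distrib_left[symmetric] sum_kron wV bV
    by (simp add: power2_eq_square algebra_simps)
qed

lemma conf_christoffel_partial:
  fixes x :: "real^'n"
  assumes om: "(om has_derivative om') (at x)"
  shows "partial m (conf_christoffel om k i j) x = kron k i * om' (axis m 1) $ j + kron k j * om' (axis m 1) $ i
    - partial m (\<lambda>y. hyp_metric y $ i $ j) x * conf_vec om x $ k
    - hyp_metric x $ i $ j * (om' (axis m 1) $ k + (1 + x \<bullet> om x) * kron k m
        + (om x $ m + x \<bullet> om' (axis m 1)) * x $ k)"
proof -
  have omi: "((\<lambda>x. om x $ a) has_derivative (\<lambda>h. om' h $ a)) (at x)" for a
    by (rule bounded_linear.has_derivative[OF bounded_linear_vec_nth om])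
  have V: "((\<lambda>x. conf_vec om x $ k) has_derivative
      (\<lambda>h. om' h $ k + (1 + x \<bullet> om x) * h $ k + (h \<bullet> om x + x \<bullet> om' h) * x $ k)) (at x)"
    unfolding conf_vec_def vector_add_component vector_scaleR_component
    by (auto intro!: derivative_eq_intros omi om vec_nth_has_derivative simp: algebra_simps)
  have "(conf_christoffel om k i j has_derivative
      (\<lambda>h. kron k i * om' h $ j + kron k j * om' h $ i - (hyp_metric x $ i $ j *
        (om' h $ k + (1 + x \<bullet> om x) * h $ k + (h \<bullet> om x + x \<bullet> om' h) * x $ k) +
        (2 * (hyp_rho x)\<^sup>2 * (x \<bullet> h) * x $ i * x $ j - hyp_rho x * (h $ i * x $ j + x $ i * h $ j)) * conf_vec om x $ k))) (at x)"
    unfolding conf_christoffel_eq[abs_def]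
    by (intro has_derivative_diff has_derivative_add has_derivative_mult_right omi has_derivative_mult V hyp_metric_has_derivative)
  then show ?thesis
    by (subst partial_eqI, assumption)
      (simp add: partial_hyp_metric axis_nth inner_axis_1 inner_commute[of _ "om x"] kron_sym[of m] algebra_simps)
qed

lemma conf_christoffel_div:
  fixes x :: "real^'n"
  assumes om: "(om has_derivative om') (at x)"
  shows "(\<Sum>k\<in>UNIV. partial k (conf_christoffel om k i j) x) =
    om' (axis i 1) $ j + om' (axis j 1) $ i
    - (2 * (hyp_rho x)\<^sup>2 * (x \<bullet> conf_vec om x) * (x $ i * x $ j)
       - hyp_rho x * (conf_vec om x $ i * x $ j + x $ i * conf_vec om x $ j))
    - hyp_metric x $ i $ j * ((\<Sum>k\<in>UNIV. om' (axis k 1) $ k) + (1 + x \<bullet> om x) * real CARD('n)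
       + x \<bullet> om x + (\<Sum>k\<in>UNIV. x $ k * (x \<bullet> om' (axis k 1))))"
proof -
  let ?V = "\<lambda>k. conf_vec om x $ k"
  have "(\<Sum>k\<in>UNIV. partial k (conf_christoffel om k i j) x) = (\<Sum>k\<in>UNIV.
     kron k i * om' (axis k 1) $ j + kron k j * om' (axis k 1) $ i
     - (2 * (hyp_rho x)\<^sup>2 * (x $ i * x $ j) * (x $ k * ?V k)
        - hyp_rho x * (kron k i * (?V k * x $ j) + kron k j * (x $ i * ?V k)))
     - hyp_metric x $ i $ j * (om' (axis k 1) $ k + (1 + x \<bullet> om x)
        + (x $ k * om x $ k + x $ k * (x \<bullet> om' (axis k 1)))))"
    by (rule sum.cong) (simp_all add: conf_christoffel_partial[OF om] partial_hyp_metric kron_self algebra_simps)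
  then show ?thesis
    unfolding sum_subtractf sum.distrib sum_distrib_left[symmetric] sum_kron
    by (simp add: inner_vec_def[of x "conf_vec om x"] inner_vec_def[of x "om x"] algebra_simps)
qed

lemma conf_christoffel_trace_partial:
  fixes x :: "real^'n"
  assumes om: "(om has_derivative om') (at x)"
  shows "(\<Sum>k\<in>UNIV. partial j (conf_christoffel om k i k) x) =
    real CARD('n) * om' (axis j 1) $ i - hyp_rho x * kron i j + 2 * (hyp_rho x)\<^sup>2 * (x $ i * x $ j)"
proof -
  let ?V = "\<lambda>k. conf_vec om x $ k"
  define z where "z = om x $ j + x \<bullet> om' (axis j 1)"
  have "(\<Sum>k\<in>UNIV. partial j (conf_christoffel om k i k) x) = (\<Sum>k\<in>UNIV.
     kron k i * om' (axis j 1) $ k + om' (axis j 1) $ i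
     - (2 * (hyp_rho x)\<^sup>2 * (x $ i * x $ j) * (x $ k * ?V k)
        - hyp_rho x * (kron i j * (x $ k * ?V k) + kron k j * (x $ i * ?V k)))
     - (hyp_metric x $ i $ k * om' (axis j 1) $ k + (1 + x \<bullet> om x) * (kron k j * hyp_metric x $ i $ k)
        + z * (hyp_metric x $ i $ k * x $ k)))"
    by (rule sum.cong) (simp_all add: conf_christoffel_partial[OF om] partial_hyp_metric kron_self
      kron_sym[of j] z_def algebra_simps)
  also have "\<dots> = real CARD('n) * om' (axis j 1) $ i + om' (axis j 1) $ i
     - (2 * (hyp_rho x)\<^sup>2 * (x $ i * x $ j) * (x \<bullet> conf_vec om x)
        - hyp_rho x * (kron i j * (x \<bullet> conf_vec om x) + x $ i * ?V j))
     - (om' (axis j 1) $ i - hyp_rho x * (x \<bullet> om' (axis j 1)) * x $ i + (1 + x \<bullet> om x) * hyp_metric x $ i $ j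
        + z * (x $ i - hyp_rho x * (x \<bullet> x) * x $ i))"
    unfolding sum_subtractf sum.distrib sum_distrib_left[symmetric] sum_kron sum_hyp_metric_vec
    by (simp add: inner_vec_def[of x "conf_vec om x"])
  also have "x $ i - hyp_rho x * (x \<bullet> x) * x $ i = hyp_rho x * x $ i"

  proof -
    have "hyp_rho x = 1 - hyp_rho x * (x \<bullet> x)"
      using hyp_rho_mult[of x] by (simp add: distrib_left)
    then have "hyp_rho x * x $ i = (1 - hyp_rho x * (x \<bullet> x)) * x $ i" by simp
    then show ?thesis by (simp add: left_diff_distrib)
  qed
  also have "2 * (hyp_rho x)\<^sup>2 * (x $ i * x $ j) * (x \<bullet> conf_vec om x) =
      2 * hyp_rho x * (x $ i * x $ j) * (hyp_rho x * (x \<bullet> conf_vec om x))"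
    by (simp add: power2_eq_square)
  also have "hyp_rho x * (kron i j * (x \<bullet> conf_vec om x) + x $ i * ?V j) =
      kron i j * (hyp_rho x * (x \<bullet> conf_vec om x)) + hyp_rho x * x $ i * ?V j"
    by (simp add: algebra_simps)
  finally show ?thesis
    unfolding hyp_rho_inner_conf_vec
    by (simp add: z_def conf_vec_def hyp_metric_nth power2_eq_square algebra_simps)
qed


text \<open>The coefficient of b in the Ricci tensor, namely -(n-1) - \<Delta>\<phi> -
  (n-2)|d\<phi>|^2, together with -(n-2)(x \<bullet> om), the correction that turns second
  coordinate derivatives of \<phi> into the covariant Hessian.\<close>

definition conf_kappa :: "(real^'n \<Rightarrow> real^'n) \<Rightarrow> (real^'n \<Rightarrow> real^'n) \<Rightarrow> real^'n \<Rightarrow> real"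
  where "conf_kappa om om' x = - (\<Sum>k\<in>UNIV. om' (axis k 1) $ k) - (\<Sum>k\<in>UNIV. x $ k * (x \<bullet> om' (axis k 1)))
    - (real CARD('n) - 1) - real CARD('n) * (x \<bullet> om x)
    - (real CARD('n) - 2) * (om x \<bullet> om x + (x \<bullet> om x) + (x \<bullet> om x)\<^sup>2)"

text \<open>Symmetry of the derivative of \<open>om\<close> is not assumed, so it enters in both
  index orders, with coefficients 1 - n and 1. When it is symmetric they combine to -(n-2), and the
  formula is the classical Ric = -(n-1) b - (n-2)(Hess \<phi> - d\<phi> d\<phi>) - (\<Delta>\<phi> +
  (n-2)|d\<phi>|^2) b.\<close>

lemma ricci_conformal:
  fixes x :: "real^'n"
  assumes U: "open U" "x \<in> U"
    and g: "\<And>y. y \<in> U \<Longrightarrow> g y = E y *\<^sub>R hyp_metric y"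
    and E: "\<And>y. y \<in> U \<Longrightarrow> E y \<noteq> 0" "\<And>y. y \<in> U \<Longrightarrow> (E has_derivative (\<lambda>h. 2 * E y * (om y \<bullet> h))) (at y)"
    and om: "(om has_derivative om') (at x)"
  shows "ricci g i j x = (1 - real CARD('n)) * om' (axis j 1) $ i + om' (axis i 1) $ j
    + conf_kappa om om' x * hyp_metric x $ i $ j + (real CARD('n) - 2) * (om x $ i * om x $ j)"
proof -
  let ?C = "conf_christoffel om"
  have chr: "christoffel g k a b y = ?C k a b y" if "y \<in> U" for y k a b
    by (rule christoffel_conformal[of U y g E]) (use U that g E in auto)
  have pc: "partial m (christoffel g k a b) x = partial m (?C k a b) x" for m k a b
    by (rule partial_cong_open[OF U]) (rule chr)
  define P where "P = x \<bullet> om x"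
  define r where "r = hyp_rho x"
  define S where "S = (\<Sum>k\<in>UNIV. om' (axis k 1) $ k)"
  define S2 where "S2 = (\<Sum>k\<in>UNIV. x $ k * (x \<bullet> om' (axis k 1)))"
  define ww where "ww = om x \<bullet> om x"
  let ?V = "conf_vec om x" and ?b = "hyp_metric x $ i $ j"
  have wV: "om x \<bullet> ?V = ww + (1 + P) * P"
    by (simp add: conf_vec_def inner_add_right ww_def P_def inner_commute)
  have rV: "r * (x \<bullet> ?V) = 1 + P - r" unfolding r_def P_def by (rule hyp_rho_inner_conf_vec)
  have r2V: "2 * r\<^sup>2 * (x \<bullet> ?V) * (x $ i * x $ j) = 2 * r * (1 + P - r) * (x $ i * x $ j)"
    unfolding rV[symmetric] by (simp add: power2_eq_square)
  have V: "?V $ a = om x $ a + (1 + P) * x $ a" for a by (simp add: conf_vec_def P_def)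
  have b: "r * kron i j = r * ?b + r\<^sup>2 * (x $ i * x $ j)"
    by (simp add: hyp_metric_nth r_def power2_eq_square algebra_simps)
  have "ricci g i j x = (\<Sum>k\<in>UNIV. partial k (?C k i j) x) - (\<Sum>k\<in>UNIV. partial j (?C k i k) x)
      + ((\<Sum>k\<in>UNIV. \<Sum>l\<in>UNIV. ?C k k l x * ?C l i j x) - (\<Sum>k\<in>UNIV. \<Sum>l\<in>UNIV. ?C k j l x * ?C l i k x))"
    unfolding ricci_def pc chr[OF U(2)] by (simp add: sum_subtractf)
  also have "\<dots> = (om' (axis i 1) $ j + om' (axis j 1) $ i
      - (2 * r * (1 + P - r) * (x $ i * x $ j) - r * (?V $ i * x $ j + x $ i * ?V $ j))
      - ?b * (S + (1 + P) * real CARD('n) + P + S2))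
      - (real CARD('n) * om' (axis j 1) $ i - r * kron i j + 2 * r\<^sup>2 * (x $ i * x $ j))
      + (((real CARD('n) * om x $ i - r * x $ i) * om x $ j + (real CARD('n) * om x $ j - r * x $ j) * om x $ i
          - ?b * (real CARD('n) * (ww + (1 + P) * P) - (1 + P - r)))
        - ((real CARD('n) + 2) * (om x $ i * om x $ j) - 2 * ?b * (ww + (1 + P) * P) + r\<^sup>2 * (x $ i * x $ j)))"
    unfolding conf_christoffel_div[OF om] conf_christoffel_trace_partial[OF om] conf_christoffel_prod1
      conf_christoffel_prod2 r_def[symmetric] P_def[symmetric] S_def[symmetric] S2_def[symmetric] wV rV r2V ..
  also have "\<dots> = (1 - real CARD('n)) * om' (axis j 1) $ i + om' (axis i 1) $ j
    + (- S - S2 - (real CARD('n) - 1) - real CARD('n) * P - (real CARD('n) - 2) * (ww + P + P\<^sup>2)) * ?b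
    + (real CARD('n) - 2) * (om x $ i * om x $ j)"
    unfolding V b by (simp add: power2_eq_square algebra_simps)
  finally show ?thesis
    unfolding conf_kappa_def S_def S2_def P_def ww_def .
qed

lemma hyp_inv_contract:
  fixes x :: "real^'n"
  shows "(\<Sum>i\<in>UNIV. \<Sum>j\<in>UNIV. hyp_inv x $ i $ j * M i j) =
    (\<Sum>i\<in>UNIV. M i i) + (\<Sum>i\<in>UNIV. \<Sum>j\<in>UNIV. x $ i * x $ j * M i j)"
  by (simp add: hyp_inv_def distrib_right sum.distrib sum_kron)

lemma hyp_inv_contract_metric:
  fixes x :: "real^'n"
  shows "(\<Sum>i\<in>UNIV. \<Sum>j\<in>UNIV. hyp_inv x $ i $ j * hyp_metric x $ i $ j) = real CARD('n)"
  by (subst hyp_metric_sym) (simp add: hyp_inv_mult kron_self)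

text \<open>The bracket after 2(n-1) is \<Delta>\<phi> and the last bracket is |d\<phi>|^2, both for
  the hyperbolic metric, written out in Cartesian coordinates; the terms n(x \<bullet> om) and (x
  \<bullet> om)^2 come from the Christoffel symbols and from \<open>hyp_inv\<close>.\<close>

lemma scalar_curvature_conformal:
  fixes x :: "real^'n"
  assumes U: "open U" "x \<in> U"
    and g: "\<And>y. y \<in> U \<Longrightarrow> g y = E y *\<^sub>R hyp_metric y"
    and E: "\<And>y. y \<in> U \<Longrightarrow> E y \<noteq> 0" "\<And>y. y \<in> U \<Longrightarrow> (E has_derivative (\<lambda>h. 2 * E y * (om y \<bullet> h))) (at y)"
    and om: "(om has_derivative om') (at x)"
  defines "n \<equiv> real CARD('n)"
  shows "scalar_curvature g x = (1 / E x) * (- n * (n - 1)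
    - 2 * (n - 1) * ((\<Sum>k\<in>UNIV. om' (axis k 1) $ k) + x \<bullet> om' x + n * (x \<bullet> om x))
    - (n - 2) * (n - 1) * (om x \<bullet> om x + (x \<bullet> om x)\<^sup>2))"
proof -
  have lin: "linear om'" using om by (rule has_derivative_linear)
  define S where "S = (\<Sum>k\<in>UNIV. om' (axis k 1) $ k)"
  have xs: "(\<Sum>k\<in>UNIV. x $ k *\<^sub>R axis k 1) = x"
    by (simp add: vec_eq_iff axis_def if_distrib cong: if_cong)
  have S2: "(\<Sum>k\<in>UNIV. x $ k * (x \<bullet> om' (axis k 1))) = x \<bullet> om' x"
  proof -
    have "om' x = (\<Sum>k\<in>UNIV. x $ k *\<^sub>R om' (axis k 1))"
      by (subst xs[symmetric]) (simp only: linear_sum[OF lin] linear_scale[OF lin])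
    then have "x \<bullet> om' x = x \<bullet> (\<Sum>k\<in>UNIV. x $ k *\<^sub>R om' (axis k 1))" by simp
    also have "\<dots> = (\<Sum>k\<in>UNIV. x $ k * (x \<bullet> om' (axis k 1)))" by (simp add: inner_sum_right)
    finally show ?thesis by simp
  qed
  have D1: "(\<Sum>i\<in>UNIV. \<Sum>j\<in>UNIV. x $ i * x $ j * om' (axis j 1) $ i) = x \<bullet> om' x"
    unfolding S2[symmetric] by (subst sum.swap) (simp add: inner_vec_def sum_distrib_left mult_ac)
  have D2: "(\<Sum>i\<in>UNIV. \<Sum>j\<in>UNIV. x $ i * x $ j * om' (axis i 1) $ j) = x \<bullet> om' x"
    unfolding S2[symmetric] by (simp add: inner_vec_def sum_distrib_left mult_ac)
  have W: "(\<Sum>i\<in>UNIV. \<Sum>j\<in>UNIV. x $ i * x $ j * (om x $ i * om x $ j)) = (x \<bullet> om x)\<^sup>2"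
    by (simp add: inner_vec_def power2_eq_square sum_product mult_ac)
  have c1: "(\<Sum>i\<in>UNIV. \<Sum>j\<in>UNIV. hyp_inv x $ i $ j * om' (axis j 1) $ i) = S + x \<bullet> om' x"
    using hyp_inv_contract[of x "\<lambda>i j. om' (axis j 1) $ i"] D1 by (simp add: S_def)
  have c2: "(\<Sum>i\<in>UNIV. \<Sum>j\<in>UNIV. hyp_inv x $ i $ j * om' (axis i 1) $ j) = S + x \<bullet> om' x"
    using hyp_inv_contract[of x "\<lambda>i j. om' (axis i 1) $ j"] D2 by (simp add: S_def)
  have c3: "(\<Sum>i\<in>UNIV. \<Sum>j\<in>UNIV. hyp_inv x $ i $ j * (om x $ i * om x $ j)) = om x \<bullet> om x + (x \<bullet> om x)\<^sup>2"
    using hyp_inv_contract[of x "\<lambda>i j. om x $ i * om x $ j"] W by (simp add: inner_vec_def[of "om x"])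
  have gi: "matrix_inv (g x) = (1 / E x) *\<^sub>R hyp_inv x"
    by (simp add: g[OF U(2)] matrix_inv_conformal[OF E(1)[OF U(2)]])
  let ?k = "conf_kappa om om' x"
  have ric: "ricci g i j x = (1 - n) * om' (axis j 1) $ i + om' (axis i 1) $ j
    + ?k * hyp_metric x $ i $ j + (n - 2) * (om x $ i * om x $ j)" for i j
    unfolding n_def by (rule ricci_conformal[of U x g E]) (use U g E om in auto)
  have "scalar_curvature g x = (\<Sum>i\<in>UNIV. \<Sum>j\<in>UNIV. (1 / E x) *
     ((1 - n) * (hyp_inv x $ i $ j * om' (axis j 1) $ i) + hyp_inv x $ i $ j * om' (axis i 1) $ j
     + ?k * (hyp_inv x $ i $ j * hyp_metric x $ i $ j) + (n - 2) * (hyp_inv x $ i $ j * (om x $ i * om x $ j))))"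
    unfolding scalar_curvature_def gi ric
    by (intro sum.cong refl) (simp add: algebra_simps)
  also have "\<dots> = (1 / E x) * ((1 - n) * (S + x \<bullet> om' x) + (S + x \<bullet> om' x) + ?k * n
     + (n - 2) * (om x \<bullet> om x + (x \<bullet> om x)\<^sup>2))"
    unfolding sum.distrib sum_distrib_left[symmetric] c1 c2 c3 hyp_inv_contract_metric n_def ..
  also have "?k = - S - x \<bullet> om' x - (n - 1) - n * (x \<bullet> om x)
    - (n - 2) * (om x \<bullet> om x + (x \<bullet> om x) + (x \<bullet> om x)\<^sup>2)"
    unfolding conf_kappa_def S2 n_def S_def ..
  finally show ?thesis
    unfolding S_def[symmetric] by (simp add: power2_eq_square algebra_simps)
qed

section \<open>Smoothness of power series composed with functions on space\<close>

lemma pser_comp_has_derivative: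
  assumes q: "pser_conv A B q" and "\<bar>\<sigma> x\<bar> < A" "\<bar>\<tau> x\<bar> < B"
    and d: "(\<sigma> has_derivative \<sigma>') (at x)" "(\<tau> has_derivative \<tau>') (at x)"
  shows "((\<lambda>x. pser q (\<sigma> x) (\<tau> x)) has_derivative
    (\<lambda>h. \<sigma>' h * pser (pser_ds q) (\<sigma> x) (\<tau> x) + \<tau>' h * pser (pser_dt q) (\<sigma> x) (\<tau> x))) (at x)"
  using has_derivative_compose[OF has_derivative_Pair[OF d] pser_has_derivative[OF assms(1-3)]] by simp

text \<open>The class is closed under differentiation: a partial derivative is a combination of the
  composed series of \<open>pser_ds q\<close> and \<open>pser_dt q\<close>. Hence the induction on
  the order runs over all \<open>q\<close> at once.\<close>

lemma Ck_on_pser: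
  fixes \<sigma> \<tau> :: "real^'n \<Rightarrow> real"
  assumes U: "open U" and \<sigma>: "\<And>k. Ck_on k U \<sigma>" and \<tau>: "\<And>k. Ck_on k U \<tau>"
    and bd: "\<And>x. x \<in> U \<Longrightarrow> \<bar>\<sigma> x\<bar> < A" "\<And>x. x \<in> U \<Longrightarrow> \<bar>\<tau> x\<bar> < B"
  shows "pser_conv A B q \<Longrightarrow> Ck_on k U (\<lambda>x. pser q (\<sigma> x) (\<tau> x))"
proof (induction k arbitrary: q)
  case 0
  have "((\<lambda>x. pser q (\<sigma> x) (\<tau> x)) has_derivative (\<lambda>h. frechet_derivative \<sigma> (at x) h * pser (pser_ds q) (\<sigma> x) (\<tau> x)
      + frechet_derivative \<tau> (at x) h * pser (pser_dt q) (\<sigma> x) (\<tau> x))) (at x)" if "x \<in> U" for x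
    by (intro pser_comp_has_derivative[OF 0] bd that Ck_on_Suc_has_derivative[OF U \<sigma>[of "Suc 0"] that]
      Ck_on_Suc_has_derivative[OF U \<tau>[of "Suc 0"] that])
  then show ?case
    unfolding Ck_on.simps by (meson has_derivative_continuous continuous_at_imp_continuous_on)
next
  case (Suc k)
  show ?case
  proof (rule Ck_on_SucI[OF U])
    show "((\<lambda>x. pser q (\<sigma> x) (\<tau> x)) has_derivative (\<lambda>h. frechet_derivative \<sigma> (at x) h * pser (pser_ds q) (\<sigma> x) (\<tau> x)
      + frechet_derivative \<tau> (at x) h * pser (pser_dt q) (\<sigma> x) (\<tau> x))) (at x)" if "x \<in> U" for x
      by (intro pser_comp_has_derivative[OF Suc.prems] bd that Ck_on_Suc_has_derivative[OF U \<sigma>[of "Suc 0"] that]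
        Ck_on_Suc_has_derivative[OF U \<tau>[of "Suc 0"] that])
    show "Ck_on k U (\<lambda>x. frechet_derivative \<sigma> (at x) (axis i 1) * pser (pser_ds q) (\<sigma> x) (\<tau> x)
      + frechet_derivative \<tau> (at x) (axis i 1) * pser (pser_dt q) (\<sigma> x) (\<tau> x))" for i
      by (intro Ck_on_add[OF U] Ck_on_mult[OF U] Suc.IH pser_conv_ds pser_conv_dt Suc.prems
        Ck_on_Suc_partial[OF \<sigma>[of "Suc k"]] Ck_on_Suc_partial[OF \<tau>[of "Suc k"]])
  qed
qed

section \<open>The conformal factor\<close>

text \<open>The reciprocal of the static potential V_(0), which tends to 0 at infinity. Along the
  ray in direction \<theta>, the companion \<open>tfun\<close> tends to w \<bullet> \<theta>, so (s,
  t) has limits on the sphere at infinity.\<close>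

definition sfun :: "real^'n \<Rightarrow> real"
  where "sfun x = 1 / sqrt (1 + x \<bullet> x)"

definition tfun :: "real^'n \<Rightarrow> real^'n \<Rightarrow> real"
  where "tfun w x = sfun x * (w \<bullet> x)"

lemma sfun_pos: "0 < sfun x"
  using one_plus_inner_pos[of x] by (simp add: sfun_def)

lemma sfun_sq: "(sfun x)\<^sup>2 * (1 + x \<bullet> x) = 1"
  using one_plus_inner_pos[of x] by (simp add: sfun_def power_divide)

lemma norm_sfun: "norm x * sfun x < 1"
proof -
  have "norm x = sqrt (x \<bullet> x)" by (rule norm_eq_sqrt_inner)
  also have "\<dots> < sqrt (1 + x \<bullet> x)" by simp
  finally show ?thesis using one_plus_inner_pos[of x] by (simp add: sfun_def)
qed

lemma tfun_le: "\<bar>tfun w x\<bar> \<le> norm w"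
proof -
  have "\<bar>tfun w x\<bar> = sfun x * \<bar>w \<bullet> x\<bar>" using sfun_pos[of x] by (simp add: tfun_def abs_mult)
  also have "\<dots> \<le> sfun x * (norm w * norm x)"
    using sfun_pos[of x] by (intro mult_left_mono Cauchy_Schwarz_ineq2) auto
  also have "\<dots> = norm w * (norm x * sfun x)" by simp
  also have "\<dots> \<le> norm w * 1" using norm_sfun[of x] by (intro mult_left_mono) auto
  finally show ?thesis by simp
qed

lemma sfun_has_derivative: "(sfun has_derivative (\<lambda>h. - ((sfun x) ^ 3 * (x \<bullet> h)))) (at x)"
proof -
  have p: "0 < 1 + x \<bullet> x" by (rule one_plus_inner_pos)
  have s: "sfun y = inverse (sqrt (1 + y \<bullet> y))" for y :: "real^'n" by (simp add: sfun_def inverse_eq_divide)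
  have i: "((\<lambda>x. 1 + x \<bullet> x) has_derivative (\<lambda>h. 2 * (x \<bullet> h))) (at x)"
    by (auto intro!: derivative_eq_intros simp: inner_commute)
  have "(sfun has_derivative (\<lambda>h. - (inverse (sqrt (1 + x \<bullet> x)) *
      (2 * (x \<bullet> h) * (inverse (sqrt (1 + x \<bullet> x)) / 2)) * inverse (sqrt (1 + x \<bullet> x))))) (at x)"
    unfolding s[abs_def] using p by (intro Deriv.has_derivative_inverse has_derivative_real_sqrt i) auto
  then show ?thesis by (simp add: s power3_eq_cube mult_ac)
qed

lemma tfun_has_derivative:
  "(tfun w has_derivative (\<lambda>h. sfun x * (w \<bullet> h) - (sfun x)\<^sup>2 * tfun w x * (x \<bullet> h))) (at x)"
  unfolding tfun_def[abs_def]
  by (rule has_derivative_eq_rhs[OF has_derivative_mult[OF sfun_has_derivative has_derivative_inner_right[OF has_derivative_ident]]])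
    (auto simp: power3_eq_cube power2_eq_square algebra_simps)

lemma Ck_on_sfun: "Ck_on k UNIV sfun"
proof -
  have "Ck_on k UNIV (\<lambda>x :: real^'n. 1 / sqrt (1 + x \<bullet> x))"
    using one_plus_inner_pos
    by (intro Ck_on_divide Ck_on_const Ck_on_sqrt Ck_on_add Ck_on_inner Ck_on_id open_UNIV)
      (auto simp: less_le)
  then show ?thesis by (simp add: sfun_def[abs_def])
qed

lemma Ck_on_tfun: "Ck_on k UNIV (tfun w)"
  unfolding tfun_def[abs_def]
  by (intro Ck_on_mult Ck_on_sfun Ck_on_inner Ck_on_id Ck_on_const open_UNIV)

text \<open>
  A function \<open>v\<close> of \<open>s\<close> and \<open>t\<close> has gradient \<open>a x + c w\<close>, and \<open>da = aX x + aY w\<close>, \<open>dc = cX x + cY w\<close>;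
  \<open>as, at', cs, ct\<close> are the derivatives of \<open>a\<close> and \<open>c\<close> in \<open>s\<close> and \<open>t\<close>. The left-hand sides are \<open>\<Delta>v\<close>,
  \<open>|dv|\<^sup>2\<close> and \<open>x \<cdot> dv\<close>, computed in Cartesian coordinates.
\<close>

lemma laplacian_identity:
  fixes s t vs vt vss vst vtt n Q r2 wx :: real
  assumes s: "s \<noteq> 0" and r2: "s\<^sup>2 * (1 + r2) = 1" and wx: "t = s * wx"
  defines "a \<equiv> - (s ^ 3) * vs - s\<^sup>2 * t * vt" and "c \<equiv> s * vt"
  defines "as \<equiv> - 3 * s\<^sup>2 * vs - s ^ 3 * vss - 2 * s * t * vt - s\<^sup>2 * t * vst"
    and "at' \<equiv> - (s ^ 3) * vst - s\<^sup>2 * vt - s\<^sup>2 * t * vtt"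
    and "cs \<equiv> vt + s * vst" and "ct \<equiv> s * vtt"
  defines "aX \<equiv> - (s ^ 3) * as - s\<^sup>2 * t * at'" and "aY \<equiv> s * at'"
    and "cX \<equiv> - (s ^ 3) * cs - s\<^sup>2 * t * ct" and "cY \<equiv> s * ct"
  defines "vs' \<equiv> s * vs" and "vss' \<equiv> s\<^sup>2 * vss + s * vs" and "vst' \<equiv> s * vst"
  defines "m \<equiv> vss' + 2 * t * vst' + t * vt + t\<^sup>2 * vtt + (vs' + t * vt) - Q * vtt"
  shows "n * a + aX * r2 + aY * wx + cX * wx + cY * Q + (a * r2 + (aX * r2 + aY * wx) * r2 + (cX * r2 + cY * wx) * wx)
      + n * (a * r2 + c * wx) = vss' + (1 - n) * vs' - s\<^sup>2 * m"
    and "a\<^sup>2 * r2 + 2 * a * c * wx + c\<^sup>2 * Q + (a * r2 + c * wx)\<^sup>2 = vs'\<^sup>2 + s\<^sup>2 * (Q * vt\<^sup>2 - (vs' + t * vt)\<^sup>2)"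
    and "a * r2 + c * wx = - (1 - s\<^sup>2) * vs' + s\<^sup>2 * t * vt"
proof -
  \<comment> \<open>Eliminating |x|^2 and w \<bullet> x in favour of s and t turns all three claims
    into polynomial identities once denominators are cleared.\<close>
  have R: "r2 = (1 - s\<^sup>2) / s\<^sup>2" using r2 s by (simp add: field_simps)
  have W: "wx = t / s" using wx s by simp
  note defs = a_def c_def as_def at'_def cs_def ct_def aX_def aY_def cX_def cY_def vs'_def vss'_def vst'_def m_def
  show "n * a + aX * r2 + aY * wx + cX * wx + cY * Q + (a * r2 + (aX * r2 + aY * wx) * r2 + (cX * r2 + cY * wx) * wx)
      + n * (a * r2 + c * wx) = vss' + (1 - n) * vs' - s\<^sup>2 * m"
    unfolding defs R W using s by (simp add: divide_simps) algebra
  show "a\<^sup>2 * r2 + 2 * a * c * wx + c\<^sup>2 * Q + (a * r2 + c * wx)\<^sup>2 = vs'\<^sup>2 + s\<^sup>2 * (Q * vt\<^sup>2 - (vs' + t * vt)\<^sup>2)"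
    unfolding defs R W using s by (simp add: divide_simps) algebra
  show "a * r2 + c * wx = - (1 - s\<^sup>2) * vs' + s\<^sup>2 * t * vt"
    unfolding defs R W using s by (simp add: divide_simps) algebra
qed


text \<open>The weight \<open>norm w + 1\<close> exceeds every value of |t|, so (s, t) stays in the
  interior of the domain of convergence, where the series is differentiable; this includes s = 0,
  the boundary at infinity.\<close>

locale ah_end =
  fixes w :: "real^'n" and P :: "real poly" and A :: real
  assumes dim: "3 \<le> CARD('n)" and A_pos: "0 < A"
    and conv: "pser_conv A (norm w + 1) (vcoef CARD('n) (w \<bullet> w) P)"
    and conv_shift: "pser_conv A (norm w + 1) (\<lambda>k. vcoef CARD('n) (w \<bullet> w) P (k + CARD('n)))"
    and half: "\<bar>s\<bar> < A \<Longrightarrow> \<bar>t\<bar> \<le> norm w + 1 \<Longrightarrow> \<bar>pser (vcoef CARD('n) (w \<bullet> w) P) s t\<bar> \<le> 1/2"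
    and shift: "\<bar>s\<bar> < A \<Longrightarrow> \<bar>t\<bar> \<le> norm w + 1 \<Longrightarrow> pser (vcoef CARD('n) (w \<bullet> w) P) s t =
      s ^ CARD('n) * pser (\<lambda>k. vcoef CARD('n) (w \<bullet> w) P (k + CARD('n))) s t"
begin

abbreviation "B \<equiv> norm w + 1"
abbreviation "p \<equiv> vcoef CARD('n) (w \<bullet> w) P"

definition far_region :: "(real^'n) set" where "far_region = {x. sfun x < A}"

definition vsol :: "real^'n \<Rightarrow> real" where "vsol x = pser p (sfun x) (tfun w x)"

definition grad_x :: "real^'n \<Rightarrow> real"
  where "grad_x x = - (sfun x ^ 3) * pser (pser_ds p) (sfun x) (tfun w x)
    - (sfun x)\<^sup>2 * tfun w x * pser (pser_dt p) (sfun x) (tfun w x)"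

definition grad_w :: "real^'n \<Rightarrow> real"
  where "grad_w x = sfun x * pser (pser_dt p) (sfun x) (tfun w x)"

definition grad_v :: "real^'n \<Rightarrow> real^'n" where "grad_v x = grad_x x *\<^sub>R x + grad_w x *\<^sub>R w"

definition ah_metric :: "real^'n \<Rightarrow> real^'n^'n"
  where "ah_metric x = (1 / (1 + vsol x)\<^sup>2) *\<^sub>R hyp_metric x"

lemma open_far_region: "open far_region"
  unfolding far_region_def
  using Ck_on_sfun[of 0] by (intro open_Collect_less continuous_on_const) (simp add: Ck_on.simps)

lemma tfun_B: "\<bar>tfun w x\<bar> < B" "\<bar>tfun w x\<bar> \<le> B"
  using tfun_le[of w x] by linarith+

lemma sfun_A: "x \<in> far_region \<Longrightarrow> \<bar>sfun x\<bar> < A"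
  using sfun_pos[of x] by (simp add: far_region_def)

lemma vsol_bound: "x \<in> far_region \<Longrightarrow> \<bar>vsol x\<bar> \<le> 1/2"
  unfolding vsol_def by (intro half sfun_A tfun_B)

lemma F_pos: "x \<in> far_region \<Longrightarrow> 1/2 \<le> 1 + vsol x"
  using vsol_bound[of x] by linarith

lemma pser_x_has_derivative:
  assumes "pser_conv A B q" "x \<in> far_region"
  shows "((\<lambda>x. pser q (sfun x) (tfun w x)) has_derivative
    (\<lambda>h. - (sfun x ^ 3 * (x \<bullet> h)) * pser (pser_ds q) (sfun x) (tfun w x)
      + (sfun x * (w \<bullet> h) - (sfun x)\<^sup>2 * tfun w x * (x \<bullet> h)) * pser (pser_dt q) (sfun x) (tfun w x))) (at x)"
  by (rule pser_comp_has_derivative[OF assms(1) sfun_A[OF assms(2)] tfun_B(1) sfun_has_derivative tfun_has_derivative])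

lemma vsol_has_derivative: "x \<in> far_region \<Longrightarrow> (vsol has_derivative (\<lambda>h. grad_v x \<bullet> h)) (at x)"
  unfolding vsol_def[abs_def]
  by (rule has_derivative_eq_rhs[OF pser_x_has_derivative[OF conv]])
    (auto simp: grad_v_def grad_x_def grad_w_def inner_add_left algebra_simps)

lemma conf_factor_has_derivative:
  assumes y: "y \<in> far_region"
  shows "((\<lambda>y. 1 / (1 + vsol y)\<^sup>2) has_derivative (\<lambda>h. - 2 / (1 + vsol y) ^ 3 * (grad_v y \<bullet> h))) (at y)"
proof -
  have F: "1 + vsol y \<noteq> 0" using F_pos[OF y] by linarith
  have "((\<lambda>y. 1 + vsol y) has_derivative (\<lambda>h. grad_v y \<bullet> h)) (at y)"
    using has_derivative_add[OF has_derivative_const vsol_has_derivative[OF y]] by simp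
  then have "((\<lambda>y. inverse ((1 + vsol y)\<^sup>2)) has_derivative (\<lambda>h. - (inverse ((1 + vsol y)\<^sup>2) *
     (of_nat 2 * (grad_v y \<bullet> h) * (1 + vsol y) ^ (2 - 1)) * inverse ((1 + vsol y)\<^sup>2)))) (at y)"
    using F by (intro Deriv.has_derivative_inverse has_derivative_power) auto
  moreover have "- (inverse ((1 + vsol y)\<^sup>2) * (of_nat 2 * (grad_v y \<bullet> h) * (1 + vsol y) ^ (2 - 1)) * inverse ((1 + vsol y)\<^sup>2))
      = - 2 / (1 + vsol y) ^ 3 * (grad_v y \<bullet> h)" for h
  proof -
    have "- (inverse (f\<^sup>2) * (of_nat 2 * d * f ^ (2 - 1)) * inverse (f\<^sup>2)) = - 2 / f ^ 3 * d"
      if "f \<noteq> 0" for f d :: real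
      using that by (simp add: power2_eq_square power3_eq_cube field_simps)
    then show ?thesis using F by blast
  qed
  ultimately show ?thesis by (simp add: inverse_eq_divide)
qed

context
  fixes x :: "real^'n" assumes x: "x \<in> far_region"
begin

private definition "s = sfun x"
private definition "t = tfun w x"
private definition "vs = pser (pser_ds p) s t"
private definition "vt = pser (pser_dt p) s t"
private definition "vss = pser (pser_ds (pser_ds p)) s t"
private definition "vst = pser (pser_ds (pser_dt p)) s t"
private definition "vtt = pser (pser_dt (pser_dt p)) s t"
private definition "as = - 3 * s\<^sup>2 * vs - s ^ 3 * vss - 2 * s * t * vt - s\<^sup>2 * t * vst"
private definition "at' = - (s ^ 3) * vst - s\<^sup>2 * vt - s\<^sup>2 * t * vtt"
private definition "cs = vt + s * vst"
private definition "ct = s * vtt"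
private definition "aX = - (s ^ 3) * as - s\<^sup>2 * t * at'"
private definition "aY = s * at'"
private definition "cX = - (s ^ 3) * cs - s\<^sup>2 * t * ct"
private definition "cY = s * ct"
private definition "D' h = grad_x x *\<^sub>R h + (aX * (x \<bullet> h) + aY * (w \<bullet> h)) *\<^sub>R x + (cX * (x \<bullet> h) + cY * (w \<bullet> h)) *\<^sub>R w" for h

lemma pser_dt_ds: "pser (pser_dt (pser_ds p)) s t = vst"
  by (simp add: vst_def pser_ds_def pser_dt_def fun_eq_iff pderiv_smult pser_def)

private lemma grad_v_has_derivative: "(grad_v has_derivative D') (at x)"
proof -
  have d: "((\<lambda>x. pser (pser_ds p) (sfun x) (tfun w x)) has_derivative
    (\<lambda>h. - (s ^ 3 * (x \<bullet> h)) * vss + (s * (w \<bullet> h) - s\<^sup>2 * t * (x \<bullet> h)) * vst)) (at x)"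
    "((\<lambda>x. pser (pser_dt p) (sfun x) (tfun w x)) has_derivative
    (\<lambda>h. - (s ^ 3 * (x \<bullet> h)) * vst + (s * (w \<bullet> h) - s\<^sup>2 * t * (x \<bullet> h)) * vtt)) (at x)"
    using pser_x_has_derivative[OF pser_conv_ds[OF conv] x] pser_x_has_derivative[OF pser_conv_dt[OF conv] x]
      pser_dt_ds by (simp_all add: s_def t_def vss_def vst_def vtt_def)
  have sd: "(sfun has_derivative (\<lambda>h. - (s ^ 3 * (x \<bullet> h)))) (at x)"
    "(tfun w has_derivative (\<lambda>h. s * (w \<bullet> h) - s\<^sup>2 * t * (x \<bullet> h))) (at x)"
    unfolding s_def t_def by (rule sfun_has_derivative tfun_has_derivative)+
  have c: "(grad_w has_derivative (\<lambda>h. cX * (x \<bullet> h) + cY * (w \<bullet> h))) (at x)"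
    unfolding grad_w_def[abs_def]
    by (rule has_derivative_eq_rhs[OF has_derivative_mult[OF sd(1) d(2)]])
      (auto simp: cX_def cY_def cs_def ct_def vt_def s_def[symmetric] t_def[symmetric] power3_eq_cube power2_eq_square algebra_simps)
  have a: "(grad_x has_derivative (\<lambda>h. aX * (x \<bullet> h) + aY * (w \<bullet> h))) (at x)"
    unfolding grad_x_def[abs_def]
    by (rule has_derivative_eq_rhs[OF has_derivative_diff[OF
          has_derivative_mult[OF has_derivative_minus[OF has_derivative_power[OF sd(1)]] d(1)]
          has_derivative_mult[OF has_derivative_mult[OF has_derivative_power[OF sd(1)] sd(2)] d(2)]]])
      (auto simp: aX_def aY_def as_def at'_def vs_def vt_def s_def[symmetric] t_def[symmetric]
        power3_eq_cube power2_eq_square numeral_3_eq_3 algebra_simps)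
  show ?thesis
    unfolding grad_v_def[abs_def] D'_def[abs_def]
    by (rule has_derivative_eq_rhs[OF has_derivative_add[OF has_derivative_scaleR[OF a has_derivative_ident]
      has_derivative_scaleR[OF c has_derivative_const]]]) auto
qed

private lemma sx: "s \<noteq> 0" "s\<^sup>2 * (1 + x \<bullet> x) = 1" "t = s * (w \<bullet> x)"
  using sfun_pos[of x] sfun_sq[of x] by (simp_all add: s_def t_def tfun_def)

private lemma afcf: "grad_x x = - (s ^ 3) * vs - s\<^sup>2 * t * vt" "grad_w x = s * vt"
  by (simp_all add: grad_x_def grad_w_def s_def t_def vs_def vt_def)

private lemma lap:
  shows "n * grad_x x + aX * (x \<bullet> x) + aY * (w \<bullet> x) + cX * (w \<bullet> x) + cY * (w \<bullet> w)
      + (grad_x x * (x \<bullet> x) + (aX * (x \<bullet> x) + aY * (w \<bullet> x)) * (x \<bullet> x) + (cX * (x \<bullet> x) + cY * (w \<bullet> x)) * (w \<bullet> x))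
      + n * (grad_x x * (x \<bullet> x) + grad_w x * (w \<bullet> x)) = s\<^sup>2 * vss + s * vs + (1 - n) * (s * vs)
      - s\<^sup>2 * (s\<^sup>2 * vss + s * vs + 2 * t * (s * vst) + t * vt + t\<^sup>2 * vtt + (s * vs + t * vt) - (w \<bullet> w) * vtt)"
    and "(grad_x x)\<^sup>2 * (x \<bullet> x) + 2 * grad_x x * grad_w x * (w \<bullet> x) + (grad_w x)\<^sup>2 * (w \<bullet> w) + (grad_x x * (x \<bullet> x) + grad_w x * (w \<bullet> x))\<^sup>2
      = (s * vs)\<^sup>2 + s\<^sup>2 * ((w \<bullet> w) * vt\<^sup>2 - (s * vs + t * vt)\<^sup>2)"
    and "grad_x x * (x \<bullet> x) + grad_w x * (w \<bullet> x) = - (1 - s\<^sup>2) * (s * vs) + s\<^sup>2 * t * vt"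
  unfolding afcf aX_def aY_def cX_def cY_def as_def at'_def cs_def ct_def
  by (rule laplacian_identity[OF sx])+

lemma x_grad_v: "x \<bullet> grad_v x = - (1 - (sfun x)\<^sup>2) * (sfun x * pser (pser_ds p) (sfun x) (tfun w x))
    + (sfun x)\<^sup>2 * tfun w x * pser (pser_dt p) (sfun x) (tfun w x)"
  using lap(3) by (simp add: grad_v_def inner_add_right inner_commute s_def t_def vs_def vt_def)

private lemma grad: "grad_v x \<bullet> grad_v x + (x \<bullet> grad_v x)\<^sup>2 = (s * vs)\<^sup>2 + s\<^sup>2 * ((w \<bullet> w) * vt\<^sup>2 - (s * vs + t * vt)\<^sup>2)"
proof -
  have "grad_v x \<bullet> grad_v x + (x \<bullet> grad_v x)\<^sup>2 = (grad_x x)\<^sup>2 * (x \<bullet> x) + 2 * grad_x x * grad_w x * (w \<bullet> x) + (grad_w x)\<^sup>2 * (w \<bullet> w)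
      + (grad_x x * (x \<bullet> x) + grad_w x * (w \<bullet> x))\<^sup>2"
    by (simp add: grad_v_def inner_add_left inner_add_right inner_commute[of x w] power2_eq_square algebra_simps)
  then show ?thesis unfolding lap(2) .
qed

text \<open>The negative square in the gradient formula is dropped; what remains involves only
  quantities carrying a factor s^n and suffices for the decay.\<close>

lemma grad_le: "grad_v x \<bullet> grad_v x + (x \<bullet> grad_v x)\<^sup>2 \<le> (sfun x * pser (pser_ds p) (sfun x) (tfun w x))\<^sup>2
    + (sfun x)\<^sup>2 * ((w \<bullet> w) * (pser (pser_dt p) (sfun x) (tfun w x))\<^sup>2)"
proof -
  have "s\<^sup>2 * ((w \<bullet> w) * vt\<^sup>2 - (s * vs + t * vt)\<^sup>2) \<le> s\<^sup>2 * ((w \<bullet> w) * vt\<^sup>2)"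
    by (intro mult_left_mono) auto
  then show ?thesis unfolding grad by (simp add: s_def t_def vs_def vt_def)
qed

lemma scalar_curvature_ah_metric: "scalar_curvature ah_metric x = - real CARD('n) * (real CARD('n) - 1)"
proof -
  define n where "n = real CARD('n)"
  define F where "F = 1 + vsol x"
  define L where "L = s\<^sup>2 * vss + s * vs + (1 - n) * (s * vs) - s\<^sup>2 * (s\<^sup>2 * vss + s * vs + 2 * t * (s * vst) + t * vt
    + t\<^sup>2 * vtt + (s * vs + t * vt) - (w \<bullet> w) * vtt)"
  define G where "G = (s * vs)\<^sup>2 + s\<^sup>2 * ((w \<bullet> w) * vt\<^sup>2 - (s * vs + t * vt)\<^sup>2)"
  have F0: "F \<noteq> 0" using F_pos[OF x] by (simp add: F_def)
  define E where "E y = 1 / (1 + vsol y)\<^sup>2" for y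
  \<comment> \<open>Half the logarithmic differential of E = F^(-2), that is -dF/F, the differential
    of \<phi> = - log F.\<close>
  define om where "om y = (- 1 / (1 + vsol y)) *\<^sub>R grad_v y" for y
  define om' where "om' h = (- 1 / F) *\<^sub>R D' h + ((grad_v x \<bullet> h) / F\<^sup>2) *\<^sub>R grad_v x" for h
  have E': "(E has_derivative (\<lambda>h. 2 * E y * (om y \<bullet> h))) (at y)" if y: "y \<in> far_region" for y
    unfolding E_def[abs_def]
    by (rule has_derivative_eq_rhs[OF conf_factor_has_derivative[OF y]])
      (use F_pos[OF y] in \<open>simp add: om_def fun_eq_iff power2_eq_square power3_eq_cube field_simps\<close>)
  have om: "(om has_derivative om') (at x)"
  proof -
    have "((\<lambda>y. 1 + vsol y) has_derivative (\<lambda>h. grad_v x \<bullet> h)) (at x)"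
      using has_derivative_add[OF has_derivative_const vsol_has_derivative[OF x]] by simp
    then have "((\<lambda>y. - inverse (1 + vsol y)) has_derivative (\<lambda>h. - (- (inverse F * (grad_v x \<bullet> h) * inverse F)))) (at x)"
      unfolding F_def using F_pos[OF x]
      by (intro has_derivative_minus Deriv.has_derivative_inverse) auto
    from has_derivative_scaleR[OF this grad_v_has_derivative]
    show ?thesis
      unfolding om_def[abs_def] om'_def[abs_def]
      by (rule has_derivative_eq_rhs[OF _ ext, THEN has_derivative_transform_within[of _ _ _ _ 1]])
        (auto simp: F_def inverse_eq_divide power2_eq_square)
  qed
  have trD: "(\<Sum>k\<in>UNIV. D' (axis k 1) $ k) = n * grad_x x + aX * (x \<bullet> x) + aY * (w \<bullet> x) + cX * (w \<bullet> x) + cY * (w \<bullet> w)"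
  proof -
    have "(\<Sum>k\<in>UNIV. D' (axis k 1) $ k) = (\<Sum>k\<in>UNIV. grad_x x + aX * (x $ k * x $ k) + aY * (w $ k * x $ k)
        + cX * (w $ k * x $ k) + cY * (w $ k * w $ k))"
      by (rule sum.cong) (simp_all add: D'_def axis_nth kron_self inner_axis_1 algebra_simps)
    then show ?thesis
      unfolding sum.distrib sum_distrib_left[symmetric] by (simp add: inner_vec_def n_def)
  qed
  have tr: "(\<Sum>k\<in>UNIV. om' (axis k 1) $ k) = (- 1 / F) * (\<Sum>k\<in>UNIV. D' (axis k 1) $ k) + (grad_v x \<bullet> grad_v x) / F\<^sup>2"
  proof -
    have "(\<Sum>k\<in>UNIV. om' (axis k 1) $ k) = (\<Sum>k\<in>UNIV. (- 1 / F) * D' (axis k 1) $ k + (1 / F\<^sup>2) * (grad_v x $ k * grad_v x $ k))"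
      by (rule sum.cong) (simp_all add: om'_def inner_axis_1)
    then show ?thesis
      unfolding sum.distrib sum_distrib_left[symmetric] by (simp add: inner_vec_def)
  qed
  have xD: "x \<bullet> D' x = grad_x x * (x \<bullet> x) + (aX * (x \<bullet> x) + aY * (w \<bullet> x)) * (x \<bullet> x) + (cX * (x \<bullet> x) + cY * (w \<bullet> x)) * (w \<bullet> x)"
    by (simp add: D'_def inner_add_right inner_commute[of x w])
  have xDf: "x \<bullet> grad_v x = grad_x x * (x \<bullet> x) + grad_w x * (w \<bullet> x)"
    by (simp add: grad_v_def inner_add_right inner_commute[of x w])
  have L: "(\<Sum>k\<in>UNIV. D' (axis k 1) $ k) + x \<bullet> D' x + n * (x \<bullet> grad_v x) = L"
    unfolding trD xD xDf L_def using lap(1) by (simp add: n_def)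
  have LO: "(\<Sum>k\<in>UNIV. om' (axis k 1) $ k) + x \<bullet> om' x + n * (x \<bullet> om x) = - L / F + G / F\<^sup>2"
  proof -
    have "x \<bullet> om' x = (- 1 / F) * (x \<bullet> D' x) + (x \<bullet> grad_v x)\<^sup>2 / F\<^sup>2"
      by (simp add: om'_def inner_add_right inner_diff_right power2_eq_square inner_commute[of "grad_v x"])
    moreover have "x \<bullet> om x = (- 1 / F) * (x \<bullet> grad_v x)" by (simp add: om_def F_def)
    ultimately show ?thesis
      unfolding tr G_def grad[symmetric] L[symmetric]
      by (simp add: add_divide_distrib diff_divide_distrib distrib_left)
  qed
  have GO: "om x \<bullet> om x + (x \<bullet> om x)\<^sup>2 = G / F\<^sup>2"
    unfolding G_def grad[symmetric] by (simp add: om_def F_def power2_eq_square add_divide_distrib)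
  have pde: "L - n * vsol x = n / 2 * ((vsol x)\<^sup>2 + G) - vsol x * L"
  proof -
    have "2 \<le> CARD('n)" using dim by simp
    from vcoef_equation[OF this conv sfun_A[OF x] tfun_B(2)]
    show ?thesis
      unfolding L_def G_def vsol_def n_def
        vs_def vt_def vss_def vst_def vtt_def s_def t_def
      by (simp add: algebra_simps)
  qed
  have "scalar_curvature ah_metric x = (1 / E x) * (- n * (n - 1)
    - 2 * (n - 1) * ((\<Sum>k\<in>UNIV. om' (axis k 1) $ k) + x \<bullet> om' x + n * (x \<bullet> om x))
    - (n - 2) * (n - 1) * (om x \<bullet> om x + (x \<bullet> om x)\<^sup>2))"
    unfolding n_def
  proof (rule scalar_curvature_conformal[OF open_far_region x])
    show "ah_metric y = E y *\<^sub>R hyp_metric y" for y by (simp add: ah_metric_def E_def)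
    show "E y \<noteq> 0" if "y \<in> far_region" for y using F_pos[OF that] by (simp add: E_def)
  qed (use E' om in auto)
  also have "\<dots> = F\<^sup>2 * (- n * (n - 1) - 2 * (n - 1) * (- L / F + G / F\<^sup>2) - (n - 2) * (n - 1) * (G / F\<^sup>2))"
    unfolding LO GO by (simp add: E_def F_def)
  also have "\<dots> = (n - 1) * (- n * F\<^sup>2 + 2 * (F * L) - n * G)"
    using F0 by (simp add: field_simps power2_eq_square)
  \<comment> \<open>The solved equation in terms of F is 2 F \<Delta>v = n (F^2 - 1 + |dv|^2), with
    \<open>L\<close> for \<Delta>v and \<open>G\<close> for |dv|^2. After substitution the gradient
    terms and the powers of F cancel and only -n(n-1) survives.\<close>
  also have "2 * (F * L) = n * (2 * vsol x + (vsol x)\<^sup>2 + G)"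
    using pde by (simp add: F_def algebra_simps)
  also have "(n - 1) * (- n * F\<^sup>2 + n * (2 * vsol x + (vsol x)\<^sup>2 + G) - n * G) = - n * (n - 1)"
    by (simp add: F_def power2_eq_square algebra_simps)
  finally show ?thesis by (simp add: n_def)
qed

end

end

section \<open>The ball model\<close>

text \<open>Testing the pulled back form on pairs of vectors replaces matrix algebra with the
  Jacobian by identities between inner products.\<close>

lemma pullback_eqI:
  fixes M :: "real^'n^'n"
  assumes d: "(\<phi> has_derivative D) (at x)"
    and e: "\<And>u h. D u \<bullet> (g (\<phi> x) *v D h) = u \<bullet> (M *v h)"
  shows "pullback \<phi> g x = M"
proof -
  have lin: "linear D" using d by (rule has_derivative_linear)
  have J: "jacobian \<phi> (at x) *v h = D h" for h
    unfolding jacobian_def frechet_derivative_at[OF d, symmetric] using fun_cong[OF matrix_vector_mul(2)[OF lin], of h] by simp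
  have "u \<bullet> (pullback \<phi> g x *v h) = u \<bullet> (M *v h)" for u h
  proof -
    have "u \<bullet> (pullback \<phi> g x *v h) = u \<bullet> (transpose (jacobian \<phi> (at x)) *v (g (\<phi> x) *v D h))"
      by (simp add: pullback_def J flip: matrix_vector_mul_assoc)
    also have "\<dots> = ((g (\<phi> x) *v D h) v* jacobian \<phi> (at x)) \<bullet> u"
      by (simp add: transpose_matrix_vector inner_commute)
    also have "\<dots> = D u \<bullet> (g (\<phi> x) *v D h)"
      unfolding dot_lmul_matrix J by (rule inner_commute)
    finally show ?thesis using e by simp
  qed
  then have "pullback \<phi> g x *v h = M *v h" for h
    by (metis vector_eq_rdot inner_commute)
  then show ?thesis by (simp add: matrix_eq)
qed

text \<open>Stereographic projection between the Poincare ball and the hyperboloid, the latter being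
  parametrised by its spatial coordinates x. In these coordinates the induced metric is
  \<open>hyp_metric\<close>.\<close>

definition ball_map :: "real^'n \<Rightarrow> real^'n"
  where "ball_map z = (2 / (1 - z \<bullet> z)) *\<^sub>R z"

definition ball_inv :: "real^'n \<Rightarrow> real^'n"
  where "ball_inv x = (1 / (1 + sqrt (1 + x \<bullet> x))) *\<^sub>R x"

lemma norm_less_1_iff: "norm z < 1 \<longleftrightarrow> z \<bullet> z < (1::real)" for z :: "real^'n"
  by (simp add: norm_eq_sqrt_inner)

lemma ball_map_sq:
  assumes "z \<bullet> z < 1" shows "1 + ball_map z \<bullet> ball_map z = ((1 + z \<bullet> z) / (1 - z \<bullet> z))\<^sup>2"
proof -
  have "1 - z \<bullet> z \<noteq> 0" using assms by simp
  then show ?thesis by (simp add: ball_map_def power2_eq_square divide_simps) (simp add: algebra_simps)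
qed

lemma ball_map_sqrt:
  assumes "z \<bullet> z < 1" shows "sqrt (1 + ball_map z \<bullet> ball_map z) = (1 + z \<bullet> z) / (1 - z \<bullet> z)"
  unfolding ball_map_sq[OF assms] using assms by (intro real_sqrt_unique) auto

lemma ball_inv_map: assumes "z \<bullet> z < 1" shows "ball_inv (ball_map z) = z"
proof -
  have "1 + (1 + z \<bullet> z) / (1 - z \<bullet> z) = 2 / (1 - z \<bullet> z)" using assms by (simp add: field_simps)
  then have "ball_inv (ball_map z) = ((1 - z \<bullet> z) / 2 * (2 / (1 - z \<bullet> z))) *\<^sub>R z"
    unfolding ball_inv_def ball_map_sqrt[OF assms] by (simp add: ball_map_def)
  also have "(1 - z \<bullet> z) / 2 * (2 / (1 - z \<bullet> z)) = 1" using assms by (simp add: divide_simps)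
  finally show ?thesis by simp
qed

lemma ball_inv_sq: "ball_inv x \<bullet> ball_inv x = (sqrt (1 + x \<bullet> x) - 1) / (sqrt (1 + x \<bullet> x) + 1)"
proof -
  define v where "v = sqrt (1 + x \<bullet> x)"
  have v: "1 \<le> v" "x \<bullet> x = v\<^sup>2 - 1" by (simp_all add: v_def)
  then show ?thesis
    unfolding ball_inv_def v_def[symmetric] by (simp add: v(2) power2_eq_square divide_simps) (simp add: algebra_simps)
qed

lemma ball_inv_less: "ball_inv x \<bullet> ball_inv x < 1"
proof -
  have "1 \<le> sqrt (1 + x \<bullet> x)" by simp
  then have "0 < sqrt (1 + x \<bullet> x) + 1" by linarith
  then show ?thesis unfolding ball_inv_sq by (simp add: divide_less_eq_1_pos)
qed

lemma ball_map_inv: "ball_map (ball_inv x) = x"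
proof -
  define v where "v = sqrt (1 + x \<bullet> x)"
  have v: "1 \<le> v" by (simp add: v_def)
  have "1 - (v - 1) / (v + 1) = 2 / (1 + v)" using v by (simp add: field_simps)
  then show ?thesis
    using v by (simp add: ball_map_def ball_inv_sq flip: v_def) (simp add: ball_inv_def flip: v_def)
qed

lemma one_minus_inner_has_derivative:
  "((\<lambda>z :: real^'n. 1 - z \<bullet> z) has_derivative (\<lambda>h. - 2 * (z \<bullet> h))) (at z)"
  by (auto intro!: derivative_eq_intros simp: inner_commute)

lemma ball_map_has_derivative:
  fixes z :: "real^'n"
  assumes "z \<bullet> z < 1"
  shows "(ball_map has_derivative (\<lambda>h. (2 / (1 - z \<bullet> z)) *\<^sub>R h + (4 * (z \<bullet> h) / (1 - z \<bullet> z)\<^sup>2) *\<^sub>R z)) (at z)"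
proof -
  have n: "1 - z \<bullet> z \<noteq> 0" using assms by simp
  have "((\<lambda>z. 2 * inverse (1 - z \<bullet> z)) has_derivative
      (\<lambda>h. 2 * - (inverse (1 - z \<bullet> z) * (- 2 * (z \<bullet> h)) * inverse (1 - z \<bullet> z)))) (at z)"
    by (intro has_derivative_mult_right Deriv.has_derivative_inverse[OF n one_minus_inner_has_derivative])
  from has_derivative_scaleR[OF this has_derivative_ident]
  show ?thesis
    unfolding ball_map_def[abs_def]
    by (rule has_derivative_eq_rhs[THEN has_derivative_transform_within[where d = 1 and f = "\<lambda>z. (2 * inverse (1 - z \<bullet> z)) *\<^sub>R z"]])
      (auto simp: fun_eq_iff divide_inverse power2_eq_square inverse_mult_distrib mult_ac)
qed

lemma pullback_ball_map:
  fixes z :: "real^'n"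
  assumes "z \<bullet> z < 1"
  shows "pullback ball_map hyp_metric z = (4 / (1 - z \<bullet> z)\<^sup>2) *\<^sub>R mat 1"
proof (rule pullback_eqI[OF ball_map_has_derivative[OF assms]])
  fix u h :: "real^'n"
  define m a b where "m = z \<bullet> z" and "a = z \<bullet> u" and "b = z \<bullet> h"
  \<comment> \<open>Here \<open>k\<close> is the conformal scale and \<open>q\<close> the value of
    sqrt(1 + |x|^2) at x = \<open>ball_map z\<close>. The relations 1 + k m = q and 1 + q = k reduce
    the isometry to polynomial algebra.\<close>
  define k q where "k = 2 / (1 - m)" and "q = (1 + m) / (1 - m)"
  have m: "m < 1" "0 \<le> m" using assms by (simp_all add: m_def)
  have q: "0 < q" "1 + k * m = q" "1 + q = k" using m by (simp_all add: k_def q_def divide_simps)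
  have n: "1 + (norm (ball_map z))\<^sup>2 = q\<^sup>2"
    using ball_map_sq[OF assms] by (simp add: power2_norm_eq_inner m_def q_def)
  let ?D = "\<lambda>h. (2 / (1 - z \<bullet> z)) *\<^sub>R h + (4 * (z \<bullet> h) / (1 - z \<bullet> z)\<^sup>2) *\<^sub>R z"
  have D: "?D h = k *\<^sub>R h + (k\<^sup>2 * (z \<bullet> h)) *\<^sub>R z" for h
    by (simp add: k_def power_divide flip: m_def)
  have zD: "ball_map z \<bullet> ?D h = k\<^sup>2 * q * (z \<bullet> h)" for h
  proof -
    have bm: "ball_map z = k *\<^sub>R z" by (simp add: ball_map_def k_def m_def)
    have "ball_map z \<bullet> ?D h = k\<^sup>2 * (1 + k * m) * (z \<bullet> h)"
      unfolding bm D inner_add_right inner_scaleR_left inner_scaleR_right m_def by algebra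
    then show ?thesis unfolding q(2) .
  qed
  have "?D u \<bullet> ?D h = k\<^sup>2 * (u \<bullet> h) + a * b * k ^ 3 * (1 + (1 + k * m))"
    unfolding D m_def a_def b_def inner_add_left inner_add_right inner_scaleR_left inner_scaleR_right inner_commute[of u z]
    by algebra
  then have DD: "?D u \<bullet> ?D h = k\<^sup>2 * (u \<bullet> h) + a * b * k ^ 4"
    unfolding q by (simp add: power3_eq_cube power4_eq_xxxx)
  have "?D u \<bullet> (hyp_metric (ball_map z) *v ?D h) = ?D u \<bullet> ?D h
      - (ball_map z \<bullet> ?D h) * (ball_map z \<bullet> ?D u) / q\<^sup>2"
    unfolding hyp_metric_mult inner_diff_right n by (simp add: inner_commute)
  also have "\<dots> = k\<^sup>2 * (u \<bullet> h)"
    unfolding zD DD unfolding a_def[symmetric] b_def[symmetric] using q(1)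
    by (simp add: power2_eq_square power4_eq_xxxx)
  also have "\<dots> = u \<bullet> (((4 / (1 - z \<bullet> z)\<^sup>2) *\<^sub>R mat 1) *v h)"
    by (simp add: k_def m_def power_divide flip: scaleR_matrix_vector_assoc)
  finally show "?D u \<bullet> (hyp_metric (ball_map z) *v ?D h) = u \<bullet> (((4 / (1 - z \<bullet> z)\<^sup>2) *\<^sub>R mat 1) *v h)" .
qed

lemma sqrt_one_plus_has_derivative:
  "((\<lambda>x :: real^'n. sqrt (1 + x \<bullet> x)) has_derivative (\<lambda>h. (x \<bullet> h) / sqrt (1 + x \<bullet> x))) (at x)"
proof -
  have i: "((\<lambda>x. 1 + x \<bullet> x) has_derivative (\<lambda>h. 2 * (x \<bullet> h))) (at x)"
    by (auto intro!: derivative_eq_intros simp: inner_commute)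
  have "((\<lambda>x. sqrt (1 + x \<bullet> x)) has_derivative (\<lambda>h. 2 * (x \<bullet> h) * (inverse (sqrt (1 + x \<bullet> x)) / 2))) (at x)"
    by (rule has_derivative_real_sqrt) (rule one_plus_inner_pos, rule i)
  moreover have "2 * (x \<bullet> h) * (inverse (sqrt (1 + x \<bullet> x)) / 2) = (x \<bullet> h) / sqrt (1 + x \<bullet> x)" for h
    by (simp only: divide_inverse) simp
  ultimately show ?thesis by (simp only:)
qed

lemma ball_inv_has_derivative:
  fixes x :: "real^'n"
  defines "v \<equiv> sqrt (1 + x \<bullet> x)"
  shows "(ball_inv has_derivative (\<lambda>h. (1 / (1 + v)) *\<^sub>R h - ((x \<bullet> h) / (v * (1 + v)\<^sup>2)) *\<^sub>R x)) (at x)"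
proof -
  have n: "1 + sqrt (1 + x \<bullet> x) \<noteq> 0" by (smt (verit) real_sqrt_ge_zero one_plus_inner_pos)
  have "((\<lambda>x. inverse (1 + sqrt (1 + x \<bullet> x))) has_derivative
      (\<lambda>h. - (inverse (1 + v) * (0 + (x \<bullet> h) / v) * inverse (1 + v)))) (at x)"
    unfolding v_def
    by (rule Deriv.has_derivative_inverse, rule n, intro has_derivative_add has_derivative_const sqrt_one_plus_has_derivative)
  from has_derivative_scaleR[OF this has_derivative_ident]
  show ?thesis
    unfolding ball_inv_def[abs_def]
    by (rule has_derivative_eq_rhs[THEN has_derivative_transform_within[where d = 1
          and f = "\<lambda>x. inverse (1 + sqrt (1 + x \<bullet> x)) *\<^sub>R x"]])
      (auto simp: fun_eq_iff divide_inverse power2_eq_square inverse_mult_distrib v_def mult_ac)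
qed

lemma pullback_ball_inv:
  fixes x :: "real^'n"
  shows "pullback ball_inv (\<lambda>_. mat 1) x = (1 / (1 + sqrt (1 + x \<bullet> x))\<^sup>2) *\<^sub>R hyp_metric x"
proof (rule pullback_eqI[OF ball_inv_has_derivative])
  fix u h :: "real^'n"
  define v a b where "v = sqrt (1 + x \<bullet> x)" and "a = x \<bullet> u" and "b = x \<bullet> h"
  have v: "1 \<le> v" "x \<bullet> x = v\<^sup>2 - 1" "(norm x)\<^sup>2 = v\<^sup>2 - 1" by (simp_all add: v_def power2_norm_eq_inner)
  have nz: "v \<noteq> 0" "1 + v \<noteq> 0" using v by linarith+
  define k e where "k = 1 / (1 + v)" and "e = 1 / (v * (1 + v)\<^sup>2)"
  \<comment> \<open>The coefficient of (x \<bullet> u)(x \<bullet> h) in the pulled back Euclidean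
    form; it has to match the radial part -1/v^2 of the hyperbolic metric up to the conformal factor
    k^2. The identity comes from v^2 - 1 = (v - 1)(v + 1).\<close>
  have ke: "e\<^sup>2 * (v\<^sup>2 - 1) - 2 * k * e = - k\<^sup>2 / v\<^sup>2"
    using nz by (simp add: k_def e_def power2_eq_square divide_simps) algebra
  have "((1 / (1 + v)) *\<^sub>R u - ((x \<bullet> u) / (v * (1 + v)\<^sup>2)) *\<^sub>R x) \<bullet> ((1 / (1 + v)) *\<^sub>R h - ((x \<bullet> h) / (v * (1 + v)\<^sup>2)) *\<^sub>R x)
     = (k *\<^sub>R u - (a * e) *\<^sub>R x) \<bullet> (k *\<^sub>R h - (b * e) *\<^sub>R x)"
    by (simp add: k_def e_def a_def b_def)
  also have "\<dots> = k\<^sup>2 * (u \<bullet> h) + a * b * (e\<^sup>2 * (x \<bullet> x) - 2 * k * e)"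
    unfolding inner_diff_left inner_diff_right inner_scaleR_left inner_scaleR_right inner_commute[of u x]
      a_def[symmetric] b_def[symmetric] by algebra
  also have "\<dots> = (1 / (1 + v)\<^sup>2) * (u \<bullet> h - a * b / v\<^sup>2)"
    unfolding v(2) ke by (simp add: k_def power_divide algebra_simps)
  also have "\<dots> = u \<bullet> (((1 / (1 + v)\<^sup>2) *\<^sub>R hyp_metric x) *v h)"
    by (simp add: hyp_metric_mult inner_diff_right v(3) inner_commute[of u x] a_def b_def mult_ac flip: scaleR_matrix_vector_assoc)
  finally show "((1 / (1 + sqrt (1 + x \<bullet> x))) *\<^sub>R u - ((x \<bullet> u) / (sqrt (1 + x \<bullet> x) * (1 + sqrt (1 + x \<bullet> x))\<^sup>2)) *\<^sub>R x) \<bullet>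
     (mat 1 *v ((1 / (1 + sqrt (1 + x \<bullet> x))) *\<^sub>R h - ((x \<bullet> h) / (sqrt (1 + x \<bullet> x) * (1 + sqrt (1 + x \<bullet> x))\<^sup>2)) *\<^sub>R x)) =
     u \<bullet> (((1 / (1 + sqrt (1 + x \<bullet> x))\<^sup>2) *\<^sub>R hyp_metric x) *v h)"
    by (simp add: v_def)
qed

lemma Ck_on_ball_map: "Ck_on k (ball 0 1) ball_map"
  unfolding ball_map_def[abs_def]
  by (intro Ck_on_scaleR Ck_on_divide Ck_on_diff Ck_on_inner Ck_on_const Ck_on_id open_ball)
    (simp add: norm_less_1_iff)

lemma Ck_on_ball_inv: "Ck_on k UNIV ball_inv"
proof -
  have "1 + sqrt (1 + x \<bullet> x) \<noteq> 0" "0 < 1 + x \<bullet> x" for x :: "real^'n"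
    by (smt (verit) real_sqrt_ge_zero one_plus_inner_pos)+
  then show ?thesis
    unfolding ball_inv_def[abs_def]
    by (intro Ck_on_scaleR Ck_on_divide Ck_on_add Ck_on_sqrt Ck_on_inner Ck_on_const Ck_on_id open_UNIV) auto
qed

lemma Ck_on_imp_smooth_on: "open U \<Longrightarrow> S \<subseteq> U \<Longrightarrow> (\<And>k. Ck_on k U f) \<Longrightarrow> smooth_on S f"
  unfolding smooth_on_def by blast

text \<open>Both directions are used: the map out of the ball for the compactification, its inverse
  as the conformally flat chart.\<close>

lemma ball_homeomorphism:
  assumes "S \<subseteq> ball 0 1" "ball_inv ` T \<subseteq> S" "ball_map ` S \<subseteq> T"
  shows "diffeomorphism S T ball_map ball_inv" "diffeomorphism T S ball_inv ball_map"
proof -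
  have S: "z \<bullet> z < 1" if "z \<in> S" for z using assms(1) that by (auto simp: norm_less_1_iff)
  have c: "continuous_on S ball_map" "continuous_on T ball_inv"
    using continuous_on_subset[OF Ck_on_ball_map[of 0, unfolded Ck_on.simps] assms(1)]
      continuous_on_subset[OF Ck_on_ball_inv[of 0, unfolded Ck_on.simps] subset_UNIV] by auto
  have h: "homeomorphism S T ball_map ball_inv"
    by (rule homeomorphismI) (use c assms S in \<open>auto simp: ball_inv_map ball_map_inv\<close>)
  have sm: "smooth_on S ball_map" "smooth_on T ball_inv"
    by (rule Ck_on_imp_smooth_on[OF open_ball assms(1) Ck_on_ball_map]
      Ck_on_imp_smooth_on[OF open_UNIV subset_UNIV Ck_on_ball_inv])+
  show "diffeomorphism S T ball_map ball_inv" "diffeomorphism T S ball_inv ball_map"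
    using h sm by (auto simp: diffeomorphism_def homeomorphism_symD)
qed

section \<open>The geometry of the solution\<close>

lemma Ck_on_nth: "open U \<Longrightarrow> Ck_on k U (\<lambda>x :: real^'n. x $ i)"
  by (rule Ck_on_bounded_linear[OF _ bounded_linear_vec_nth Ck_on_id])

lemma Ck_on_hyp_metric: "Ck_on k UNIV (hyp_metric :: real^'n \<Rightarrow> real^'n^'n)"
proof (rule Ck_on_vec[OF open_UNIV], rule Ck_on_vec[OF open_UNIV])
  fix i j :: "'n"
  have "1 + x \<bullet> x \<noteq> 0" for x :: "real^'n" using one_plus_inner_pos[of x] by linarith
  then show "Ck_on k UNIV (\<lambda>x. hyp_metric x $ i $ j)"
    unfolding hyp_metric_nth hyp_rho_def
    by (intro Ck_on_diff Ck_on_mult Ck_on_divide Ck_on_add Ck_on_inner Ck_on_const Ck_on_id Ck_on_nth open_UNIV)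
qed

lemma hyp_metric_transpose: "transpose (hyp_metric x) = hyp_metric x"
  by (simp add: transpose_def vec_eq_iff hyp_metric_sym)

lemma hyp_metric_pos:
  fixes v :: "real^'n"
  assumes "v \<noteq> 0" shows "0 < v \<bullet> (hyp_metric x *v v)"
proof -
  have "(x \<bullet> v)\<^sup>2 \<le> (x \<bullet> x) * (v \<bullet> v)" by (rule Cauchy_Schwarz_ineq)
  also have "\<dots> < (1 + x \<bullet> x) * (v \<bullet> v)" using assms by (intro mult_strict_right_mono) auto
  finally have "(x \<bullet> v)\<^sup>2 / (1 + x \<bullet> x) < v \<bullet> v"
    using one_plus_inner_pos[of x] by (simp add: pos_divide_less_eq mult.commute)
  then show ?thesis
    by (simp add: hyp_metric_mult inner_diff_right power2_norm_eq_inner inner_commute[of v x])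
      (simp add: power2_eq_square)
qed

lemma sfun_ball_map:
  assumes "z \<bullet> z < 1" shows "sfun (ball_map z) = (1 - z \<bullet> z) / (1 + z \<bullet> z)"
  unfolding sfun_def ball_map_sqrt[OF assms] by simp

lemma tfun_ball_map:
  assumes "z \<bullet> z < 1" shows "tfun w (ball_map z) = 2 * (w \<bullet> z) / (1 + z \<bullet> z)"
proof -
  have "w \<bullet> ball_map z = 2 * (w \<bullet> z) / (1 - z \<bullet> z)" by (simp add: ball_map_def)
  then show ?thesis using assms unfolding tfun_def sfun_ball_map[OF assms] by (simp add: divide_simps mult.commute)
qed

text \<open>From 2|z| \<le> 1 + |z|^2. There is no restriction to the unit ball: smooth extension
  across the unit sphere needs the bound on both sides of it.\<close>

lemma ball_t_le: "\<bar>2 * (w \<bullet> z) / (1 + z \<bullet> z)\<bar> \<le> norm w" for w z :: "real^'n"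
proof -
  have "2 * norm z \<le> 1 + z \<bullet> z"
    using sum_squares_bound[of 1 "norm z"] by (simp add: power2_norm_eq_inner)
  then have "2 * norm z / (1 + z \<bullet> z) \<le> 1" using one_plus_inner_pos[of z] by (simp add: divide_le_eq)
  have "\<bar>2 * (w \<bullet> z) / (1 + z \<bullet> z)\<bar> = 2 * \<bar>w \<bullet> z\<bar> / (1 + z \<bullet> z)"
    using one_plus_inner_pos[of z] by (simp add: abs_mult)
  also have "\<dots> \<le> 2 * (norm w * norm z) / (1 + z \<bullet> z)"
    using one_plus_inner_pos[of z] Cauchy_Schwarz_ineq2[of w z] by (intro divide_right_mono) auto
  also have "\<dots> = norm w * (2 * norm z / (1 + z \<bullet> z))" by simp
  also have "\<dots> \<le> norm w * 1" by (intro mult_left_mono) (fact, simp)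
  finally show ?thesis by simp
qed

context ah_end begin

lemma Ck_on_vsol: "Ck_on k far_region vsol"
  unfolding vsol_def[abs_def]
  by (rule Ck_on_pser[OF open_far_region Ck_on_subset[OF Ck_on_sfun] Ck_on_subset[OF Ck_on_tfun] sfun_A tfun_B(1) conv]) auto

lemma Ck_on_ah_metric: "Ck_on k far_region ah_metric"
proof -
  have "(1 + vsol x)\<^sup>2 \<noteq> 0" if "x \<in> far_region" for x using F_pos[OF that] by simp
  then show ?thesis
    unfolding ah_metric_def[abs_def] power2_eq_square
    by (intro Ck_on_scaleR Ck_on_divide Ck_on_mult Ck_on_add Ck_on_const Ck_on_vsol open_far_region
      Ck_on_subset[OF Ck_on_hyp_metric]) auto
qed

lemma ah_metric_metric: "S \<subseteq> far_region \<Longrightarrow> riemannian_metric_on S ah_metric"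
  unfolding riemannian_metric_on_def
proof (intro conjI ballI allI impI)
  assume S: "S \<subseteq> far_region"
  show "smooth_on S ah_metric" by (rule Ck_on_imp_smooth_on[OF open_far_region S Ck_on_ah_metric])
  fix x assume "x \<in> S"
  then have F: "0 < 1 / (1 + vsol x)\<^sup>2" using S F_pos[of x] by force
  show "transpose (ah_metric x) = ah_metric x"
    by (simp add: ah_metric_def transpose_scalar hyp_metric_transpose)
  show "0 < v \<bullet> (ah_metric x *v v)" if "v \<noteq> 0" for v
    using mult_pos_pos[OF F hyp_metric_pos[OF that, of x]]
    by (simp add: ah_metric_def flip: scaleR_matrix_vector_assoc)
qed

definition core_ball :: "(real^'n) set" where "core_ball = cball 0 (1 / A)"

lemma compl_core_ball: "- core_ball \<subseteq> far_region"
proof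
  fix x assume "x \<in> - core_ball"
  then have n: "1 / A < norm x" by (simp add: core_ball_def)
  moreover have "0 < 1 / A" using A_pos by simp
  ultimately have x: "0 < norm x" by linarith
  have "sfun x < 1 / norm x" using norm_sfun[of x] x by (simp add: pos_less_divide_eq mult.commute)
  also have "\<dots> < A" using n A_pos x by (simp add: field_simps)
  finally show "x \<in> far_region" by (simp add: far_region_def)
qed

lemma ah_metric_conformally_flat: "conformally_flat_on (- core_ball) ah_metric"
  unfolding conformally_flat_on_def
proof
  fix x assume x: "x \<in> - core_ball"
  \<comment> \<open>A single chart serves for all points: \<open>ball_inv\<close> is defined
    everywhere and conformal to the Euclidean metric.\<close>
  define W where "W = - core_ball"
  define W' where "W' = ball 0 1 \<inter> ball_map -` W"
  define f where "f y = (1 + sqrt (1 + y \<bullet> y))\<^sup>2 / (1 + vsol y)\<^sup>2" for y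
  have oW: "open W" by (simp add: W_def core_ball_def open_Compl)
  have "open W'"
    unfolding W'_def using Ck_on_ball_map[of 0, where 'a = 'n]
    by (intro continuous_open_preimage oW open_ball) (simp add: Ck_on.simps)
  moreover have "diffeomorphism W W' ball_inv ball_map"
  proof (rule ball_homeomorphism(2))
    show "W' \<subseteq> ball 0 1" "ball_map ` W' \<subseteq> W" by (auto simp: W'_def)
    show "ball_inv ` W \<subseteq> W'"
      using ball_inv_less by (auto simp: W'_def ball_map_inv norm_less_1_iff)
  qed
  moreover have pos: "0 < sqrt (1 + y \<bullet> y)" for y :: "real^'n" using one_plus_inner_pos[of y] by simp
  have nz: "(1 + vsol y)\<^sup>2 \<noteq> 0" if "y \<in> far_region" for y using F_pos[OF that] by simp
  have "smooth_on W f"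
  proof (rule Ck_on_imp_smooth_on[OF open_far_region])
    show "W \<subseteq> far_region" using compl_core_ball by (simp add: W_def)
    show "Ck_on k far_region f" for k
      unfolding f_def[abs_def] using nz unfolding power2_eq_square
      by (intro Ck_on_divide Ck_on_mult Ck_on_add Ck_on_const Ck_on_vsol Ck_on_sqrt Ck_on_inner Ck_on_id open_far_region
        one_plus_inner_pos)
  qed
  moreover have "0 < f y" if "y \<in> W" for y
  proof -
    have "0 < 1 + vsol y" using F_pos[of y] that compl_core_ball by (force simp: W_def)
    moreover have "0 < 1 + sqrt (1 + y \<bullet> y)" using pos[of y] by linarith
    ultimately show ?thesis unfolding f_def by (metis divide_pos_pos zero_less_power)
  qed
  moreover have "ah_metric y = f y *\<^sub>R pullback ball_inv (\<lambda>_. mat 1) y" for y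
  proof -
    have "1 + sqrt (1 + y \<bullet> y) \<noteq> 0" using pos[of y] by linarith
    then show ?thesis by (simp add: ah_metric_def f_def pullback_ball_inv)
  qed
  ultimately show "\<exists>W W' \<phi> \<phi>' f. open W \<and> x \<in> W \<and> W \<subseteq> - core_ball \<and> open W' \<and> diffeomorphism W W' \<phi> \<phi>' \<and>
      smooth_on W f \<and> (\<forall>y\<in>W. 0 < f y) \<and> (\<forall>y\<in>W. ah_metric y = f y *\<^sub>R pullback \<phi> (\<lambda>_. mat 1) y)"
    using oW x unfolding W_def by blast
qed

text \<open>In ball coordinates s and t become rational functions of z with denominator 1 + |z|^2,
  hence smooth on the whole space. Substituting them into the series extends F across the unit
  sphere, and the pole of the hyperbolic conformal factor is cancelled exactly by the square of
  \<open>rho\<close>.\<close>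

lemma ah_metric_asymptotically_hyperbolic: "asymptotically_hyperbolic_spherical core_ball ah_metric"
proof -
  \<comment> \<open>On c \<le> |z| \<le> 1 one has |s| \<le> 1 - |z|^2 \<le> A'/2 < A, so the closed
    annulus lies in the domain of convergence. The cap at 1 ensures c \<ge> 1/2, which is needed to
    keep the image away from the core.\<close>
  define A' where "A' = min A 1"
  have A': "0 < A'" "A' \<le> A" "A' \<le> 1" using A_pos by (auto simp: A'_def)
  define c where "c = sqrt (1 - A' / 2)"
  have c2: "c\<^sup>2 = 1 - A' / 2" using A' by (simp add: c_def)
  have c: "0 < c" "c < 1" using A' by (auto simp: c_def)
  have c12: "1/2 \<le> c" using c2 A' c by (intro power2_le_imp_le[of "1/2" c]) (auto simp: power2_eq_square)
  define sb where "sb z = (1 - z \<bullet> z) / (1 + z \<bullet> z)" for z :: "real^'n"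
  define tb where "tb z = 2 * (w \<bullet> z) / (1 + z \<bullet> z)" for z
  \<comment> \<open>The condition is on |s|, so \<open>U\<close> contains points just outside the
    unit ball, where s is negative; it is the open neighbourhood that \<open>smooth_on\<close> asks
    for.\<close>
  define U where "U = {z. \<bar>sb z\<bar> < A}"
  define vb where "vb z = pser p (sb z) (tb z)" for z
  define rho where "rho z = (1 - z \<bullet> z) / 2" for z :: "real^'n"
  define gbar where "gbar z = (1 / (1 + vb z)\<^sup>2) *\<^sub>R (mat 1 :: real^'n^'n)" for z
  let ?S = "{y :: real^'n. c \<le> norm y \<and> norm y \<le> 1}"
  have ne: "1 + z \<bullet> z \<noteq> 0" for z :: "real^'n" using one_plus_inner_pos[of z] by linarith
  have sbC: "Ck_on k UNIV sb" and tbC: "Ck_on k UNIV tb" for k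
    unfolding sb_def[abs_def] tb_def[abs_def]
    by (intro Ck_on_divide Ck_on_diff Ck_on_add Ck_on_mult Ck_on_inner Ck_on_const Ck_on_id open_UNIV ne)+
  have oU: "open U"
    unfolding U_def using sbC[of 0]
    by (intro open_Collect_less continuous_on_const continuous_on_rabs) (simp add: Ck_on.simps)
  have tbB: "\<bar>tb z\<bar> < B" "\<bar>tb z\<bar> \<le> B" for z
    using ball_t_le[of w z] unfolding tb_def by linarith+
  have vbC: "Ck_on k U vb" for k
    unfolding vb_def[abs_def]
    by (rule Ck_on_pser[OF oU Ck_on_subset[OF sbC] Ck_on_subset[OF tbC] _ tbB(1) conv]) (auto simp: U_def)
  have vbF: "1/2 \<le> 1 + vb z" if "z \<in> U" for z
    using half[of "sb z" "tb z"] that tbB[of z] unfolding vb_def U_def by simp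
  have SU: "?S \<subseteq> U"
  proof
    fix z :: "real^'n" assume z: "z \<in> ?S"
    have "c\<^sup>2 \<le> (norm z)\<^sup>2" "(norm z)\<^sup>2 \<le> 1" using z c by (auto intro: power_mono power_le_one)
    then have m: "1 - z \<bullet> z \<le> A' / 2" "0 \<le> 1 - z \<bullet> z" using c2 by (simp_all add: power2_norm_eq_inner)
    have "\<bar>sb z\<bar> = (1 - z \<bullet> z) / (1 + z \<bullet> z)" using m one_plus_inner_pos[of z] by (simp add: sb_def)
    also have "\<dots> \<le> (1 - z \<bullet> z) / 1" using m one_plus_inner_pos[of z] by (intro divide_left_mono) auto
    also have "\<dots> < A" using m A' by simp
    finally show "z \<in> U" by (simp add: U_def)
  qed
  have vb: "vb z = vsol (ball_map z)" if "z \<bullet> z < 1" for z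
    by (simp add: vb_def vsol_def sb_def tb_def sfun_ball_map[OF that] tfun_ball_map[OF that])
  \<comment> \<open>The norm of \<open>ball_map z\<close> for |z| = c. It equals 4c/A', which is at
    least 2/A' and so exceeds the core radius 1/A.\<close>
  define R where "R = 2 * c / (1 - c\<^sup>2)"
  have R: "1 / A < R"
  proof -
    have "R = 4 * c / A'" using A' by (simp add: R_def c2)
    moreover have "2 / A' \<le> 4 * c / A'" using A' c12 by (intro divide_right_mono) auto
    moreover have "1 / A < 2 / A'" using A' A_pos by (simp add: field_simps)
    ultimately show ?thesis by linarith
  qed
  let ?T = "{x :: real^'n. R \<le> norm x}"
  have nb: "norm (ball_map z) = 2 * norm z / (1 - (norm z)\<^sup>2)" if "norm z < 1" for z :: "real^'n"
    using that by (simp add: ball_map_def norm_less_1_iff power2_norm_eq_inner)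
  have mono: "2 * a / (1 - a\<^sup>2) < 2 * b / (1 - b\<^sup>2)" if "0 \<le> a" "a < b" "b < 1" for a b :: real
  proof -
    have "a\<^sup>2 \<le> b\<^sup>2" "b\<^sup>2 < 1"
      using that power_mono[of a b 2] power_strict_mono[of b 1 2] by auto
    then have "a\<^sup>2 < 1" by linarith
    have "2 * a / (1 - a\<^sup>2) \<le> 2 * a / (1 - b\<^sup>2)"
      using that \<open>a\<^sup>2 \<le> b\<^sup>2\<close> \<open>b\<^sup>2 < 1\<close> \<open>a\<^sup>2 < 1\<close> by (intro divide_left_mono mult_pos_pos) auto
    also have "\<dots> < 2 * b / (1 - b\<^sup>2)"
      using that \<open>b\<^sup>2 < 1\<close> by (intro divide_strict_right_mono) auto
    finally show ?thesis .
  qed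
  have diff: "diffeomorphism {y. c \<le> norm y \<and> norm y < 1} ?T ball_map ball_inv"
  proof (rule ball_homeomorphism(1))
    show "{y. c \<le> norm y \<and> norm y < 1} \<subseteq> ball 0 1" by auto
    show "ball_map ` {y. c \<le> norm y \<and> norm y < 1} \<subseteq> ?T"
    proof clarify
      fix z :: "real^'n" assume z: "c \<le> norm z" "norm z < 1"
      then show "R \<le> norm (ball_map z)"
        using mono[of c "norm z"] c unfolding R_def nb[OF z(2)] by (cases "c = norm z") auto
    qed
    show "ball_inv ` ?T \<subseteq> {y. c \<le> norm y \<and> norm y < 1}"
    proof clarify
      fix x :: "real^'n" assume x: "R \<le> norm x"
      have l: "norm (ball_inv x) < 1" using ball_inv_less[of x] by (simp add: norm_less_1_iff)
      have "norm x = 2 * norm (ball_inv x) / (1 - (norm (ball_inv x))\<^sup>2)"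
        using nb[OF l] by (simp add: ball_map_inv)
      then show "c \<le> norm (ball_inv x) \<and> norm (ball_inv x) < 1"
        using l mono[of "norm (ball_inv x)" c] x c unfolding R_def by force
    qed
  qed
  have ext: "exterior_region core_ball ?T"
  proof -
    have "?T \<subseteq> - core_ball" using R by (auto simp: core_ball_def)
    moreover have "bounded (- ?T)"
      by (rule bounded_subset[OF bounded_ball[of 0 R]]) auto
    ultimately show ?thesis by (simp add: exterior_region_def)
  qed
  have rho_d: "(rho has_derivative (\<lambda>h. - (y \<bullet> h))) (at y)" for y
    unfolding rho_def[abs_def]
    by (rule has_derivative_eq_rhs[OF has_derivative_mult_left[OF one_minus_inner_has_derivative, of "1/2" y, simplified]]) auto
  have rho_p: "partial i rho y = - y $ i" for i y
    using partial_eqI[OF rho_d] by (simp add: inner_axis_1)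
  have rhoC: "Ck_on k UNIV rho" for k
    unfolding rho_def[abs_def] by (intro Ck_on_divide Ck_on_diff Ck_on_inner Ck_on_const Ck_on_id open_UNIV) simp
  have gbarC: "Ck_on k U gbar" for k
  proof -
    have "(1 + vb z)\<^sup>2 \<noteq> 0" if "z \<in> U" for z using vbF[OF that] by simp
    then show ?thesis
      unfolding gbar_def[abs_def] power2_eq_square
      by (intro Ck_on_scaleR Ck_on_divide Ck_on_mult Ck_on_add Ck_on_const vbC oU)
  qed
  have g_pos: "0 < 1 / (1 + vb z)\<^sup>2" if "z \<in> ?S" for z using vbF[of z] SU that by force
  \<comment> \<open>The unit sphere is s = 0, where only the coefficient of order 0 is left, and it
    is zero. Hence \<open>gbar\<close> is Euclidean there, and both conditions on the boundary at
    infinity become statements about the unit sphere.\<close>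
  have vb1: "vb y = 0" if "norm y = 1" for y
  proof -
    have "y \<bullet> y = 1" using that by (simp add: norm_eq_1)
    then have "sb y = 0" by (simp add: sb_def)
    then show ?thesis using dim by (simp add: vb_def pser_at_0 vcoef_less)
  qed
  have gbar1: "gbar y = mat 1" if "norm y = 1" for y using vb1[OF that] by (simp add: gbar_def)
  have pb: "gbar y = (rho y)\<^sup>2 *\<^sub>R pullback ball_map ah_metric y" if "norm y < 1" for y
  proof -
    have y: "y \<bullet> y < 1" using that by (simp add: norm_less_1_iff)
    have "pullback ball_map ah_metric y = (1 / (1 + vb y)\<^sup>2) *\<^sub>R pullback ball_map hyp_metric y"
      unfolding pullback_def ah_metric_def vb[OF y]
      by (simp add: matrix_scalar_ac scalar_matrix_assoc)
    then show ?thesis using y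
      by (simp add: pullback_ball_map[OF y] gbar_def rho_def power_divide)
  qed
  have compact: "conformal_compactification core_ball ah_metric c ball_map rho gbar"
    unfolding conformal_compactification_def
  proof (intro conjI allI impI)
    show "\<exists>M_ext \<psi>'. exterior_region core_ball M_ext \<and> diffeomorphism {y. c \<le> norm y \<and> norm y < 1} M_ext ball_map \<psi>'"
      using ext diff by blast
    show "smooth_on ?S rho" by (rule Ck_on_imp_smooth_on[OF open_UNIV subset_UNIV rhoC])
    show "0 \<le> rho y" if "c \<le> norm y \<and> norm y \<le> 1" for y
      using that by (simp add: rho_def norm_eq_sqrt_inner)
    show "(rho y = 0) = (norm y = 1)" for y by (simp add: rho_def norm_eq_1)
    show "\<exists>i. partial i rho y \<noteq> 0" if "norm y = 1" for y
    proof -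
      have "y \<noteq> 0" using that by auto
      then show ?thesis by (simp add: rho_p vec_eq_iff)
    qed
    show "riemannian_metric_on ?S gbar"
      unfolding riemannian_metric_on_def
    proof (intro conjI ballI allI impI)
      show "smooth_on ?S gbar" by (rule Ck_on_imp_smooth_on[OF oU SU gbarC])
      show "transpose (gbar x) = gbar x" for x by (simp add: gbar_def transpose_scalar transpose_mat)
      show "0 < v \<bullet> (gbar x *v v)" if "x \<in> ?S" "v \<noteq> 0" for x v
        using mult_pos_pos[OF g_pos[OF that(1)], of "v \<bullet> v"] that
        by (simp add: gbar_def flip: scaleR_matrix_vector_assoc)
    qed
    show "gbar y = (rho y)\<^sup>2 *\<^sub>R pullback ball_map ah_metric y" if "c \<le> norm y \<and> norm y < 1" for y
      using pb that by blast
  qed (use c in auto)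
  have inv1: "matrix_inv (mat 1 :: real^'n^'n) = mat 1" by (rule matrix_inv_eqI) simp
  show ?thesis
    unfolding asymptotically_hyperbolic_spherical_def
  proof (rule exI[of _ c], rule exI[of _ ball_map], rule exI[of _ rho], rule exI[of _ gbar], intro conjI allI impI)
    show "conformal_compactification core_ball ah_metric c ball_map rho gbar" by (rule compact)
    fix y :: "real^'n" assume y: "norm y = 1"
    have "(\<Sum>i\<in>UNIV. \<Sum>j\<in>UNIV. matrix_inv (gbar y) $ i $ j * partial i rho y * partial j rho y) = y \<bullet> y"
      unfolding gbar1[OF y] inv1 rho_p mat_1_nth by (simp add: mult.assoc sum_kron sum_nth_sq)
    then show "sqrt (\<Sum>i\<in>UNIV. \<Sum>j\<in>UNIV. matrix_inv (gbar y) $ i $ j * partial i rho y * partial j rho y) = 1"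
      using y by (simp add: norm_eq_1)
    show "\<exists>s>0. \<forall>v w. v \<bullet> y = 0 \<and> w \<bullet> y = 0 \<longrightarrow> v \<bullet> (gbar y *v w) = s * (v \<bullet> w)"
      by (rule exI[of _ 1]) (simp add: gbar1[OF y])
  qed
qed

end

section \<open>Decay and charges of conformal perturbations\<close>

text \<open>The hyperbolic metric is parallel, so only the scalar factor gets
  differentiated.\<close>

lemma cov_deriv_conformal:
  fixes x :: "real^'n"
  assumes U: "open U" "x \<in> U" and e: "\<And>y. y \<in> U \<Longrightarrow> e y = h y *\<^sub>R hyp_metric y"
    and h: "(h has_derivative (\<lambda>k. dh \<bullet> k)) (at x)"
  shows "cov_deriv hyp_metric e k i j x = dh $ k * hyp_metric x $ i $ j"
proof -
  let ?b = "\<lambda>i j. hyp_metric x $ i $ j"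
  have p: "partial k (\<lambda>y. e y $ i $ j) x = dh $ k * ?b i j + h x * partial k (\<lambda>y. hyp_metric y $ i $ j) x"
  proof -
    have "partial k (\<lambda>y. e y $ i $ j) x = partial k (\<lambda>y. h y * hyp_metric y $ i $ j) x"
      by (rule partial_cong_open[OF U]) (simp add: e)
    then show ?thesis
      by (subst (asm) partial_eqI[OF has_derivative_mult[OF h hyp_metric_has_derivative]])
        (simp add: axis_nth inner_axis_1 partial_hyp_metric algebra_simps)
  qed
  have c: "christoffel hyp_metric l a b x = - ?b a b * x $ l" for l a b
  proof -
    have "christoffel hyp_metric l a b x = conf_christoffel (\<lambda>_. 0) l a b x"
      by (rule christoffel_conformal[of UNIV x hyp_metric "\<lambda>_. 1"]) auto
    then show ?thesis by (simp add: conf_christoffel_def)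
  qed
  have bx: "(\<Sum>l\<in>UNIV. ?b a l * x $ l) = hyp_rho x * x $ a" for a
  proof -
    have "hyp_rho x = 1 - hyp_rho x * (x \<bullet> x)" using hyp_rho_mult[of x] by (simp add: distrib_left)
    then have "hyp_rho x * x $ a = (1 - hyp_rho x * (x \<bullet> x)) * x $ a" by simp
    then show ?thesis by (simp add: sum_hyp_metric_vec left_diff_distrib)
  qed
  have "(\<Sum>l\<in>UNIV. christoffel hyp_metric l k i x * e x $ l $ j + christoffel hyp_metric l k j x * e x $ i $ l)
     = (\<Sum>l\<in>UNIV. - h x * ?b k i * (?b j l * x $ l) - h x * ?b k j * (?b i l * x $ l))"
    by (rule sum.cong) (simp_all add: c e[OF U(2)] hyp_metric_sym[of x _ j])
  also have "\<dots> = - h x * hyp_rho x * (?b k i * x $ j + ?b k j * x $ i)"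
    unfolding sum_subtractf sum_distrib_left[symmetric] bx by (simp add: algebra_simps)
  finally show ?thesis
    unfolding cov_deriv_def p partial_hyp_metric
    by (simp add: hyp_metric_nth kron_sym[of k] power2_eq_square algebra_simps)
qed

lemma tensor_norm_conformal:
  fixes x :: "real^'n"
  assumes "e x = c *\<^sub>R hyp_metric x"
  shows "tensor_norm hyp_metric e x = sqrt (real CARD('n)) * \<bar>c\<bar>"
proof -
  have "(\<Sum>i\<in>UNIV. \<Sum>j\<in>UNIV. \<Sum>k\<in>UNIV. \<Sum>l\<in>UNIV. hyp_inv x $ i $ k * hyp_inv x $ j $ l * e x $ i $ j * e x $ k $ l)
    = (\<Sum>i\<in>UNIV. \<Sum>j\<in>UNIV. c\<^sup>2 * (hyp_metric x $ i $ j * (\<Sum>l\<in>UNIV. hyp_inv x $ j $ l * (\<Sum>k\<in>UNIV. hyp_inv x $ i $ k * hyp_metric x $ k $ l))))"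
    by (intro sum.cong refl, subst sum.swap) (simp add: assms sum_distrib_left power2_eq_square mult_ac)
  also have "\<dots> = c\<^sup>2 * (\<Sum>i\<in>UNIV. \<Sum>j\<in>UNIV. hyp_inv x $ j $ i * hyp_metric x $ i $ j)"
    unfolding hyp_inv_mult sum_kron by (simp add: sum_distrib_left mult_ac)
  also have "\<dots> = c\<^sup>2 * real CARD('n)"
    by (subst sum.swap) (simp add: hyp_inv_mult kron_self)
  finally show ?thesis
    unfolding tensor_norm_def matrix_inv_hyp by (simp add: real_sqrt_mult mult.commute)
qed

text \<open>For a tensor product dh b the contraction factorises into |dh|^2 times |b|^2, and |b|^2
  = n. The term (x \<bullet> dh)^2 is the rank one part of \<open>hyp_inv\<close>.\<close>

lemma cov_deriv_norm_conformal:
  fixes x :: "real^'n"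
  assumes c: "\<And>k i j. cov_deriv hyp_metric e k i j x = dh $ k * hyp_metric x $ i $ j"
  shows "cov_deriv_norm hyp_metric e x = sqrt (real CARD('n) * (dh \<bullet> dh + (x \<bullet> dh)\<^sup>2))"
proof -
  have "(\<Sum>i\<in>UNIV. \<Sum>j\<in>UNIV. \<Sum>k\<in>UNIV. \<Sum>i'\<in>UNIV. \<Sum>j'\<in>UNIV. \<Sum>k'\<in>UNIV.
      hyp_inv x $ k $ k' * hyp_inv x $ i $ i' * hyp_inv x $ j $ j' *
      cov_deriv hyp_metric e k i j x * cov_deriv hyp_metric e k' i' j' x)
    = (\<Sum>i\<in>UNIV. \<Sum>j\<in>UNIV. \<Sum>k\<in>UNIV. \<Sum>i'\<in>UNIV. hyp_inv x $ i $ i' * hyp_metric x $ i $ j * dh $ k *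
        ((\<Sum>j'\<in>UNIV. hyp_inv x $ j $ j' * hyp_metric x $ j' $ i') * (\<Sum>k'\<in>UNIV. hyp_inv x $ k $ k' * dh $ k')))"
    unfolding c sum_product
    by (intro sum.cong refl) (simp add: sum_distrib_left hyp_metric_sym[of x _ ] mult_ac)
  also have "\<dots> = (\<Sum>i\<in>UNIV. \<Sum>j\<in>UNIV. \<Sum>k\<in>UNIV. (dh $ k * dh $ k + (x \<bullet> dh) * (x $ k * dh $ k)) * (hyp_inv x $ i $ j * hyp_metric x $ i $ j))"
  proof (intro sum.cong refl)
    fix i j k
    have "(\<Sum>i'\<in>UNIV. hyp_inv x $ i $ i' * hyp_metric x $ i $ j * dh $ k * (kron j i' * (dh $ k + (x \<bullet> dh) * x $ k)))
      = (\<Sum>i'\<in>UNIV. kron j i' * (hyp_inv x $ i $ i' * hyp_metric x $ i $ j * dh $ k * (dh $ k + (x \<bullet> dh) * x $ k)))"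
      by (rule sum.cong) (simp_all add: mult_ac)
    then show "(\<Sum>i'\<in>UNIV. hyp_inv x $ i $ i' * hyp_metric x $ i $ j * dh $ k *
        ((\<Sum>j'\<in>UNIV. hyp_inv x $ j $ j' * hyp_metric x $ j' $ i') * (\<Sum>k'\<in>UNIV. hyp_inv x $ k $ k' * dh $ k')))
      = (dh $ k * dh $ k + (x \<bullet> dh) * (x $ k * dh $ k)) * (hyp_inv x $ i $ j * hyp_metric x $ i $ j)"
      unfolding hyp_inv_mult hyp_inv_vec sum_kron by (simp add: algebra_simps)
  qed
  also have "\<dots> = (\<Sum>i\<in>UNIV. \<Sum>j\<in>UNIV. (dh \<bullet> dh + (x \<bullet> dh)\<^sup>2) * (hyp_inv x $ i $ j * hyp_metric x $ i $ j))"
    unfolding sum_distrib_right[symmetric] sum.distrib sum_distrib_left[symmetric]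
    by (simp add: inner_vec_def power2_eq_square)
  also have "\<dots> = real CARD('n) * (dh \<bullet> dh + (x \<bullet> dh)\<^sup>2)"
    unfolding sum_distrib_left[symmetric] hyp_inv_contract_metric by (rule mult.commute)
  finally show ?thesis
    unfolding cov_deriv_norm_def matrix_inv_hyp by simp
qed

text \<open>For e = h b the divergence is dh and the trace n h, so the form is V(dh - n dh) - h dV +
  n h dV = (1 - n)(V dh - h dV).\<close>

lemma charge_form_conformal:
  fixes x :: "real^'n"
  assumes U: "open U" "x \<in> U" and e: "\<And>y. y \<in> U \<Longrightarrow> e y = h y *\<^sub>R hyp_metric y"
    and h: "(h has_derivative (\<lambda>k. dh \<bullet> k)) (at x)"
    and V: "(V has_derivative (\<lambda>k. dV \<bullet> k)) (at x)"
  shows "charge_form V e x X = (1 - real CARD('n)) * (V x * (dh \<bullet> X) - h x * (dV \<bullet> X))"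
proof -
  let ?n = "real CARD('n)"
  note cov = cov_deriv_conformal[OF U e h]
  have tr: "tensor_trace hyp_metric e y = ?n * h y" if "y \<in> U" for y
  proof -
    have "tensor_trace hyp_metric e y = h y * (\<Sum>i\<in>UNIV. \<Sum>j\<in>UNIV. hyp_inv y $ i $ j * hyp_metric y $ i $ j)"
      by (simp add: tensor_trace_def matrix_inv_hyp e[OF that] sum_distrib_left mult_ac)
    then show ?thesis by (simp add: hyp_inv_contract_metric)
  qed
  have ptr: "partial j (tensor_trace hyp_metric e) x = ?n * dh $ j" for j
    by (subst partial_cong_open[OF U tr], assumption)
      (simp add: partial_eqI[OF has_derivative_mult_right[OF h]] inner_axis_1)
  have pV: "partial j V x = dV $ j" for j by (simp add: partial_eqI[OF V] inner_axis_1)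
  have dv: "divergence hyp_metric e j x = dh $ j" for j
  proof -
    have "divergence hyp_metric e j x = (\<Sum>i\<in>UNIV. dh $ i * (\<Sum>k\<in>UNIV. hyp_inv x $ i $ k * hyp_metric x $ k $ j))"
      by (simp add: divergence_def matrix_inv_hyp cov sum_distrib_left mult_ac)
    then show ?thesis by (simp add: hyp_inv_mult sum_kron)
  qed
  have gr: "(\<Sum>i\<in>UNIV. gradient hyp_metric V x $ i * e x $ i $ j) = h x * dV $ j" for j
  proof -
    have "(\<Sum>i\<in>UNIV. gradient hyp_metric V x $ i * e x $ i $ j)
      = (\<Sum>i\<in>UNIV. \<Sum>k\<in>UNIV. h x * dV $ k * (hyp_inv x $ k $ i * hyp_metric x $ i $ j))"
      by (intro sum.cong refl)
        (simp add: gradient_def matrix_inv_hyp matrix_vector_mult_def pV e[OF U(2)] sum_distrib_right sum_distrib_left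
          hyp_inv_sym[of x _ _] mult_ac)
    also have "\<dots> = (\<Sum>k\<in>UNIV. h x * dV $ k * kron k j)"
      by (subst sum.swap) (simp add: hyp_inv_mult flip: sum_distrib_left)
    finally show ?thesis by (simp add: mult.assoc sum_kron flip: sum_distrib_left)
  qed
  have "charge_form V e x X = (\<Sum>j\<in>UNIV. (1 - ?n) * (V x * (dh $ j * X $ j) - h x * (dV $ j * X $ j)))"
    unfolding charge_form_def dv ptr gr pV tr[OF U(2)]
    by (intro sum.cong refl) (simp add: algebra_simps)
  then show ?thesis
    unfolding sum_distrib_left[symmetric] sum_subtractf by (simp add: inner_vec_def)
qed

section \<open>The energy-momentum vector of the solution\<close>

lemma pser_bounded:
  assumes q: "pser_conv A B q" and a: "0 \<le> a" "a < A"
  obtains C where "0 \<le> C" "\<And>s t. \<bar>s\<bar> \<le> a \<Longrightarrow> \<bar>t\<bar> \<le> B \<Longrightarrow> \<bar>pser q s t\<bar> \<le> C"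
proof
  have B: "0 \<le> B" using q by (simp add: pser_conv_def)
  have aA: "\<bar>a\<bar> < A" using a by simp
  have sm: "summable (\<lambda>k. pnorm B (q k) * a ^ k)" using pser_conv_abs[OF q aA] a by simp
  show "0 \<le> (\<Sum>k. pnorm B (q k) * a ^ k)" using sm B a by (intro suminf_nonneg) auto
  show "\<bar>pser q s t\<bar> \<le> (\<Sum>k. pnorm B (q k) * a ^ k)" if st: "\<bar>s\<bar> \<le> a" "\<bar>t\<bar> \<le> B" for s t
  proof -
    have sA: "\<bar>s\<bar> < A" using st a by linarith
    have "\<bar>pser q s t\<bar> \<le> (\<Sum>k. \<bar>poly (q k) t * s ^ k\<bar>)"
      unfolding pser_def by (rule summable_rabs[OF pser_abs_summable[OF q sA st(2)]])
    also have "\<dots> \<le> (\<Sum>k. pnorm B (q k) * a ^ k)"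
    proof (rule suminf_le[OF _ pser_abs_summable[OF q sA st(2)] sm])
      show "\<bar>poly (q k) t * s ^ k\<bar> \<le> pnorm B (q k) * a ^ k" for k
        unfolding abs_mult power_abs using B st a by (intro mult_mono abs_poly_le_pnorm power_mono) auto
    qed
    finally show ?thesis .
  qed
qed

lemma pser_continuous:
  assumes "pser_conv A B q"
  shows "continuous_on ({-A<..<A} \<times> {-B<..<B}) (\<lambda>z. pser q (fst z) (snd z))"
proof (rule continuous_at_imp_continuous_on, rule ballI)
  fix z assume "z \<in> {-A<..<A} \<times> {-B<..<B}"
  then have "\<bar>fst z\<bar> < A" "\<bar>snd z\<bar> < B" by auto
  from pser_has_derivative[OF assms this] show "isCont (\<lambda>z. pser q (fst z) (snd z)) z"
    by (simp add: has_derivative_continuous)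
qed

lemma sums_drop_zeros:
  fixes a :: "nat \<Rightarrow> real"
  assumes "\<And>k. k < n \<Longrightarrow> a k = 0" "(\<lambda>k. a (k + n)) sums x" shows "a sums x"
proof -
  have "(\<Sum>k<n. a k) = 0" by (rule sum.neutral) (simp add: assms)
  then show ?thesis using sums_iff_shift[of a n x] assms(2) by simp
qed

text \<open>
  On the sphere of radius \<open>r\<close> the static potential \<open>\<mu>\<close> is \<open>1 / s\<close> or \<open>r\<close> times \<open>harmonic1 \<mu>\<close>. The resulting
  discrepancy between the two kinds of charges is a power of \<open>s r\<close> (\<open>mode_exp\<close>) and a factor
  \<open>s\<^sup>2 r\<^sup>2 = 1 - s\<^sup>2\<close> (\<open>mode_par\<close>), see \<open>charge_formula\<close>; both tend to 1 at infinity.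
\<close>

definition harmonic1 :: "'n option \<Rightarrow> real^'n \<Rightarrow> real"
  where "harmonic1 \<mu> y = (case \<mu> of None \<Rightarrow> 1 | Some i \<Rightarrow> y $ i)"

definition mode_exp :: "'n::finite option \<Rightarrow> nat"
  where "mode_exp \<mu> = (case \<mu> of None \<Rightarrow> CARD('n) - 2 | Some i \<Rightarrow> CARD('n) - 1)"

definition mode_par :: "'n option \<Rightarrow> real"
  where "mode_par \<mu> = (case \<mu> of None \<Rightarrow> 1 | Some i \<Rightarrow> 0)"

context ah_end begin

text \<open>With s^n factored out, v = s^n \<open>G0\<close>, s v_s = s^n \<open>G1\<close> and v_t
  = s^n \<open>G2\<close>. The summand with n in \<open>G1\<close> comes from differentiating s^n
  itself. The three functions are continuous up to s = 0.\<close>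

definition "q = (\<lambda>k. p (k + CARD('n)))"
definition "G0 s t = pser q s t"
definition "G1 s t = CARD('n) * pser q s t + s * pser (pser_ds q) s t"
definition "G2 s t = pser (pser_dt q) s t"

lemma q_conv: "pser_conv A B q" unfolding q_def by (rule conv_shift)

lemma p_zero: "k < CARD('n) \<Longrightarrow> p k = 0" by (rule vcoef_less)

lemma factor:
  assumes "\<bar>s\<bar> < A" "\<bar>t\<bar> \<le> B"
  shows "pser p s t = s ^ CARD('n) * G0 s t" "s * pser (pser_ds p) s t = s ^ CARD('n) * G1 s t" "pser (pser_dt p) s t = s ^ CARD('n) * G2 s t"
proof -
  show "pser p s t = s ^ CARD('n) * G0 s t" using shift[OF assms] by (simp add: G0_def q_def)
  have "(\<lambda>k. s ^ CARD('n) * (CARD('n) * (poly (q k) t * s ^ k) + real k * poly (q k) t * s ^ k)) sums (s ^ CARD('n) * G1 s t)"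
    unfolding G1_def by (intro sums_mult sums_add pser_sums[OF q_conv assms] pser_theta_sums(1)[OF q_conv assms])
  then have "(\<lambda>k. real (k + CARD('n)) * poly (p (k + CARD('n))) t * s ^ (k + CARD('n))) sums (s ^ CARD('n) * G1 s t)"
    by (simp add: q_def power_add algebra_simps)
  then have "(\<lambda>k. real k * poly (p k) t * s ^ k) sums (s ^ CARD('n) * G1 s t)"
    by (rule sums_drop_zeros[rotated]) (simp add: p_zero)
  then show "s * pser (pser_ds p) s t = s ^ CARD('n) * G1 s t"
    using pser_theta_sums(1)[OF conv assms] sums_unique2 by blast
  have "(\<lambda>k. s ^ CARD('n) * (poly (pser_dt q k) t * s ^ k)) sums (s ^ CARD('n) * G2 s t)"
    unfolding G2_def by (intro sums_mult pser_sums[OF pser_conv_dt[OF q_conv] assms])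
  then have "(\<lambda>k. poly (pser_dt p (k + CARD('n))) t * s ^ (k + CARD('n))) sums (s ^ CARD('n) * G2 s t)"
    by (simp add: q_def pser_dt_def power_add mult_ac)
  then have "(\<lambda>k. poly (pser_dt p k) t * s ^ k) sums (s ^ CARD('n) * G2 s t)"
    by (rule sums_drop_zeros[rotated]) (simp add: pser_dt_def p_zero)
  then show "pser (pser_dt p) s t = s ^ CARD('n) * G2 s t"
    using pser_sums[OF pser_conv_dt[OF conv] assms] sums_unique2 by blast
qed

definition dfac :: "real^'n \<Rightarrow> real" where "dfac x = 1 / (1 + vsol x)\<^sup>2 - 1"
definition grad_dfac :: "real^'n \<Rightarrow> real^'n" where "grad_dfac x = (- 2 / (1 + vsol x) ^ 3) *\<^sub>R grad_v x"

text \<open>Pulling out the factor v makes the decay of order s^n visible.\<close>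

lemma dfac_eq:
  assumes "x \<in> far_region" shows "dfac x = - vsol x * (2 + vsol x) / (1 + vsol x)\<^sup>2"
proof -
  have "1 / f\<^sup>2 - 1 = - (f - 1) * (1 + f) / f\<^sup>2" if "f \<noteq> 0" for f :: real
    using that by (simp add: field_simps power2_eq_square)
  from this[of "1 + vsol x"] show ?thesis using F_pos[OF assms] by (simp add: dfac_def algebra_simps)
qed

lemma dfac_has_derivative: "x \<in> far_region \<Longrightarrow> (dfac has_derivative (\<lambda>h. grad_dfac x \<bullet> h)) (at x)"
  unfolding dfac_def[abs_def] grad_dfac_def
  by (rule has_derivative_eq_rhs[OF has_derivative_diff[OF conf_factor_has_derivative has_derivative_const]]) auto

abbreviation "dev \<equiv> metric_deviation (\<lambda>x. x) ah_metric"

lemma deviation: "dev x = dfac x *\<^sub>R hyp_metric x"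
proof -
  have "pullback (\<lambda>x. x) ah_metric x = ah_metric x" by (rule pullback_eqI[OF has_derivative_ident]) simp
  then show ?thesis by (simp add: metric_deviation_def ah_metric_def dfac_def scaleR_left_diff_distrib)
qed

lemma sfun_far:
  assumes "2 / A \<le> norm x" shows "x \<in> far_region" "\<bar>sfun x\<bar> \<le> A / 2" "sfun x * norm x \<le> 1" "0 < norm x"
proof -
  show x: "0 < norm x" using assms A_pos by (meson divide_pos_pos less_le_trans zero_less_numeral)
  show sn: "sfun x * norm x \<le> 1" using norm_sfun[of x] by (simp add: mult.commute)
  have "sfun x * (2 / A) \<le> sfun x * norm x" using assms sfun_pos[of x] by (intro mult_left_mono) auto
  then have "sfun x * (2 / A) \<le> 1" using sn by linarith
  then show s: "\<bar>sfun x\<bar> \<le> A / 2" using A_pos sfun_pos[of x] by (simp add: field_simps)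
  then show "x \<in> far_region" using A_pos by (simp add: far_region_def)
qed

text \<open>Both norms are O(s^n), and s \<le> 1/r. The rate n lies comfortably above the threshold
  n/2.\<close>

lemma ah_metric_decay: "asymptotic_decay (\<lambda>x. x) ah_metric (real CARD('n))"
proof -
  have A2: "0 \<le> A / 2" "A / 2 < A" using A_pos by auto
  \<comment> \<open>Restricting to |s| \<le> A/2, that is r \<ge> 2/A, keeps away from the edge of
    convergence and gives uniform bounds.\<close>
  obtain C0 where C0: "0 \<le> C0" "\<And>s t. \<bar>s\<bar> \<le> A / 2 \<Longrightarrow> \<bar>t\<bar> \<le> B \<Longrightarrow> \<bar>G0 s t\<bar> \<le> C0"
    using pser_bounded[OF q_conv A2] unfolding G0_def by blast
  obtain C1 where C1: "0 \<le> C1" "\<And>s t. \<bar>s\<bar> \<le> A / 2 \<Longrightarrow> \<bar>t\<bar> \<le> B \<Longrightarrow> \<bar>pser (pser_ds q) s t\<bar> \<le> C1"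
    using pser_bounded[OF pser_conv_ds[OF q_conv] A2] by blast
  obtain C2 where C2: "0 \<le> C2" "\<And>s t. \<bar>s\<bar> \<le> A / 2 \<Longrightarrow> \<bar>t\<bar> \<le> B \<Longrightarrow> \<bar>G2 s t\<bar> \<le> C2"
    using pser_bounded[OF pser_conv_dt[OF q_conv] A2] unfolding G2_def by blast
  define C1' where "C1' = real CARD('n) * C0 + A / 2 * C1"
  have C1'': "\<bar>G1 s t\<bar> \<le> C1'" if "\<bar>s\<bar> \<le> A / 2" "\<bar>t\<bar> \<le> B" for s t
  proof -
    have "\<bar>G1 s t\<bar> \<le> real CARD('n) * \<bar>pser q s t\<bar> + \<bar>s\<bar> * \<bar>pser (pser_ds q) s t\<bar>"
      unfolding G1_def by (rule order.trans[OF abs_triangle_ineq]) (simp add: abs_mult)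
    also have "\<dots> \<le> C1'"
      unfolding C1'_def using that C0 C1 A2 by (intro add_mono mult_mono) (auto simp: G0_def)
    finally show ?thesis .
  qed
  define M where "M = C1'\<^sup>2 + (A / 2)\<^sup>2 * ((w \<bullet> w) * C2\<^sup>2)"
  define K where "K = sqrt (real CARD('n)) * (10 * C0) + sqrt (real CARD('n) * (256 * M))"
  have bound: "tensor_norm hyp_metric (dev) x
       + cov_deriv_norm hyp_metric (dev) x \<le> K * norm x powr (- real CARD('n))"
    if x: "2 / A \<le> norm x" for x
  proof -
    note far = sfun_far[OF x]
    define s t where "s = sfun x" and "t = tfun w x"
    have s: "\<bar>s\<bar> \<le> A / 2" "\<bar>s\<bar> < A" "0 < s" using far sfun_pos[of x] A2 by (auto simp: s_def)
    have t: "\<bar>t\<bar> \<le> B" unfolding t_def by (rule tfun_B)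
    note fac = factor[OF s(2) t]
    have F: "1/2 \<le> 1 + vsol x" "\<bar>vsol x\<bar> \<le> 1/2" using F_pos[OF far(1)] vsol_bound[OF far(1)] by auto
    have v: "\<bar>vsol x\<bar> \<le> s ^ CARD('n) * C0"
      unfolding vsol_def s_def[symmetric] t_def[symmetric] fac(1) using s C0(2)[OF s(1) t]
      by (simp add: abs_mult mult_left_mono)
    have F2: "1/4 \<le> (1 + vsol x)\<^sup>2" using power_mono[OF F(1), of 2] by (simp add: power2_eq_square)
    have "dfac x = - vsol x * (2 + vsol x) / (1 + vsol x)\<^sup>2" by (rule dfac_eq[OF far(1)])
    then have "\<bar>dfac x\<bar> = \<bar>vsol x\<bar> * \<bar>2 + vsol x\<bar> / (1 + vsol x)\<^sup>2" by (simp add: abs_mult)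
    \<comment> \<open>From |v| \<le> 1/2 and F^2 \<ge> 1/4: this yields the factor 10 in
      \<open>K\<close>.\<close>
    also have "\<dots> \<le> \<bar>vsol x\<bar> * (5/2) / (1/4)"
      using F F2 by (intro frac_le mult_left_mono) auto
    also have "\<dots> \<le> 10 * C0 * s ^ CARD('n)" using v by (simp add: mult.commute)
    finally have h: "\<bar>dfac x\<bar> \<le> 10 * C0 * s ^ CARD('n)" .
    have "grad_v x \<bullet> grad_v x + (x \<bullet> grad_v x)\<^sup>2 \<le> (s ^ CARD('n) * G1 s t)\<^sup>2 + s\<^sup>2 * ((w \<bullet> w) * (s ^ CARD('n) * G2 s t)\<^sup>2)"
      using grad_le[OF far(1)] unfolding s_def[symmetric] t_def[symmetric] fac .
    also have "\<dots> = (s ^ CARD('n))\<^sup>2 * ((G1 s t)\<^sup>2 + s\<^sup>2 * ((w \<bullet> w) * (G2 s t)\<^sup>2))"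
      by (simp add: power_mult_distrib algebra_simps)
    also have "\<dots> \<le> (s ^ CARD('n))\<^sup>2 * M"
      unfolding M_def using C1''[OF s(1) t] C2(2)[OF s(1) t] s
      by (intro mult_left_mono add_mono mult_mono power2_mono) (auto simp: abs_le_square_iff[symmetric])
    finally have gr: "grad_v x \<bullet> grad_v x + (x \<bullet> grad_v x)\<^sup>2 \<le> (s ^ CARD('n))\<^sup>2 * M" .
    \<comment> \<open>Since F \<ge> 1/2, the factor 2/F^3 is at most 16, whose square is the 256 in
      \<open>K\<close>.\<close>
    have "1/8 \<le> (1 + vsol x) ^ 3" using power_mono[OF F(1), of 3] by (simp add: power3_eq_cube)
    then have "\<bar>- 2 / (1 + vsol x) ^ 3\<bar> \<le> 2 / (1/8)" using F by (subst abs_divide) (intro frac_le, auto)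
    then have c: "(- 2 / (1 + vsol x) ^ 3)\<^sup>2 \<le> 256"
      using power_mono[of "\<bar>- 2 / (1 + vsol x) ^ 3\<bar>" 16 2, unfolded power2_abs] by simp
    have "grad_dfac x \<bullet> grad_dfac x + (x \<bullet> grad_dfac x)\<^sup>2 = (- 2 / (1 + vsol x) ^ 3)\<^sup>2 * (grad_v x \<bullet> grad_v x + (x \<bullet> grad_v x)\<^sup>2)"
      by (simp add: grad_dfac_def power2_eq_square distrib_left)
    also have "\<dots> \<le> 256 * ((s ^ CARD('n))\<^sup>2 * M)" by (intro mult_mono c gr) auto
    finally have g: "grad_dfac x \<bullet> grad_dfac x + (x \<bullet> grad_dfac x)\<^sup>2 \<le> (256 * M) * (s ^ CARD('n))\<^sup>2" by (simp add: mult_ac)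
    have cov: "cov_deriv_norm hyp_metric (dev) x = sqrt (real CARD('n) * (grad_dfac x \<bullet> grad_dfac x + (x \<bullet> grad_dfac x)\<^sup>2))"
      by (rule cov_deriv_norm_conformal, rule cov_deriv_conformal[OF open_far_region far(1) deviation dfac_has_derivative[OF far(1)]])
    have "cov_deriv_norm hyp_metric (dev) x \<le> sqrt (real CARD('n) * ((256 * M) * (s ^ CARD('n))\<^sup>2))"
      unfolding cov by (intro real_sqrt_le_mono mult_left_mono g) simp
    also have "\<dots> = sqrt (real CARD('n) * (256 * M)) * s ^ CARD('n)"
      using s by (simp add: real_sqrt_mult mult_ac)
    finally have 2: "cov_deriv_norm hyp_metric (dev) x \<le> sqrt (real CARD('n) * (256 * M)) * s ^ CARD('n)" .
    have 1: "tensor_norm hyp_metric (dev) x \<le> sqrt (real CARD('n)) * (10 * C0) * s ^ CARD('n)"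
      unfolding tensor_norm_conformal[of "dev" x, OF deviation]
      using mult_left_mono[OF h, of "sqrt (real CARD('n))"] by (simp add: mult_ac)
    have "s \<le> 1 / norm x" using far by (simp add: s_def pos_le_divide_eq)
    then have "s ^ CARD('n) \<le> (1 / norm x) ^ CARD('n)" using s by (intro power_mono) auto
    also have "\<dots> = norm x powr (- real CARD('n))"
      using far by (simp add: powr_minus powr_realpow power_divide inverse_eq_divide)
    finally have sn: "s ^ CARD('n) \<le> norm x powr (- real CARD('n))" .
    have "0 \<le> M" by (simp add: M_def)
    then have K: "0 \<le> K" using C0 by (simp add: K_def)
    have "tensor_norm hyp_metric (dev) x
       + cov_deriv_norm hyp_metric (dev) x \<le> K * s ^ CARD('n)"
      using 1 2 by (simp add: K_def algebra_simps)
    also have "\<dots> \<le> K * norm x powr (- real CARD('n))" using sn K by (rule mult_left_mono)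
    finally show ?thesis .
  qed
  have nn: "0 \<le> tensor_norm hyp_metric (dev) x
       + cov_deriv_norm hyp_metric (dev) x" if x: "2 / A \<le> norm x" for x
  proof -
    have cov: "cov_deriv_norm hyp_metric (dev) x = sqrt (real CARD('n) * (grad_dfac x \<bullet> grad_dfac x + (x \<bullet> grad_dfac x)\<^sup>2))"
      by (rule cov_deriv_norm_conformal, rule cov_deriv_conformal[OF open_far_region sfun_far(1)[OF x] deviation dfac_has_derivative[OF sfun_far(1)[OF x]]])
    show ?thesis
      unfolding cov tensor_norm_conformal[of "dev" x, OF deviation] by simp
  qed
  show ?thesis
    unfolding asymptotic_decay_def
  proof (rule bigoI[of _ K])
    show "\<forall>\<^sub>F x in at_infinity. norm (tensor_norm hyp_metric (dev) x
       + cov_deriv_norm hyp_metric (dev) x) \<le> K * norm (norm x powr - real CARD('n))"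
      unfolding eventually_at_infinity
    proof (intro exI allI impI)
      fix x :: "real^'n" assume "2 / A \<le> norm x"
      then show "norm (tensor_norm hyp_metric (dev) x
       + cov_deriv_norm hyp_metric (dev) x) \<le> K * norm (norm x powr - real CARD('n))"
        using bound nn by simp
    qed
  qed
qed

section \<open>The charge integrals and their limit\<close>

definition H1 :: "real \<Rightarrow> real \<Rightarrow> real"
  where "H1 s t = - (1 - s\<^sup>2) * G1 s t + s\<^sup>2 * t * G2 s t"

definition Ffun :: "real \<Rightarrow> real \<Rightarrow> real"
  where "Ffun s t = 1 + s ^ CARD('n) * G0 s t"

text \<open>What is left of the flux density once all powers of s and r have been collected: a
  function of (s, t) that is continuous at s = 0, so the limit at infinity is an evaluation
  there.\<close>

definition charge_charge_dens :: "real \<Rightarrow> real \<Rightarrow> real \<Rightarrow> real"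
  where "charge_charge_dens c s t = (1 - real CARD('n)) *
    (- 2 / (Ffun s t) ^ 3 * H1 s t + (1 - c * s\<^sup>2) * (G0 s t * (1 + Ffun s t) / (Ffun s t)\<^sup>2))"

lemma Ffun_pos: "\<bar>s\<bar> < A \<Longrightarrow> \<bar>t\<bar> \<le> B \<Longrightarrow> 1/2 \<le> Ffun s t"
  using half[of s t] factor(1)[of s t] unfolding Ffun_def by simp

lemma G_continuous:
  defines "D \<equiv> {-A<..<A} \<times> {-B<..<B}"
  shows "continuous_on D (\<lambda>z. G0 (fst z) (snd z))" "continuous_on D (\<lambda>z. G1 (fst z) (snd z))"
    "continuous_on D (\<lambda>z. G2 (fst z) (snd z))"
  unfolding D_def G0_def G1_def G2_def
  by (intro continuous_intros pser_continuous q_conv pser_conv_ds pser_conv_dt)+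

lemma charge_dens_continuous: "continuous_on ({-A<..<A} \<times> {-B<..<B}) (\<lambda>z. charge_charge_dens c (fst z) (snd z))"
proof -
  have "Ffun (fst z) (snd z) \<noteq> 0" if "z \<in> {-A<..<A} \<times> {-B<..<B}" for z
    using Ffun_pos[of "fst z" "snd z"] that by force
  then have nz: "1 + fst z ^ CARD('n) * G0 (fst z) (snd z) \<noteq> 0" if "z \<in> {-A<..<A} \<times> {-B<..<B}" for z
    using that unfolding Ffun_def by blast
  show ?thesis
    unfolding charge_charge_dens_def H1_def Ffun_def
    by (intro continuous_intros G_continuous) (use nz in auto)
qed

text \<open>At s = 0 one has F = 1, \<open>G0\<close> = P and \<open>H1\<close> = -nP. The term with
  dh gives 2nP, the term with h gives 2P, and (1 - n)(2n + 2) = -2(n^2 - 1).\<close>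

lemma charge_dens_0: "charge_charge_dens c 0 t = - 2 * ((real CARD('n))\<^sup>2 - 1) * poly P t"
proof -
  have "G0 0 t = poly P t" by (simp add: G0_def q_def pser_at_0 vcoef_start)
  moreover have "G1 0 t = real CARD('n) * poly P t"
    by (simp add: G1_def q_def pser_at_0 vcoef_start)
  moreover have "Ffun 0 t = 1" by (simp add: Ffun_def power_0_left)
  ultimately show ?thesis
    by (simp add: charge_charge_dens_def H1_def power2_eq_square algebra_simps)
qed

lemma static_potential_has_derivative:
  fixes x :: "real^'n"
  shows
  "(static_potential None has_derivative (\<lambda>h. (sfun x *\<^sub>R x) \<bullet> h)) (at x)"
  "(static_potential (Some i) has_derivative (\<lambda>h. axis i 1 \<bullet> h)) (at x)"
proof -
  have N: "static_potential None = (\<lambda>x :: real^'n. sqrt (1 + x \<bullet> x))"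
    by (simp add: fun_eq_iff power2_norm_eq_inner)
  show "(static_potential None has_derivative (\<lambda>h. (sfun x *\<^sub>R x) \<bullet> h)) (at x)"
    unfolding N using sqrt_one_plus_has_derivative[of x] by (simp add: sfun_def)
  have S: "static_potential (Some i) = (\<lambda>x :: real^'n. x $ i)" by (simp add: fun_eq_iff)
  show "(static_potential (Some i) has_derivative (\<lambda>h. axis i 1 \<bullet> h)) (at x)"
    unfolding S using vec_nth_has_derivative[of i "at x"] by (simp add: inner_axis_1 inner_commute[of "axis i 1"])
qed

text \<open>Power count: s^n from the solution, 1/(s r) from the normal, 1/s or r from the
  potential, r^(n-1) from the area. All powers combine into one of s r, which is bounded by
  1.\<close>

lemma charge_formula:
  assumes x: "2 / A \<le> norm x"
  shows "norm x ^ (CARD('n) - 1) * charge_form (static_potential \<mu>) (dev) x (sphere_normal x)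
    = (sfun x * norm x) ^ mode_exp \<mu> * harmonic1 \<mu> (sgn x) * charge_charge_dens (mode_par \<mu>) (sfun x) (tfun w x)"
proof -
  note far = sfun_far[OF x]
  define s t r where "s = sfun x" and "t = tfun w x" and "r = norm x"
  have s: "\<bar>s\<bar> < A" "0 < s" using far sfun_pos[of x] A_pos by (auto simp: s_def)
  have t: "\<bar>t\<bar> \<le> B" unfolding t_def by (rule tfun_B)
  have r: "0 < r" using far by (simp add: r_def)
  note fac = factor[OF s(1) t]
  obtain m where m: "CARD('n) = m + 2" using dim that[of "CARD('n) - 2"] by simp
  define F where "F = Ffun s t"
  have F: "F \<noteq> 0" "1 + vsol x = F"
    using Ffun_pos[OF s(1) t] fac(1) by (auto simp: F_def Ffun_def vsol_def s_def t_def)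
  have vF: "vsol x = s ^ CARD('n) * G0 s t" using fac(1) by (simp add: vsol_def s_def t_def)
  have xD: "x \<bullet> grad_v x = s ^ CARD('n) * H1 s t"
    unfolding x_grad_v[OF far(1)] s_def[symmetric] t_def[symmetric] fac H1_def by (simp add: algebra_simps)
  have dx: "grad_dfac x \<bullet> x = s ^ CARD('n) * (- 2 / F ^ 3 * H1 s t)"
    by (simp add: grad_dfac_def F(2) xD inner_commute[of "grad_v x"])
  have hx: "dfac x = - (s ^ CARD('n) * (G0 s t * (1 + F) / F\<^sup>2))"
    unfolding dfac_eq[OF far(1)] F(2) by (simp add: vF) (simp add: F(2)[symmetric] vF algebra_simps)
  have nu: "sphere_normal x = (1 / (s * r)) *\<^sub>R x"
    by (simp add: sphere_normal_def s_def sfun_def r_def power2_norm_eq_inner)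
  have s2: "s\<^sup>2 * r\<^sup>2 = 1 - s\<^sup>2"
    using sfun_sq[of x] by (simp add: s_def r_def power2_norm_eq_inner algebra_simps)
  note chf = charge_form_conformal[OF open_far_region far(1) deviation dfac_has_derivative[OF far(1)]]
  show ?thesis
  proof (cases \<mu>)
    case None
    have sp: "static_potential None x = 1 / s"
      by (simp add: s_def sfun_def power2_norm_eq_inner)
    have "charge_form (static_potential None) (dev) x (sphere_normal x)
      = (1 - real CARD('n)) * (1 / (s * r)) * (1 / s * (grad_dfac x \<bullet> x) - dfac x * (s * r\<^sup>2))"
    proof -
      have i: "grad_dfac x \<bullet> ((1 / (s * r)) *\<^sub>R x) = 1 / (s * r) * (grad_dfac x \<bullet> x)"
        "(s *\<^sub>R x) \<bullet> ((1 / (s * r)) *\<^sub>R x) = 1 / (s * r) * (s * r\<^sup>2)"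
        by (simp_all add: r_def power2_norm_eq_inner)
      show ?thesis
        unfolding chf[OF static_potential_has_derivative(1)] sp nu s_def[symmetric] i by (simp add: right_diff_distrib mult_ac)
    qed
    also have "\<dots> = (1 - real CARD('n)) * (1 / (s * r)) * s ^ m * s *
        (- 2 / F ^ 3 * H1 s t + (s\<^sup>2 * r\<^sup>2) * (G0 s t * (1 + F) / F\<^sup>2))"
    proof -
      have "(1 - k) * c * (1 / s * (s ^ (m + 2) * a) - - (s ^ (m + 2) * b) * (s * r\<^sup>2)) =
          (1 - k) * c * s ^ m * s * (a + s\<^sup>2 * r\<^sup>2 * b)" for k a b c :: real
      proof -
        have e: "1 / s * (s ^ (m + 2) * a) = s ^ m * s * a" using s by (simp add: power_add power2_eq_square)
        show ?thesis unfolding e by (simp add: power_add power2_eq_square algebra_simps)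
      qed
      then show ?thesis unfolding dx hx m by blast
    qed
    finally have "r ^ (CARD('n) - 1) * charge_form (static_potential None) (dev) x (sphere_normal x)
      = r ^ (m + 1) * (1 / (s * r)) * s ^ m * s * ((1 - real CARD('n)) *
        (- 2 / F ^ 3 * H1 s t + (1 - s\<^sup>2) * (G0 s t * (1 + F) / F\<^sup>2)))"
      unfolding s2 by (simp add: m)
    also have "r ^ (m + 1) * (1 / (s * r)) * s ^ m * s = (s * r) ^ m"
      using s r by (simp add: power_mult_distrib)
    finally show ?thesis
      unfolding None r_def[symmetric] s_def[symmetric] t_def[symmetric]
      by (simp add: mode_exp_def harmonic1_def mode_par_def charge_charge_dens_def F_def m del: static_potential.simps)
  next
    case (Some i)
    have "charge_form (static_potential (Some i)) (dev) x (sphere_normal x)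
      = (1 - real CARD('n)) * (1 / (s * r)) * (x $ i * (grad_dfac x \<bullet> x) - dfac x * x $ i)"
      unfolding chf[OF static_potential_has_derivative(2)] nu
      by (simp add: inner_commute[of "axis i 1"] inner_axis_1 algebra_simps)
    also have "\<dots> = (1 - real CARD('n)) * (1 / (s * r)) * s ^ (m + 1) * s * x $ i *
        (- 2 / F ^ 3 * H1 s t + G0 s t * (1 + F) / F\<^sup>2)"
    proof -
      have "(1 - k) * c * (y * (s ^ (m + 2) * a) - - (s ^ (m + 2) * b) * y) =
          (1 - k) * c * s ^ (m + 1) * s * y * (a + b)" for k a b c y :: real
        by (simp add: power_add power2_eq_square algebra_simps)
      then show ?thesis unfolding dx hx m by blast
    qed
    finally have "r ^ (CARD('n) - 1) * charge_form (static_potential (Some i)) (dev) x (sphere_normal x)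
      = (r ^ (m + 1) * (1 / s) * s ^ (m + 1) * s) * (x $ i / r) * ((1 - real CARD('n)) *
        (- 2 / F ^ 3 * H1 s t + G0 s t * (1 + F) / F\<^sup>2))"
      by (simp add: m)
    also have "r ^ (m + 1) * (1 / s) * s ^ (m + 1) * s = (s * r) ^ (m + 1)"
      using s by (simp add: power_mult_distrib)
    also have "x $ i / r = sgn x $ i" by (simp add: sgn_vec_def r_def divide_inverse)
    finally show ?thesis
      unfolding Some r_def[symmetric] s_def[symmetric] t_def[symmetric]
      by (simp add: mode_exp_def harmonic1_def mode_par_def charge_charge_dens_def F_def m del: static_potential.simps)
  qed
qed

end

text \<open>At \<open>x = 0\<close> the projected point is \<open>0\<close>, which the indicator of the sphere discards.\<close>

lemma set_lebesgue_integral_sphere: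
  fixes f :: "real^'n \<Rightarrow> real"
  assumes R: "0 < R" and f: "(\<lambda>x. indicator (sphere 0 R) x * f x) \<in> borel_measurable borel"
  shows "(LINT x : sphere 0 R | sphere_measure R. f x) =
    (LINT x|lborel. (R ^ (CARD('n) - 1) * real CARD('n) * indicator (ball 0 1) x) *
       (indicator (sphere 0 R) ((R / norm x) *\<^sub>R x) * f ((R / norm x) *\<^sub>R x)))"
proof -
  have m: "(\<lambda>x :: real^'n. (R / norm x) *\<^sub>R x) \<in> borel_measurable borel" by measurable
  have m': "(\<lambda>x :: real^'n. (R / norm x) *\<^sub>R x) \<in> density lborel (\<lambda>x. ennreal (R ^ (CARD('n) - 1) * real CARD('n) * indicator (ball 0 1) x)) \<rightarrow>\<^sub>M borel"
    using m by simp
  have "(LINT x : sphere 0 R | sphere_measure R. f x) =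
     (LINT x|density lborel (\<lambda>x. ennreal (R ^ (CARD('n) - 1) * real CARD('n) * indicator (ball 0 1) x)).
        indicator (sphere 0 R) ((R / norm x) *\<^sub>R x) * f ((R / norm x) *\<^sub>R x))"
    unfolding set_lebesgue_integral_def sphere_measure_def real_scaleR_def
    by (rule integral_distr[OF m' f])
  also have "\<dots> = (LINT x|lborel. (R ^ (CARD('n) - 1) * real CARD('n) * indicator (ball 0 1) x) *\<^sub>R
       (indicator (sphere 0 R) ((R / norm x) *\<^sub>R x) * f ((R / norm x) *\<^sub>R x)))"
  proof (rule integral_density)
    show "(\<lambda>x. indicator (sphere 0 R) ((R / norm x) *\<^sub>R x) * f ((R / norm x) *\<^sub>R x)) \<in> borel_measurable lborel"
      using measurable_compose[OF m f] by simp
    show "AE x in lborel. 0 \<le> R ^ (CARD('n) - 1) * real CARD('n) * indicator (ball 0 1) (x :: real^'n)"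
      using R by simp
    show "(\<lambda>x :: real^'n. R ^ (CARD('n) - 1) * real CARD('n) * indicator (ball 0 1) x) \<in> borel_measurable lborel"
      unfolding measurable_lborel1
      by (intro borel_measurable_times borel_measurable_const borel_measurable_indicator) simp
  qed
  finally show ?thesis by simp
qed

lemma harmonic1_sgn_measurable: "(\<lambda>x :: real^'n. harmonic1 \<mu> (sgn x)) \<in> borel_measurable borel"
  unfolding harmonic1_def sgn_vec_def by (cases \<mu>) auto

lemma harmonic1_sgn_bound: "\<bar>harmonic1 \<mu> (sgn (x :: real^'n))\<bar> \<le> 1"
proof (cases \<mu>)
  case (Some i)
  have "\<bar>sgn x $ i\<bar> \<le> norm (sgn x)" by (rule component_le_norm_cart)
  also have "\<dots> \<le> 1" by (simp add: norm_sgn)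
  finally show ?thesis by (simp add: harmonic1_def Some)
qed (simp add: harmonic1_def)

lemma integrable_indicator_ball: "integrable lborel (indicator (ball 0 1) :: real^'n \<Rightarrow> real)"
  by (rule integrable_real_indicator) (simp_all add: emeasure_bounded_finite[unfolded infinity_ennreal_def])

lemma sfun_scale_sgn: "x \<noteq> 0 \<Longrightarrow> 0 \<le> R \<Longrightarrow> sfun (R *\<^sub>R sgn (x :: real^'n)) = 1 / sqrt (1 + R\<^sup>2)"
proof -
  assume x: "x \<noteq> 0"
  have "sgn x \<bullet> sgn x = 1" using x by (simp add: norm_sgn flip: norm_eq_1)
  then show ?thesis by (simp add: sfun_def power2_eq_square)
qed

context ah_end begin

text \<open>The charge form is built from derivatives chosen pointwise, so its measurability is not
  evident. On the sphere it agrees with the continuous expression of \<open>charge_formula\<close>,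
  and the indicator removes the rest.\<close>

lemma charge_measurable:
  assumes R: "2 / A \<le> R"
  shows "(\<lambda>x. indicator (sphere 0 R) x *
    charge_form (static_potential \<mu>) (dev) x (sphere_normal x)) \<in> borel_measurable borel"
proof -
  define f where "f x = (sfun x * norm x) ^ mode_exp \<mu> * harmonic1 \<mu> (sgn x) * charge_charge_dens (mode_par \<mu>) (sfun x) (tfun w x) / norm x ^ (CARD('n) - 1)" for x
  have R0: "0 < R" using R A_pos by (meson divide_pos_pos less_le_trans zero_less_numeral)
  have cs: "continuous_on UNIV (sfun :: real^'n \<Rightarrow> real)" "continuous_on UNIV (tfun w)"
    using Ck_on_sfun[of 0, where 'a = 'n] Ck_on_tfun[of 0 w] by (simp_all add: Ck_on.simps)
  have "continuous_on (sphere 0 R) (\<lambda>x. charge_charge_dens (mode_par \<mu>) (fst (sfun x, tfun w x)) (snd (sfun x, tfun w x)))"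
  proof (rule continuous_on_compose2[OF charge_dens_continuous])
    show "continuous_on (sphere 0 R) (\<lambda>x. (sfun x, tfun w x))"
      using cs continuous_on_subset by (intro continuous_intros) blast+
    show "(\<lambda>x. (sfun x, tfun w x)) ` sphere 0 R \<subseteq> {-A<..<A} \<times> {-B<..<B}"
    proof (rule image_subsetI)
      fix x :: "real^'n" assume "x \<in> sphere 0 R"
      then have "x \<in> far_region" using sfun_far(1)[of x] R by simp
      then show "(sfun x, tfun w x) \<in> {-A<..<A} \<times> {-B<..<B}" using sfun_A[of x] tfun_B(1)[of x] by auto
    qed
  qed
  moreover have "continuous_on (sphere 0 R) (\<lambda>x. harmonic1 \<mu> (sgn x))"
  proof -
    have "continuous_on (sphere 0 R) (\<lambda>x :: real^'n. sgn x)"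
      using R0 by (intro continuous_on_sgn continuous_on_id) auto
    then show ?thesis unfolding harmonic1_def by (cases \<mu>) (auto intro!: continuous_intros)
  qed
  ultimately have "continuous_on (sphere 0 R) f"
    unfolding f_def using R0 continuous_on_subset[OF cs(1) subset_UNIV, of "sphere 0 R"]
    by (intro continuous_intros) auto
  then have "(\<lambda>x. indicator (sphere 0 R) x *\<^sub>R f x) \<in> borel_measurable borel"
    by (intro borel_measurable_continuous_on_indicator) auto
  moreover have "indicator (sphere 0 R) x *\<^sub>R f x = indicator (sphere 0 R) x *
    charge_form (static_potential \<mu>) (dev) x (sphere_normal x)" for x
  proof (cases "x \<in> sphere 0 R")
    case True
    then have "f x = charge_form (static_potential \<mu>) (dev) x (sphere_normal x)"
      unfolding f_def using charge_formula[of x \<mu>] R R0 by (simp add: divide_eq_eq mult.commute)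
    then show ?thesis by simp
  qed simp
  ultimately show ?thesis by (simp only:)
qed

definition limit_density :: "'n option \<Rightarrow> real^'n \<Rightarrow> real"
  where "limit_density \<mu> x = real CARD('n) * indicator (ball 0 1) x *
    (harmonic1 \<mu> (sgn x) * (- 2 * ((real CARD('n))\<^sup>2 - 1) * poly P (w \<bullet> sgn x)))"

text \<open>All spheres are parametrised by directions from one fixed ball, after which the limit is
  dominated convergence over that ball.\<close>

lemma charge_limit:
  "((\<lambda>R. LINT x : sphere 0 R | sphere_measure R.
      charge_form (static_potential \<mu>) (dev) x (sphere_normal x))
    \<longlongrightarrow> (LINT x|lborel. limit_density \<mu> x)) at_top"
proof -
  let ?s = "\<lambda>R :: real. 1 / sqrt (1 + R\<^sup>2)"
  let ?c = "\<lambda>x. charge_form (static_potential \<mu>) (dev) x (sphere_normal x)"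
  define g where "g R x = (if 2 / A \<le> R then (R ^ (CARD('n) - 1) * real CARD('n) * indicator (ball 0 1) x) *
       (indicator (sphere 0 R) ((R / norm x) *\<^sub>R x) * ?c ((R / norm x) *\<^sub>R x)) else 0)" for R and x :: "real^'n"
  have A2: "0 < 2 / A" using A_pos by simp
  \<comment> \<open>Inside the ball the integrand depends on x only through its direction, since the
    point of evaluation is R times \<open>sgn x\<close>.\<close>
  have g_eq: "g R x = real CARD('n) * indicator (ball 0 1) x * ((?s R * R) ^ mode_exp \<mu> * harmonic1 \<mu> (sgn x) *
      charge_charge_dens (mode_par \<mu>) (?s R) (?s R * R * (w \<bullet> sgn x)))"
    and g_dom: "0 \<le> ?s R" "?s R \<le> A / 2" "\<bar>?s R * R * (w \<bullet> sgn x)\<bar> \<le> norm w"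
      "0 \<le> ?s R * R" "?s R * R \<le> 1"
    if R: "2 / A \<le> R" and x: "x \<noteq> 0" for R and x :: "real^'n"
  proof -
    have R0: "0 < R" using R A2 by linarith
    define y where "y = R *\<^sub>R sgn x"
    have y: "norm y = R" using R0 x by (simp add: y_def norm_sgn)
    have yx: "(R / norm x) *\<^sub>R x = y" by (simp add: y_def sgn_vec_def divide_inverse)
    have sy: "sfun y = ?s R" unfolding y_def using x R0 by (intro sfun_scale_sgn) auto
    have ty: "tfun w y = ?s R * R * (w \<bullet> sgn x)" by (simp add: tfun_def sy) (simp add: y_def)
    have "norm (sgn x) = 1" using x by (simp add: norm_sgn)
    then have "sgn (sgn x) = sgn x" by (subst sgn_vec_def) simp
    then have gy: "sgn y = sgn x" using R0 by (simp add: y_def sgn_scaleR)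
    have far: "2 / A \<le> norm y" using R y by simp
    note f = sfun_far[OF far, unfolded sy y]
    have "g R x = real CARD('n) * indicator (ball 0 1) x * (R ^ (CARD('n) - 1) * ?c y)"
      using R y by (simp add: g_def yx)
    then show "g R x = real CARD('n) * indicator (ball 0 1) x * ((?s R * R) ^ mode_exp \<mu> * harmonic1 \<mu> (sgn x) *
      charge_charge_dens (mode_par \<mu>) (?s R) (?s R * R * (w \<bullet> sgn x)))"
      unfolding charge_formula[OF far, of \<mu>, unfolded sy ty gy y] .
    show "0 \<le> ?s R" by simp
    then show "?s R \<le> A / 2" using f(2) by linarith
    show "\<bar>?s R * R * (w \<bullet> sgn x)\<bar> \<le> norm w" using tfun_le[of w y] unfolding ty .
    show "0 \<le> ?s R * R" using R0 by simp
    show "?s R * R \<le> 1" using f(3) .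
  qed
  \<comment> \<open>Compact because s = 0 is included: the continuous density is bounded on it,
    which gives a dominating function independent of R.\<close>
  let ?K = "{0..A/2} \<times> {- norm w..norm w}"
  have "?K \<subseteq> {-A<..<A} \<times> {-B<..<B}" using A_pos by auto
  then have "compact ((\<lambda>z. charge_charge_dens (mode_par \<mu>) (fst z) (snd z)) ` ?K)"
    by (intro compact_continuous_image[OF continuous_on_subset[OF charge_dens_continuous]] compact_Times compact_Icc)
  then have "bounded ((\<lambda>z. charge_charge_dens (mode_par \<mu>) (fst z) (snd z)) ` ?K)" by (rule compact_imp_bounded)
  then obtain C where "\<forall>y \<in> (\<lambda>z. charge_charge_dens (mode_par \<mu>) (fst z) (snd z)) ` ?K. norm y \<le> C"
    unfolding bounded_iff by blast
  then have C: "\<bar>charge_charge_dens (mode_par \<mu>) (fst z) (snd z)\<bar> \<le> C" if "z \<in> ?K" for z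
    using that by (auto simp: mem_Times_iff)
  have "(0, 0) \<in> ?K" using A_pos by simp
  from order.trans[OF abs_ge_zero C[OF this]] have C0: "0 \<le> C" .
  have AE0: "AE x :: real^'n in lborel. x \<noteq> 0" by (rule AE_lborel_singleton)
  have lim: "((\<lambda>R. LINT x|lborel. g R x) \<longlongrightarrow> (LINT x|lborel. limit_density \<mu> x)) at_top"
  proof (rule integral_dominated_convergence_at_top)
    show "integrable lborel (\<lambda>x :: real^'n. real CARD('n) * indicator (ball 0 1) x * C)"
      by (intro integrable_mult_left integrable_mult_right integrable_indicator_ball)
    show "\<forall>\<^sub>F R in at_top. AE x in lborel. norm (g R x) \<le> real CARD('n) * indicator (ball 0 1) x * C"
      using eventually_ge_at_top[of "2 / A"]
    proof eventually_elim
      case (elim R)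
      show ?case
        using AE0
      proof eventually_elim
        case (elim x)
        note d = g_dom[OF \<open>2 / A \<le> R\<close> elim]
        have "\<bar>charge_charge_dens (mode_par \<mu>) (?s R) (?s R * R * (w \<bullet> sgn x))\<bar> \<le> C"
        proof -
          have "(?s R, ?s R * R * (w \<bullet> sgn x)) \<in> ?K"
            unfolding mem_Sigma_iff atLeastAtMost_iff using d(1,2,3) by (intro conjI; linarith)
          from C[OF this] show ?thesis unfolding fst_conv snd_conv .
        qed
        moreover have "\<bar>(?s R * R) ^ mode_exp \<mu>\<bar> \<le> 1"
          using d power_le_one[of "?s R * R" "mode_exp \<mu>"] by (simp only: abs_of_nonneg zero_le_power)
        ultimately have "\<bar>(?s R * R) ^ mode_exp \<mu> * harmonic1 \<mu> (sgn x) *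
            charge_charge_dens (mode_par \<mu>) (?s R) (?s R * R * (w \<bullet> sgn x))\<bar> \<le> 1 * 1 * C"
          unfolding abs_mult using C0 by (intro mult_mono harmonic1_sgn_bound) auto
        then show ?case
          unfolding g_eq[OF \<open>2 / A \<le> R\<close> elim] real_norm_def
          by (subst abs_mult) (auto intro!: mult_left_mono simp: abs_mult indicator_def)
      qed
    qed
    show "AE x in lborel. ((\<lambda>R. g R x) \<longlongrightarrow> limit_density \<mu> x) at_top"
      using AE0
    proof eventually_elim
      case (elim x)
      have s0: "(?s \<longlongrightarrow> 0) at_top" by real_asymp
      have s1: "((\<lambda>R :: real. ?s R * R) \<longlongrightarrow> 1) at_top" by real_asymp
      have wx: "\<bar>w \<bullet> sgn x\<bar> \<le> norm w"
        using Cauchy_Schwarz_ineq2[of w "sgn x"] elim by (simp add: norm_sgn)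
      have "((\<lambda>R. charge_charge_dens (mode_par \<mu>) (fst (?s R, ?s R * R * (w \<bullet> sgn x)))
          (snd (?s R, ?s R * R * (w \<bullet> sgn x))))
          \<longlongrightarrow> charge_charge_dens (mode_par \<mu>) (fst (0, 1 * (w \<bullet> sgn x))) (snd (0 :: real, 1 * (w \<bullet> sgn x)))) at_top"
      proof (rule continuous_on_tendsto_compose[OF charge_dens_continuous])
        show "((\<lambda>R. (?s R, ?s R * R * (w \<bullet> sgn x))) \<longlongrightarrow> (0, 1 * (w \<bullet> sgn x))) at_top"
          by (intro tendsto_Pair tendsto_mult s0 s1 tendsto_const)
        show "(0, 1 * (w \<bullet> sgn x)) \<in> {-A<..<A} \<times> {-B<..<B}" using wx A_pos by auto
        show "\<forall>\<^sub>F R in at_top. (?s R, ?s R * R * (w \<bullet> sgn x)) \<in> {-A<..<A} \<times> {-B<..<B}"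
          using eventually_ge_at_top[of "2 / A"]
        proof eventually_elim
          case (elim R)
          note d = g_dom[OF elim \<open>x \<noteq> 0\<close>]
          show ?case
            unfolding mem_Sigma_iff greaterThanLessThan_iff using d(1,2,3) A_pos by (intro conjI; linarith)
        qed
      qed
      then have "((\<lambda>R. real CARD('n) * indicator (ball 0 1) x * ((?s R * R) ^ mode_exp \<mu> * harmonic1 \<mu> (sgn x) *
        charge_charge_dens (mode_par \<mu>) (?s R) (?s R * R * (w \<bullet> sgn x)))) \<longlongrightarrow>
        real CARD('n) * indicator (ball 0 1) x * (1 ^ mode_exp \<mu> * harmonic1 \<mu> (sgn x) * charge_charge_dens (mode_par \<mu>) 0 (w \<bullet> sgn x))) at_top"
        by (intro tendsto_mult tendsto_const tendsto_power s1) simp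
      then have "((\<lambda>R. real CARD('n) * indicator (ball 0 1) x * ((?s R * R) ^ mode_exp \<mu> * harmonic1 \<mu> (sgn x) *
        charge_charge_dens (mode_par \<mu>) (?s R) (?s R * R * (w \<bullet> sgn x)))) \<longlongrightarrow> limit_density \<mu> x) at_top"
        unfolding limit_density_def charge_dens_0 by simp
      then show ?case
        by (rule Lim_transform_eventually)
          (use eventually_ge_at_top[of "2 / A"] in \<open>eventually_elim, simp only: g_eq[OF _ elim]\<close>)
    qed
    show "g R \<in> borel_measurable lborel" for R
    proof (cases "2 / A \<le> R")
      case True
      have m: "(\<lambda>x :: real^'n. (R / norm x) *\<^sub>R x) \<in> borel_measurable borel" by measurable
      show ?thesis
        unfolding g_def using True measurable_compose[OF m charge_measurable[OF True, of \<mu>]]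
        by (auto intro!: borel_measurable_times borel_measurable_indicator)
    qed (simp add: g_def[abs_def])
    have "(\<lambda>x :: real^'n. poly P (w \<bullet> sgn x)) \<in> borel_measurable borel"
    proof -
      have "poly P \<in> borel_measurable borel" by (intro borel_measurable_continuous_onI continuous_on_poly continuous_on_id)
      moreover have "(\<lambda>x :: real^'n. w \<bullet> sgn x) \<in> borel_measurable borel" unfolding sgn_vec_def by measurable
      ultimately show ?thesis using measurable_compose by blast
    qed
    then show "limit_density \<mu> \<in> borel_measurable lborel"
      unfolding limit_density_def[abs_def] using harmonic1_sgn_measurable[of \<mu>]
      by (auto intro!: borel_measurable_times borel_measurable_indicator)
  qed
  show ?thesis
  proof (rule Lim_transform_eventually[OF lim])
    show "\<forall>\<^sub>F R in at_top. (LINT x|lborel. g R x) = (LINT x : sphere 0 R | sphere_measure R. ?c x)"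
      using eventually_ge_at_top[of "2 / A"]
    proof eventually_elim
      case (elim R)
      then have R0: "0 < R" using A2 by linarith
      show ?case
        unfolding set_lebesgue_integral_sphere[OF R0 charge_measurable[OF elim]] g_def using elim by simp
    qed
  qed
qed

end

section \<open>Prescribing the moments\<close>

definition mode :: "real^('n option) \<Rightarrow> real^'n \<Rightarrow> real"
  where "mode c x = (\<Sum>\<nu>\<in>UNIV. c $ \<nu> * harmonic1 \<nu> (sgn x))"

lemma mode_eq: "mode c x = c $ None + (\<chi> i. c $ Some i) \<bullet> sgn x"
proof -
  have "mode c x = c $ None * harmonic1 None (sgn x) + (\<Sum>\<nu>\<in>range Some. c $ \<nu> * harmonic1 \<nu> (sgn x))"
    unfolding mode_def UNIV_option_conv by (subst sum.insert) auto
  also have "(\<Sum>\<nu>\<in>range Some. c $ \<nu> * harmonic1 \<nu> (sgn x)) = (\<Sum>i\<in>UNIV. c $ Some i * sgn x $ i)"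
    by (subst sum.reindex) (auto simp: harmonic1_def)
  finally show ?thesis by (simp add: harmonic1_def inner_vec_def)
qed

text \<open>The Gram matrix is injective because its quadratic form is the integral of the square of
  \<open>mode c\<close>; being square it is then surjective.\<close>

lemma moments_surjective:
  fixes p :: "real^('n::finite option)"
  obtains c :: "real^('n option)"
  where "\<And>\<mu>. (LINT x : ball 0 1 | lborel. harmonic1 \<mu> (sgn x) * mode c (x :: real^'n)) = p $ \<mu>"
proof -
  let ?ind = "\<lambda>x :: real^'n. indicator (ball 0 1) x :: real"
  define M :: "real^('n option)^('n option)"
    where "M = (\<chi> \<mu> \<nu>. LINT x|lborel. ?ind x * (harmonic1 \<mu> (sgn x) * harmonic1 \<nu> (sgn x)))"
  have int: "integrable lborel (\<lambda>x. ?ind x * (harmonic1 \<mu> (sgn x) * harmonic1 \<nu> (sgn x)))" for \<mu> \<nu>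
  proof (rule Bochner_Integration.integrable_bound)
    show "integrable lborel ?ind" by (rule integrable_indicator_ball)
    show "(\<lambda>x. ?ind x * (harmonic1 \<mu> (sgn x) * harmonic1 \<nu> (sgn x))) \<in> borel_measurable lborel"
      unfolding measurable_lborel1
      by (intro borel_measurable_times borel_measurable_indicator) (simp_all add: harmonic1_sgn_measurable)
    show "AE x in lborel. norm (?ind x * (harmonic1 \<mu> (sgn x) * harmonic1 \<nu> (sgn x))) \<le> norm (?ind x)"
    proof (rule AE_I2)
      fix x :: "real^'n"
      have "\<bar>harmonic1 \<mu> (sgn x)\<bar> * \<bar>harmonic1 \<nu> (sgn x)\<bar> \<le> 1 * 1"
        by (intro mult_mono harmonic1_sgn_bound) auto
      then show "norm (?ind x * (harmonic1 \<mu> (sgn x) * harmonic1 \<nu> (sgn x))) \<le> norm (?ind x)"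
        by (simp add: abs_mult indicator_def)
    qed
  qed
  have Mc: "(M *v c) $ \<mu> = (LINT x|lborel. ?ind x * (harmonic1 \<mu> (sgn x) * mode c x))" for c \<mu>
  proof -
    have "(LINT x|lborel. ?ind x * (harmonic1 \<mu> (sgn x) * mode c x)) =
      (LINT x|lborel. (\<Sum>\<nu>\<in>UNIV. c $ \<nu> * (?ind x * (harmonic1 \<mu> (sgn x) * harmonic1 \<nu> (sgn x)))))"
      by (rule Bochner_Integration.integral_cong) (simp_all add: mode_def sum_distrib_left mult_ac)
    also have "\<dots> = (\<Sum>\<nu>\<in>UNIV. c $ \<nu> * M $ \<mu> $ \<nu>)"
      unfolding M_def vec_lambda_beta
      by (subst Bochner_Integration.integral_sum) (auto intro: integrable_mult_right int)
    finally show ?thesis by (simp add: matrix_vector_mult_def mult.commute)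
  qed
  have quad: "c \<bullet> (M *v c) = (LINT x|lborel. ?ind x * (mode c x)\<^sup>2)"
    and quad_int: "integrable lborel (\<lambda>x. ?ind x * (mode c x)\<^sup>2)" for c
  proof -
    have i: "integrable lborel (\<lambda>x. ?ind x * (harmonic1 \<mu> (sgn x) * mode c x))" for \<mu>
    proof -
      have "integrable lborel (\<lambda>x. \<Sum>\<nu>\<in>UNIV. c $ \<nu> * (?ind x * (harmonic1 \<mu> (sgn x) * harmonic1 \<nu> (sgn x))))"
        by (intro Bochner_Integration.integrable_sum integrable_mult_right int)
      then show ?thesis by (simp add: mode_def sum_distrib_left mult_ac)
    qed
    have e: "?ind x * (mode c x)\<^sup>2 = (\<Sum>\<mu>\<in>UNIV. c $ \<mu> * (?ind x * (harmonic1 \<mu> (sgn x) * mode c x)))" for x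
    proof -
      have "(\<Sum>\<mu>\<in>UNIV. c $ \<mu> * (?ind x * (harmonic1 \<mu> (sgn x) * mode c x))) =
        ?ind x * mode c x * (\<Sum>\<mu>\<in>UNIV. c $ \<mu> * harmonic1 \<mu> (sgn x))"
        unfolding sum_distrib_left by (rule sum.cong) (simp_all add: mult_ac)
      then show ?thesis unfolding mode_def[symmetric] by (simp add: power2_eq_square mult_ac)
    qed
    show "integrable lborel (\<lambda>x. ?ind x * (mode c x)\<^sup>2)"
      unfolding e by (intro Bochner_Integration.integrable_sum integrable_mult_right i)
    show "c \<bullet> (M *v c) = (LINT x|lborel. ?ind x * (mode c x)\<^sup>2)"
      unfolding e
      by (subst Bochner_Integration.integral_sum) (auto intro: integrable_mult_right i simp: inner_vec_def Mc)
  qed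
  have inj: "c = 0" if "M *v c = 0" for c
  proof -
    have "(LINT x|lborel. ?ind x * (mode c x)\<^sup>2) = 0" using quad[of c] that by simp
    then have ae: "AE x in lborel. ?ind x * (mode c x)\<^sup>2 = 0"
      by (subst (asm) integral_nonneg_eq_0_iff_AE[OF quad_int]) auto
    \<comment> \<open>Away from the origin \<open>mode c\<close> is continuous, so its nonvanishing
      set is open. A null open set is empty, which upgrades vanishing almost everywhere to vanishing
      everywhere in the punctured ball.\<close>
    define N where "N = (ball 0 1 - {0}) \<inter> mode c -` (- {0})"
    have "continuous_on (ball 0 1 - {0}) (\<lambda>x :: real^'n. c $ None + (\<chi> i. c $ Some i) \<bullet> sgn x)"
      by (intro continuous_intros continuous_on_sgn) auto
    then have cont: "continuous_on (ball 0 1 - {0}) (mode c)"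
      by (simp add: mode_eq[abs_def])
    have N: "open N"
      unfolding N_def by (rule continuous_open_preimage[OF cont]) (auto intro: open_Diff)
    have "emeasure lborel {x \<in> space lborel. ?ind x * (mode c x)\<^sup>2 \<noteq> 0} = 0"
      by (rule emeasure_eq_0_AE) (use ae in auto)
    moreover have "{x \<in> space lborel. ?ind x * (mode c x)\<^sup>2 \<noteq> 0} \<in> sets lborel"
    proof -
      have "(\<lambda>x. ?ind x * (mode c x)\<^sup>2) \<in> borel_measurable lborel"
        using quad_int by (rule borel_measurable_integrable)
      then show ?thesis by measurable
    qed
    ultimately have "{x \<in> space lborel. ?ind x * (mode c x)\<^sup>2 \<noteq> 0} \<in> null_sets lborel" by auto
    moreover have "N \<subseteq> {x \<in> space lborel. ?ind x * (mode c x)\<^sup>2 \<noteq> 0}" by (auto simp: N_def)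
    ultimately have "N \<in> null_sets lborel"
      using N by (intro null_sets_subset[of _ lborel N]) auto
    then have "negligible N" by (simp add: negligible_iff_null_sets null_sets_completionI)
    then have "N = {}" using open_not_negligible[OF N] by blast
    then have z: "mode c x = 0" if "norm x < 1" "x \<noteq> 0" for x using that by (auto simp: N_def)
    \<comment> \<open>Two opposite directions on an axis give c_0 + c_i = 0 and c_0 - c_i = 0; the
      factor 1/2 only places the points inside the ball.\<close>
    have ax: "c $ None + s * c $ Some i = 0" if "s = 1 \<or> s = -1" for s i
    proof -
      have "mode c ((s / 2) *\<^sub>R axis i 1) = 0" using that by (intro z) auto
      moreover have "sgn ((s / 2) *\<^sub>R axis i 1 :: real^'n) = s *\<^sub>R axis i 1"
        using that by (auto simp: sgn_vec_def)
      ultimately show ?thesis by (simp add: mode_eq inner_axis_1)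
    qed
    have "c $ None = 0" "c $ Some i = 0" for i
      using ax[of 1 i] ax[of "-1" i] by simp_all
    then show "c = 0" by (metis not_None_eq vec_eq_iff zero_index)
  qed
  have "surj ((*v) M)"
    by (rule linear_injective_imp_surjective) (use inj in \<open>auto simp: linear_injective_0[OF matrix_vector_mul_linear]\<close>)
  then obtain c where "M *v c = p" by (metis surjD)
  then have "(LINT x : ball 0 1 | lborel. harmonic1 \<mu> (sgn x) * mode c x) = p $ \<mu>" for \<mu>
    using Mc[of c \<mu>] by (simp add: set_lebesgue_integral_def)
  then show thesis by (rule that)
qed

lemma ah_end_exists:
  fixes w :: "real^'n" and P :: "real poly"
  assumes "3 \<le> CARD('n)" "degree P \<le> CARD('n)"
  obtains A where "ah_end w P A"
proof -
  have "2 \<le> CARD('n)" "1 \<le> norm w + 1" using assms by simp_all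
  from vcoef_converges[OF this(1) assms(2) this(2) inner_ge_zero[of w]]
  show thesis using that assms(1) unfolding ah_end_def by metis
qed

theorem theorem3p1:
  fixes p :: "real^('n::finite option)"
  assumes "CARD('n) \<ge> 3"
  shows "\<exists>(K :: (real^'n) set) (g :: real^'n \<Rightarrow> real^'n^'n).
    compact K \<and>
    riemannian_metric_on (- K) g \<and>
    asymptotically_hyperbolic_spherical K g \<and>
    conformally_flat_on (- K) g \<and>
    (\<forall>x\<in>- K. scalar_curvature g x = - real CARD('n) * (real CARD('n) - 1)) \<and>
    has_energy_momentum K g p"
proof -
  define N where "N = real CARD('n)"
  \<comment> \<open>The factor n of \<open>sphere_measure\<close> times the constant -2(n^2 - 1) of
    \<open>charge_dens_0\<close>; dividing the target by it leaves a pure moment problem.\<close>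
  define k where "k = - 2 * N * (N\<^sup>2 - 1)"
  have N3: "3 \<le> N" using assms by (simp add: N_def)
  have "1 < N\<^sup>2" by (rule one_less_power) (use N3 in auto)
  then have "N\<^sup>2 - 1 \<noteq> 0" "- 2 * N \<noteq> 0" using N3 by linarith+
  then have k: "k \<noteq> 0" unfolding k_def by (rule no_zero_divisors[rotated])
  obtain c where c: "\<And>\<mu>. (LINT x : ball 0 1 | lborel. harmonic1 \<mu> (sgn x) * mode c (x :: real^'n)) = ((1 / k) *\<^sub>R p) $ \<mu>"
    using moments_surjective[of "(1 / k) *\<^sub>R p"] by blast
  define w where "w = (\<chi> i. c $ Some i)"
  \<comment> \<open>With this choice P(w \<bullet> \<theta>) is \<open>mode c\<close> in the
    direction \<theta>: the time component of \<open>c\<close> is the constant term and the space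
    components form \<open>w\<close>.\<close>
  define P where "P = [:c $ None, 1:]"
  have "degree P \<le> CARD('n)" using assms by (simp add: P_def)
  from ah_end_exists[OF assms this, of w] obtain A where "ah_end w P A" .
  then interpret ah_end w P A .
  have lim: "(LINT x|lborel. limit_density \<mu> x) = p $ \<mu>" for \<mu>
  proof -
    have "limit_density \<mu> x = k * (indicator (ball 0 1) x *\<^sub>R (harmonic1 \<mu> (sgn x) * mode c x))" for x
    proof -
      have "poly P y = c $ None + y" for y by (simp add: P_def)
      then show ?thesis
        unfolding limit_density_def mode_eq w_def[symmetric] by (simp add: k_def N_def algebra_simps)
    qed
    then have "(LINT x|lborel. limit_density \<mu> x) = k * (LINT x : ball 0 1 | lborel. harmonic1 \<mu> (sgn x) * mode c x)"
      by (simp add: set_lebesgue_integral_def)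
    then show ?thesis using k by (simp add: c)
  qed
  have "has_energy_momentum core_ball ah_metric p"
    unfolding has_energy_momentum_def
  proof (intro exI conjI)
    let ?T = "{x :: real^'n. 2 / A \<le> norm x}"
    have "exterior_region core_ball ?T"
      unfolding exterior_region_def
    proof
      have "1 / A < 2 / A" using A_pos by (simp add: divide_strict_right_mono)
      then show "?T \<subseteq> - core_ball" by (auto simp: core_ball_def)
      show "bounded (- ?T)" by (rule bounded_subset[OF bounded_ball[of 0 "2 / A"]]) auto
    qed
    moreover have "diffeomorphism ?T ?T (\<lambda>x. x) (\<lambda>x. x)"
      unfolding diffeomorphism_def
      by (intro conjI homeomorphism_ident Ck_on_imp_smooth_on[OF open_UNIV subset_UNIV] Ck_on_id open_UNIV)
    ultimately show "chart_at_infinity core_ball (2 / A) (\<lambda>x. x)"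
      unfolding chart_at_infinity_def using A_pos by (intro conjI exI) auto
    show "real CARD('n) / 2 < real CARD('n)" by simp
    show "asymptotic_decay (\<lambda>x. x) ah_metric (real CARD('n))" by (rule ah_metric_decay)
    show "has_energy_momentum_in_chart (\<lambda>x. x) ah_metric p"
      unfolding has_energy_momentum_in_chart_def using charge_limit lim by simp
  qed
  moreover have "\<forall>x\<in>- core_ball. scalar_curvature ah_metric x = - real CARD('n) * (real CARD('n) - 1)"
    using compl_core_ball scalar_curvature_ah_metric by blast
  moreover have "compact core_ball" by (simp add: core_ball_def)
  ultimately show ?thesis
    using ah_metric_metric[OF compl_core_ball] ah_metric_asymptotically_hyperbolic ah_metric_conformally_flat by blast
qed

end
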